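(* Let $g_1,\ldots,g_m\in\mathbb R[x]_d$, $a_1,\ldots,a_m\in\mathbb R$, $d_1=\lceil d/2\rceil$, and assume the system $a_i\ge\langle g_i,z\rangle$ ($i=1,\ldots,m$), $z\in\mathscr R_d(K^\circ)$ is feasible. Let $R$ be generic in the interior of $\Sigma[x]_{2d_1}$. Then: (i) The problem $\min\langle R,z\rangle$ s.t. $a_i-\langle g_i,z\rangle\ge0$ ($i\in[m]$), $z\in\mathscr R_{2d_1}(K^\circ)$ has a unique minimizer $z^*$, and $z^*=\lambda_1[u_1]_{2d_1}+\cdots+\lambda_r[u_r]_{2d_1}$ with scalars $\lambda_1,\ldots,\lambda_r>0$, distinct points $u_1,\ldots,u_r\in K^\circ$, and $r\le m$. (ii) For $k\ge d_2:=\max\{d_1,d_c\}$, let $z^{(k)}$ be a minimizer of the semidefinite relaxation $$\min\ \langle R,z\rangle\ \text{ s.t. }\ a_i-\langle g_i,z\rangle\ge0\ (i\in[m]),\ L^{(k)}_{c_i^{hom}}[z]=0\ (i\in\mathcal E),\ L^{(k)}_{c_j^{hom}}[z]\succeq0\ (j\in\mathcal I),\ L^{(k)}_{x^Tx-1}[z]=0,\ M_k[z]\succeq0,\ z\in\mathbb R^{\mathbb N^n_{2k}}.$$ Then for each fixed $t\ge d_1$, the sequence $\{z^{(k)}|_{2t}\}_{k\ge d_2}$ is bounded and every accumulation point $z^{**}$ of it satisfies $z^{**}|_{2d_1}=z^*$.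
   Context: $c_i$ ($i\in\mathcal E\cup\mathcal I$) are real polynomials in $x\in\mathbb R^n$; for a polynomial $p$ of degree $e$, $p^{hom}(x)$ is its homogeneous part of degree $e$. $K^\circ=\{x\in\mathbb R^n: c_i^{hom}(x)=0\ (i\in\mathcal E),\ c_j^{hom}(x)\ge0\ (j\in\mathcal I),\ x^Tx=1\}$. $d_c=\max\{\lceil\deg(c_i)/2\rceil: i\in\mathcal E\cup\mathcal I\}$. $\mathbb N^n_t=\{\alpha:|\alpha|\le t\}$, $[u]_t=(u^\alpha)_{\alpha\in\mathbb N^n_t}$, $\langle p,y\rangle=\sum_\alpha p_\alpha y_\alpha$, and for $z\in\mathbb R^{\mathbb N^n_{2k}}$, $z|_{2t}=(z_\alpha)_{\alpha\in\mathbb N^n_{2t}}$. $\mathscr R_t(T)$ is the set of $y\in\mathbb R^{\mathbb N^n_t}$ admitting a Borel measure $\mu$ supported in $T$ with $y_\alpha=\int x^\alpha d\mu$ for $|\alpha|\le t$. For a polynomial $q=\sum q_\gamma x^\gamma$ with $\deg q\le 2k$, the localizing matrix $L^{(k)}_q[z]$ is the symmetric matrix indexed by $\alpha,\beta\in\mathbb N^n$ with $|\alpha|,|\beta|\le k-\lceil\deg(q)/2\rceil$, with $(\alpha,\beta)$ entry $\sum_\gamma q_\gamma z_{\alpha+\beta+\gamma}$; $M_k[z]=L^{(k)}_1[z]$. $\Sigma[x]_{2d_1}$ is the cone of SOS polynomials of degree $\le 2d_1$; "generic $R$" means outside a Lebesgue-measure-zero subset of its interior. *)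

theory Defs
  imports "HOL-Analysis.Analysis"
begin

text \<open>Multivariate real polynomials in the variables indexed by the finite type 'n are
  represented by their coefficient functions (exponent vector to coefficient), with finite
  support.  Truncated moment vectors in R^(N^n_t) are represented by functions on exponent
  vectors that vanish at all exponents of total degree greater than t.  Points of R^n are
  elements of real^'n.\<close>

definition mdeg :: "('n::finite \<Rightarrow> nat) \<Rightarrow> nat" where
  "mdeg \<alpha> = (\<Sum>i\<in>UNIV. \<alpha> i)"

definition psupp :: "(('n \<Rightarrow> nat) \<Rightarrow> real) \<Rightarrow> ('n \<Rightarrow> nat) set" where
  "psupp p = {\<alpha>. p \<alpha> \<noteq> 0}"

definition is_poly :: "(('n \<Rightarrow> nat) \<Rightarrow> real) \<Rightarrow> bool" where
  "is_poly p \<longleftrightarrow> finite (psupp p)"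

text \<open>Degree (the zero polynomial gets degree 0).\<close>
definition pdeg :: "(('n::finite \<Rightarrow> nat) \<Rightarrow> real) \<Rightarrow> nat" where
  "pdeg p = Max (insert 0 (mdeg ` psupp p))"

definition phom :: "(('n::finite \<Rightarrow> nat) \<Rightarrow> real) \<Rightarrow> ('n \<Rightarrow> nat) \<Rightarrow> real" where
  "phom p = (\<lambda>\<alpha>. if mdeg \<alpha> = pdeg p then p \<alpha> else 0)"

definition monom_eval :: "('n::finite \<Rightarrow> nat) \<Rightarrow> real^'n \<Rightarrow> real" where
  "monom_eval \<alpha> x = (\<Prod>i\<in>UNIV. (x $ i) ^ (\<alpha> i))"

definition peval :: "(('n::finite \<Rightarrow> nat) \<Rightarrow> real) \<Rightarrow> real^'n \<Rightarrow> real" where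
  "peval p x = (\<Sum>\<alpha>\<in>psupp p. p \<alpha> * monom_eval \<alpha> x)"

definition pmult :: "(('n::finite \<Rightarrow> nat) \<Rightarrow> real) \<Rightarrow> (('n \<Rightarrow> nat) \<Rightarrow> real) \<Rightarrow> ('n \<Rightarrow> nat) \<Rightarrow> real" where
  "pmult p q = (\<lambda>\<gamma>. \<Sum>\<alpha>\<in>{\<alpha>. \<alpha> \<le> \<gamma>}. p \<alpha> * q (\<lambda>i. \<gamma> i - \<alpha> i))"

definition pair :: "(('n \<Rightarrow> nat) \<Rightarrow> real) \<Rightarrow> (('n \<Rightarrow> nat) \<Rightarrow> real) \<Rightarrow> real" where
  "pair p y = (\<Sum>\<alpha>\<in>psupp p. p \<alpha> * y \<alpha>)"

definition supported_deg :: "nat \<Rightarrow> (('n::finite \<Rightarrow> nat) \<Rightarrow> real) \<Rightarrow> bool" where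
  "supported_deg t z \<longleftrightarrow> (\<forall>\<alpha>. t < mdeg \<alpha> \<longrightarrow> z \<alpha> = 0)"

definition trunc :: "nat \<Rightarrow> (('n::finite \<Rightarrow> nat) \<Rightarrow> real) \<Rightarrow> ('n \<Rightarrow> nat) \<Rightarrow> real" where
  "trunc t z = (\<lambda>\<alpha>. if mdeg \<alpha> \<le> t then z \<alpha> else 0)"

definition mvec :: "nat \<Rightarrow> real^'n \<Rightarrow> ('n::finite \<Rightarrow> nat) \<Rightarrow> real" where
  "mvec t u = (\<lambda>\<alpha>. if mdeg \<alpha> \<le> t then monom_eval \<alpha> u else 0)"

definition moment_cone :: "nat \<Rightarrow> (real^'n) set \<Rightarrow> (('n::finite \<Rightarrow> nat) \<Rightarrow> real) set" where
  "moment_cone t T = {y. supported_deg t y \<and>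
     (\<exists>\<mu> :: (real^'n) measure. sets \<mu> = sets borel \<and> (AE x in \<mu>. x \<in> T) \<and>
        (\<forall>\<alpha>. mdeg \<alpha> \<le> t \<longrightarrow> integrable \<mu> (monom_eval \<alpha>) \<and>
                              y \<alpha> = (\<integral>x. monom_eval \<alpha> x \<partial>\<mu>)))}"

definition Kcirc :: "'i set \<Rightarrow> 'i set \<Rightarrow> ('i \<Rightarrow> ('n::finite \<Rightarrow> nat) \<Rightarrow> real) \<Rightarrow> (real^'n) set" where
  "Kcirc E I c = {u. (\<forall>i\<in>E. peval (phom (c i)) u = 0) \<and> (\<forall>j\<in>I. peval (phom (c j)) u \<ge> 0)
                     \<and> u \<bullet> u = 1}"

definition dc :: "'i set \<Rightarrow> 'i set \<Rightarrow> ('i \<Rightarrow> ('n::finite \<Rightarrow> nat) \<Rightarrow> real) \<Rightarrow> nat" where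
  "dc E I c = Max (insert 0 ((\<lambda>i. (pdeg (c i) + 1) div 2) ` (E \<union> I)))"

definition loc_idx :: "nat \<Rightarrow> (('n::finite \<Rightarrow> nat) \<Rightarrow> real) \<Rightarrow> ('n \<Rightarrow> nat) set" where
  "loc_idx k q = {\<alpha>. mdeg \<alpha> + (pdeg q + 1) div 2 \<le> k}"

definition loc_mat :: "(('n::finite \<Rightarrow> nat) \<Rightarrow> real) \<Rightarrow> (('n \<Rightarrow> nat) \<Rightarrow> real)
     \<Rightarrow> ('n \<Rightarrow> nat) \<Rightarrow> ('n \<Rightarrow> nat) \<Rightarrow> real" where
  "loc_mat q z = (\<lambda>\<alpha> \<beta>. \<Sum>\<gamma>\<in>psupp q. q \<gamma> * z (\<lambda>i. \<alpha> i + \<beta> i + \<gamma> i))"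

definition psd_on :: "('a set) \<Rightarrow> ('a \<Rightarrow> 'a \<Rightarrow> real) \<Rightarrow> bool" where
  "psd_on B M \<longleftrightarrow> (\<forall>v. 0 \<le> (\<Sum>\<alpha>\<in>B. \<Sum>\<beta>\<in>B. v \<alpha> * M \<alpha> \<beta> * v \<beta>))"

definition zero_on :: "('a set) \<Rightarrow> ('a \<Rightarrow> 'a \<Rightarrow> real) \<Rightarrow> bool" where
  "zero_on B M \<longleftrightarrow> (\<forall>\<alpha>\<in>B. \<forall>\<beta>\<in>B. M \<alpha> \<beta> = 0)"

definition one_poly :: "('n \<Rightarrow> nat) \<Rightarrow> real" where
  "one_poly = (\<lambda>\<alpha>. if \<alpha> = (\<lambda>_. 0) then 1 else 0)"

definition sphere_poly :: "('n \<Rightarrow> nat) \<Rightarrow> real" where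
  "sphere_poly = (\<lambda>\<alpha>. if \<alpha> = (\<lambda>_. 0) then -1
                      else if (\<exists>i. \<alpha> = (\<lambda>j. if j = i then 2 else 0)) then 1 else 0)"

definition outer_feas :: "nat \<Rightarrow> (nat \<Rightarrow> real) \<Rightarrow> (nat \<Rightarrow> ('n::finite \<Rightarrow> nat) \<Rightarrow> real)
     \<Rightarrow> 'i set \<Rightarrow> 'i set \<Rightarrow> ('i \<Rightarrow> ('n \<Rightarrow> nat) \<Rightarrow> real) \<Rightarrow> nat \<Rightarrow> (('n \<Rightarrow> nat) \<Rightarrow> real) set" where
  "outer_feas m a g E I c d1 =
     {z \<in> moment_cone (2 * d1) (Kcirc E I c). \<forall>i<m. a i - pair (g i) z \<ge> 0}"

definition relax_feas :: "nat \<Rightarrow> (nat \<Rightarrow> real) \<Rightarrow> (nat \<Rightarrow> ('n::finite \<Rightarrow> nat) \<Rightarrow> real)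
     \<Rightarrow> 'i set \<Rightarrow> 'i set \<Rightarrow> ('i \<Rightarrow> ('n \<Rightarrow> nat) \<Rightarrow> real) \<Rightarrow> nat \<Rightarrow> (('n \<Rightarrow> nat) \<Rightarrow> real) set" where
  "relax_feas m a g E I c k =
     {z. supported_deg (2 * k) z \<and> (\<forall>i<m. a i - pair (g i) z \<ge> 0)
       \<and> (\<forall>i\<in>E. zero_on (loc_idx k (phom (c i))) (loc_mat (phom (c i)) z))
       \<and> (\<forall>j\<in>I. psd_on (loc_idx k (phom (c j))) (loc_mat (phom (c j)) z))
       \<and> zero_on (loc_idx k sphere_poly) (loc_mat sphere_poly z)
       \<and> psd_on (loc_idx k one_poly) (loc_mat one_poly z)}"

definition is_minimizer :: "(('n \<Rightarrow> nat) \<Rightarrow> real) \<Rightarrow> (('n \<Rightarrow> nat) \<Rightarrow> real) set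
     \<Rightarrow> (('n \<Rightarrow> nat) \<Rightarrow> real) \<Rightarrow> bool" where
  "is_minimizer R F z \<longleftrightarrow> z \<in> F \<and> (\<forall>w\<in>F. pair R z \<le> pair R w)"

definition sos_cone :: "nat \<Rightarrow> (('n::finite \<Rightarrow> nat) \<Rightarrow> real) set" where
  "sos_cone e = {p. \<exists>qs. (\<forall>q\<in>set qs. is_poly q \<and> pdeg q \<le> e) \<and>
                         p = (\<lambda>\<gamma>. \<Sum>q\<leftarrow>qs. pmult q q \<gamma>)}"

definition sos_interior :: "nat \<Rightarrow> (('n::finite \<Rightarrow> nat) \<Rightarrow> real) set" where
  "sos_interior e = {R \<in> sos_cone e. \<exists>\<epsilon>>0. \<forall>p. supported_deg (2 * e) p \<and>
      (\<Sum>\<alpha>\<in>{\<alpha>. mdeg \<alpha> \<le> 2 * e}. (p \<alpha> - R \<alpha>)\<^sup>2) < \<epsilon> \<longrightarrow> p \<in> sos_cone e}"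

end

theory Submission
  imports Defs "HOL-Library.Function_Algebras" "HOL-Library.Poly_Mapping"
begin

text \<open>
  Truncated moment vectors of measures on the compact set \<open>K\<close> form the cone spanned by the
  \<open>mvec t u\<close> with \<open>u \<in> K\<close>: a vector outside that closed cone is separated from its nearest
  point by a polynomial that is nonnegative on \<open>K\<close>.  An objective in the interior of the sums of
  squares controls the total mass, so sublevel sets are compact and minimizers exist.  For a linear
  objective on a compact set, the minimizers are unique outside a null set by Fubini along
  coordinate lines, and uniqueness forces at most m atoms.

  The sphere constraint bounds all pseudo-moments by the mass, so the relaxation minimizers
  have subsequences converging to a functional L on all polynomials that satisfies all localizing
  conditions.  It is nonnegative on every p that is nonnegative on \<open>K\<close>:
  after adding penalty terms, on which L is nonpositive, p becomes nonnegative on the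
  whole cube, and its Bernstein polynomials have nonnegative coefficients with respect to products
  of the factors \<open>(1 + x) / 2\<close> and \<open>(1 - x) / 2\<close>, which are sums of squares modulo the sphere ideal.
  Hence the limit is again a moment vector on \<open>K\<close>, and by uniqueness it is the minimizer.
\<close>

text \<open>The feasible set of the moment problem is unbounded, while the exceptional null set must
  be fixed before \<open>R\<close>. Genericity is therefore proved for compact sets and applied to
  the countably many slices of mass at most \<open>s\<close>, with \<open>s\<close> a natural
  number; any two minimizers lie in a common slice.

  Localizing matrices control only products of a single constraint with squares. This dictates the
  form of the penalty: \<open>H * (1 - H) ^ (2 * k)\<close> is a constraint times a square. Scaling
  to absolute value at most 1 on the cube keeps \<open>1 - H\<close> nonnegative there, as the
  estimate by Bernoulli's inequality requires.

  Accumulation points record only degrees up to \<open>2 * t\<close>, whereas positivity on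
  \<open>K\<close> is derived from moments of all degrees. Hence a further subsequence converging in
  every coordinate is extracted first.

  Optimality of the limit comes from a comparison of values: the atoms of the minimizer, with their
  moments taken up to order \<open>2 * k\<close>, are feasible for each relaxation of order
  \<open>k\<close>. So the relaxation values never exceed the minimum of the moment problem, and a
  feasible limit with such a value is a minimizer.\<close>

section \<open>Exponents, supports and the pairing of polynomials with moment vectors\<close>

lemma finite_mdeg_le: "finite {\<alpha> :: 'n::finite \<Rightarrow> nat. mdeg \<alpha> \<le> t}"
proof (rule finite_subset)
  show "{\<alpha> :: 'n \<Rightarrow> nat. mdeg \<alpha> \<le> t} \<subseteq> PiE UNIV (\<lambda>_. {..t})"
  proof
    fix \<alpha> :: "'n \<Rightarrow> nat" assume "\<alpha> \<in> {\<alpha>. mdeg \<alpha> \<le> t}"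
    moreover have "\<alpha> i \<le> mdeg \<alpha>" for i
      unfolding mdeg_def by (rule member_le_sum) auto
    ultimately show "\<alpha> \<in> PiE UNIV (\<lambda>_. {..t})"
      by (auto simp: PiE_def intro: order_trans)
  qed
qed (auto intro: finite_PiE)

lemma mdeg_zero [simp]: "mdeg (\<lambda>_. 0) = 0"
  by (simp add: mdeg_def)

lemma mdeg_add: "mdeg (\<lambda>i. \<alpha> i + \<beta> i) = mdeg \<alpha> + mdeg \<beta>"
  by (simp add: mdeg_def sum.distrib)

lemma monom_eval_zero [simp]: "monom_eval (\<lambda>_. 0) x = 1"
  by (simp add: monom_eval_def)

lemma monom_eval_add: "monom_eval (\<lambda>i. \<alpha> i + \<beta> i) x = monom_eval \<alpha> x * monom_eval \<beta> x"
  by (simp add: monom_eval_def power_add prod.distrib)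

lemma continuous_on_monom_eval: "continuous_on S (monom_eval \<alpha>)"
  unfolding monom_eval_def[abs_def] by (intro continuous_intros)

lemma psupp_supported_deg: "supported_deg t p \<Longrightarrow> psupp p \<subseteq> {\<alpha>. mdeg \<alpha> \<le> t}"
  by (force simp: supported_deg_def psupp_def not_less)

lemma supported_deg_pdeg: "is_poly p \<Longrightarrow> supported_deg (pdeg p) p"
  unfolding supported_deg_def
proof safe
  fix \<alpha> :: "'a \<Rightarrow> nat" assume "is_poly p" "pdeg p < mdeg \<alpha>"
  then have "\<alpha> \<notin> psupp p"
    unfolding is_poly_def pdeg_def
    by (metis Max_ge finite.insertI finite_imageI image_eqI insertI2 not_less)
  then show "p \<alpha> = 0" by (simp add: psupp_def)
qed

lemma supported_deg_mono: "supported_deg s p \<Longrightarrow> s \<le> t \<Longrightarrow> supported_deg t p"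
  by (auto simp: supported_deg_def)

lemma is_poly_supported_deg: "supported_deg t p \<Longrightarrow> is_poly p"
  unfolding is_poly_def using finite_mdeg_le psupp_supported_deg finite_subset by metis

lemma pair_eq_sum:
  assumes "supported_deg t p"
  shows "pair p z = (\<Sum>\<alpha>\<in>{\<alpha>. mdeg \<alpha> \<le> t}. p \<alpha> * z \<alpha>)"
  unfolding pair_def
  by (rule sum.mono_neutral_left) (use assms psupp_supported_deg finite_mdeg_le in \<open>auto simp: psupp_def\<close>)

lemma pair_cong_deg:
  assumes "supported_deg t p" "\<And>\<alpha>. mdeg \<alpha> \<le> t \<Longrightarrow> y \<alpha> = z \<alpha>"
  shows "pair p y = pair p z"
  using assms by (simp add: pair_eq_sum)

lemma pair_add: "pair p (\<lambda>\<alpha>. y \<alpha> + z \<alpha>) = pair p y + pair p z"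
  by (simp add: pair_def sum.distrib algebra_simps)

lemma pair_cmult: "pair p (\<lambda>\<alpha>. b * z \<alpha>) = b * pair p z"
  by (simp add: pair_def sum_distrib_left algebra_simps)

lemma pair_sum: "pair p (\<lambda>\<alpha>. \<Sum>u\<in>U. f u \<alpha>) = (\<Sum>u\<in>U. pair p (f u))"
  unfolding pair_def sum_distrib_left by (rule sum.swap)

lemma continuous_on_coordinate: "continuous_on S (\<lambda>x. x i)"
  by (rule continuous_on_product_then_coordinatewise[OF continuous_on_id])

lemma continuous_on_pair: "continuous_on S (pair p)"
  unfolding pair_def[abs_def] by (intro continuous_intros continuous_on_coordinate)

lemma closed_pair_le: "closed {z. pair p z \<le> b}"
  by (intro closed_Collect_le continuous_on_pair continuous_on_const)

lemma peval_eq_pair: "peval p u = pair p (\<lambda>\<alpha>. monom_eval \<alpha> u)"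
  by (simp add: peval_def pair_def)

lemma pair_mvec: "supported_deg t p \<Longrightarrow> pair p (mvec t u) = peval p u"
  unfolding peval_eq_pair by (rule pair_cong_deg) (auto simp: mvec_def)

lemma continuous_on_peval: "continuous_on S (peval p)"
  unfolding peval_def[abs_def] by (intro continuous_intros continuous_on_monom_eval)

lemma mvec_zero_index [simp]: "mvec t u (\<lambda>_. 0) = 1"
  by (simp add: mvec_def)

section \<open>Atomic moment vectors\<close>

definition atom_cone :: "nat \<Rightarrow> (real^'n) set \<Rightarrow> (('n::finite \<Rightarrow> nat) \<Rightarrow> real) set" where
  "atom_cone t T = {y. \<exists>U lam. finite U \<and> U \<subseteq> T \<and> (\<forall>u\<in>U. 0 < lam u) \<and>
     y = (\<lambda>\<alpha>. \<Sum>u\<in>U. lam u * mvec t u \<alpha>)}"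

text \<open>Gaussian elimination, one equation at a time. It serves twice: with one equation per
  monomial it bounds the atoms needed in any representation, and with one equation per constraint it
  bounds the atoms of a unique minimizer.\<close>

lemma underdetermined_system:
  fixes h :: "'j \<Rightarrow> 'u \<Rightarrow> real"
  assumes "finite J" "finite U" "card J < card U"
  shows "\<exists>c. (\<exists>u\<in>U. c u \<noteq> 0) \<and> (\<forall>j\<in>J. (\<Sum>u\<in>U. c u * h j u) = 0)"
  using assms
proof (induction J arbitrary: U h rule: finite_induct)
  case empty
  then show ?case by (intro exI[of _ "\<lambda>_. 1"]) (auto simp: card_gt_0_iff)
next
  case (insert j J)
  show ?case
  proof (cases "\<forall>u\<in>U. h j u = 0")
    case True
    with insert.IH[of U h] insert.prems insert.hyps show ?thesis by auto
  next
    case False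
    then obtain w where w: "w \<in> U" "h j w \<noteq> 0" by auto
    \<comment> \<open>Equation \<open>j\<close> is solved for the unknown \<open>w\<close>;
      \<open>h'\<close> is the remaining system after substituting it.\<close>
    define h' where "h' = (\<lambda>i u. h i u - h i w * h j u / h j w)"
    have "card J < card (U - {w})" using insert w by simp
    with insert.IH[of "U - {w}" h'] insert.prems obtain c where
      c: "\<exists>u\<in>U - {w}. c u \<noteq> 0" "\<And>i. i \<in> J \<Longrightarrow> (\<Sum>u\<in>U - {w}. c u * h' i u) = 0" by auto
    define S where "S = (\<Sum>u\<in>U - {w}. c u * h j u)"
    define c' where "c' = c(w := - S / h j w)"
    have split: "(\<Sum>u\<in>U. c' u * h i u) = (\<Sum>u\<in>U - {w}. c u * h i u) - S / h j w * h i w" for i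
      using w insert.prems by (subst sum.remove[of _ w]) (auto simp: c'_def intro!: sum.cong)
    have "(\<Sum>u\<in>U. c' u * h i u) = 0" if "i \<in> insert j J" for i
    proof (cases "i = j")
      case True then show ?thesis using w by (simp add: split S_def)
    next
      case False
      then have "0 = (\<Sum>u\<in>U - {w}. c u * h' i u)" using c that by simp
      also have "\<dots> = (\<Sum>u\<in>U - {w}. c u * h i u) - (\<Sum>u\<in>U - {w}. c u * h j u * (h i w / h j w))"
        unfolding h'_def sum_subtractf[symmetric] by (intro sum.cong) (auto simp: field_simps)
      also have "\<dots> = (\<Sum>u\<in>U. c' u * h i u)"
        unfolding split S_def sum_distrib_right[symmetric] by simp
      finally show ?thesis by simp
    qed
    moreover have "\<exists>u\<in>U. c' u \<noteq> 0" using c(1) by (auto simp: c'_def)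
    ultimately show ?thesis by blast
  qed
qed

text \<open>The ratio test: move along \<open>c\<close>, or along \<open>-c\<close>, until the first
  positive weight drops to zero.\<close>

lemma reach_boundary:
  fixes lam c :: "'u \<Rightarrow> real"
  assumes "finite U" "\<And>u. u \<in> U \<Longrightarrow> 0 < lam u" "w \<in> U" "c w \<noteq> 0"
  shows "\<exists>s. (\<forall>u\<in>U. 0 \<le> lam u + s * c u) \<and> (\<exists>u\<in>U. lam u + s * c u = 0)"
proof -
  have neg: "\<exists>s. (\<forall>u\<in>U. 0 \<le> lam u + s * c u) \<and> (\<exists>u\<in>U. lam u + s * c u = 0)"
    if "c w < 0" for c :: "'u \<Rightarrow> real"
  proof -
    define V where "V = {u \<in> U. c u < 0}"
    have V: "finite V" "w \<in> V" using assms that by (auto simp: V_def)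
    \<comment> \<open>Only weights with \<open>c u < 0\<close> decrease, and such a weight vanishes
      at step \<open>lam u / - c u\<close>; the smallest of these steps keeps all the others
      nonnegative.\<close>
    define s where "s = Min ((\<lambda>u. lam u / - c u) ` V)"
    have "s \<in> (\<lambda>u. lam u / - c u) ` V" unfolding s_def using V by (intro Min_in) auto
    then obtain v where v: "v \<in> V" "s = lam v / - c v" by auto
    have le: "s \<le> lam u / - c u" if "u \<in> V" for u
      unfolding s_def using V that by (intro Min_le) auto
    have "0 < s" using v(1) assms(2)[of v] unfolding v(2) by (auto simp: V_def intro!: divide_pos_neg)
    have "0 \<le> lam u + s * c u" if "u \<in> U" for u
    proof (cases "c u < 0")
      case True
      then have "s * - c u \<le> lam u"
        using le[of u] that by (subst pos_le_divide_eq[symmetric]) (simp_all add: V_def)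
      then show ?thesis by simp
    next
      case False then show ?thesis using assms(2)[OF that] \<open>0 < s\<close> by (simp add: add_nonneg_nonneg)
    qed
    moreover have "lam v + s * c v = 0" "v \<in> U" using v by (auto simp: V_def)
    ultimately show ?thesis by blast
  qed
  show ?thesis
  proof (cases "c w < 0")
    case True then show ?thesis by (rule neg)
  next
    case False
    then have "- c w < 0" using assms(4) by simp
    from neg[of "\<lambda>u. - c u", OF this] obtain s where
      "\<forall>u\<in>U. 0 \<le> lam u + s * - c u" "\<exists>u\<in>U. lam u + s * - c u = 0" by blast
    then show ?thesis by (intro exI[of _ "- s"]) auto
  qed
qed

lemma atom_cone_nonneg_weights:
  assumes "finite U" "U \<subseteq> T" "\<And>u. u \<in> U \<Longrightarrow> 0 \<le> lam u"
  shows "(\<lambda>\<alpha>. \<Sum>u\<in>U. lam u * mvec t u \<alpha>) \<in> atom_cone t T"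
proof -
  have "(\<lambda>\<alpha>. \<Sum>u\<in>U. lam u * mvec t u \<alpha>) = (\<lambda>\<alpha>. \<Sum>u\<in>{u\<in>U. lam u \<noteq> 0}. lam u * mvec t u \<alpha>)"
    using assms by (auto intro!: sum.mono_neutral_right)
  then show ?thesis
    unfolding atom_cone_def using assms
    by (intro CollectI exI[of _ "{u\<in>U. lam u \<noteq> 0}"] exI[of _ lam]) (auto simp: order_less_le)
qed

text \<open>Caratheodory's argument: take a representation with the fewest atoms. A nontrivial
  linear relation between its atoms could be added until one weight vanishes, which would leave
  fewer atoms.\<close>

lemma atom_cone_minimal_representation:
  assumes "y \<in> atom_cone t T"
  obtains U lam where "finite U" "U \<subseteq> T" "\<And>u. u \<in> U \<Longrightarrow> 0 < lam u"
    "y = (\<lambda>\<alpha>. \<Sum>u\<in>U. lam u * mvec t u \<alpha>)"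
    "\<And>c. (\<And>\<alpha>. (\<Sum>u\<in>U. c u * mvec t u \<alpha>) = 0) \<Longrightarrow> \<forall>u\<in>U. c u = 0"
proof -
  define P where "P = (\<lambda>U lam. finite U \<and> U \<subseteq> T \<and> (\<forall>u\<in>U. 0 < lam u) \<and>
     y = (\<lambda>\<alpha>. \<Sum>u\<in>U. lam u * mvec t u \<alpha>))"
  have "\<exists>n U lam. P U lam \<and> card U = n" using assms by (auto simp: atom_cone_def P_def)
  then obtain n where n: "\<exists>U lam. P U lam \<and> card U = n"
    and least: "\<And>k. k < n \<Longrightarrow> \<not> (\<exists>U lam. P U lam \<and> card U = k)"
    using exists_least_iff[of "\<lambda>n. \<exists>U lam. P U lam \<and> card U = n"] by blast
  then obtain U lam where U: "P U lam" "card U = n" by blast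
  have "\<forall>u\<in>U. c u = 0" if c: "\<And>\<alpha>. (\<Sum>u\<in>U. c u * mvec t u \<alpha>) = 0" for c
  proof (rule ccontr)
    assume "\<not> (\<forall>u\<in>U. c u = 0)"
    then obtain w where w: "w \<in> U" "c w \<noteq> 0" by auto
    obtain s v where s: "\<And>u. u \<in> U \<Longrightarrow> 0 \<le> lam u + s * c u" "v \<in> U" "lam v + s * c v = 0"
      using reach_boundary[of U lam w c] U w unfolding P_def by blast
    define V where "V = {u \<in> U. lam u + s * c u \<noteq> 0}"
    have "y = (\<lambda>\<alpha>. \<Sum>u\<in>U. (lam u + s * c u) * mvec t u \<alpha>)"
      using U c by (auto simp: P_def algebra_simps sum.distrib simp flip: sum_distrib_left)
    also have "\<dots> = (\<lambda>\<alpha>. \<Sum>u\<in>V. (lam u + s * c u) * mvec t u \<alpha>)"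
      using U by (auto intro!: sum.mono_neutral_right simp: V_def P_def)
    finally have "P V (\<lambda>u. lam u + s * c u)"
      using U s unfolding P_def by (auto simp: V_def order_less_le)
    moreover have "V \<subset> U" using s by (auto simp: V_def)
    then have "card V < n" using U by (auto simp: P_def intro: psubset_card_mono)
    ultimately show False using least by blast
  qed
  then show ?thesis using U that unfolding P_def by blast
qed

lemma atom_cone_supported: "y \<in> atom_cone t T \<Longrightarrow> supported_deg t y"
  by (auto simp: atom_cone_def supported_deg_def mvec_def intro!: sum.neutral)

lemma zero_in_atom_cone: "(\<lambda>_. 0) \<in> atom_cone t T"
  using atom_cone_nonneg_weights[of "{}" T "\<lambda>_. 0" t] by simp

lemma atom_cone_empty: "atom_cone t {} = {\<lambda>_. 0}"
  by (auto simp: atom_cone_def)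

lemma atom_cone_cmult:
  assumes "y \<in> atom_cone t T" "0 \<le> b"
  shows "(\<lambda>\<alpha>. b * y \<alpha>) \<in> atom_cone t T"
proof -
  obtain U lam where U: "finite U" "U \<subseteq> T" "\<And>u. u \<in> U \<Longrightarrow> 0 < lam u"
    "y = (\<lambda>\<alpha>. \<Sum>u\<in>U. lam u * mvec t u \<alpha>)" using assms by (auto simp: atom_cone_def)
  have "(\<lambda>\<alpha>. b * y \<alpha>) = (\<lambda>\<alpha>. \<Sum>u\<in>U. (b * lam u) * mvec t u \<alpha>)"
    using U by (simp add: sum_distrib_left mult.assoc)
  then show ?thesis
    using atom_cone_nonneg_weights[of U T "\<lambda>u. b * lam u" t] U assms by (simp add: less_imp_le)
qed

lemma atom_cone_add_atom:
  assumes "y \<in> atom_cone t T" "0 \<le> b" "v \<in> T"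
  shows "(\<lambda>\<alpha>. y \<alpha> + b * mvec t v \<alpha>) \<in> atom_cone t T"
proof -
  obtain U lam where U: "finite U" "U \<subseteq> T" "\<And>u. u \<in> U \<Longrightarrow> 0 < lam u"
    "y = (\<lambda>\<alpha>. \<Sum>u\<in>U. lam u * mvec t u \<alpha>)" using assms by (auto simp: atom_cone_def)
  define l where "l = (\<lambda>u. (if u \<in> U then lam u else 0) + (if u = v then b else 0))"
  have "y \<alpha> + b * mvec t v \<alpha> = (\<Sum>u\<in>insert v U. l u * mvec t u \<alpha>)" for \<alpha>
  proof -
    have "(\<Sum>u\<in>insert v U. l u * mvec t u \<alpha>) =
      (\<Sum>u\<in>insert v U. (if u \<in> U then lam u * mvec t u \<alpha> else 0)) +
      (\<Sum>u\<in>insert v U. (if u = v then b * mvec t u \<alpha> else 0))"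
      unfolding sum.distrib[symmetric] by (intro sum.cong) (auto simp: l_def algebra_simps)
    also have "(\<Sum>u\<in>insert v U. (if u \<in> U then lam u * mvec t u \<alpha> else 0)) = y \<alpha>"
      using U by (simp add: sum.If_cases Int_absorb1 subset_insertI)
    finally show ?thesis using U by simp
  qed
  then have "(\<lambda>\<alpha>. y \<alpha> + b * mvec t v \<alpha>) = (\<lambda>\<alpha>. \<Sum>u\<in>insert v U. l u * mvec t u \<alpha>)" by blast
  then show ?thesis
    using atom_cone_nonneg_weights[of "insert v U" T l t] U assms
    by (auto simp: l_def less_imp_le add_nonneg_nonneg)
qed

lemma compact_product_UNIV:
  fixes S :: "'a \<Rightarrow> 'b::topological_space set"
  assumes "\<And>i. compact (S i)"
  shows "compact (PiE UNIV S)"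
  using compactin_PiE[of "\<lambda>_. euclidean" UNIV S] assms
  by (simp add: euclidean_product_topology)

text \<open>Independent atoms number at most the \<open>M\<close> monomials of degree up to
  \<open>t\<close>, so the slice is a closed part of the continuous image of a fixed compact set of
  \<open>M\<close> weights and \<open>M\<close> points.\<close>

lemma compact_atom_cone_bounded_mass:
  fixes T :: "(real^'n::finite) set"
  assumes "compact T"
  shows "compact {y \<in> atom_cone t T. y (\<lambda>_. 0) \<le> s}"
proof (cases "T = {}")
  case True
  have "finite {y. y = (\<lambda>_::'n \<Rightarrow> nat. 0::real) \<and> 0 \<le> s}"
    by (rule finite_subset[of _ "{\<lambda>_. 0}"]) auto
  moreover have "{y \<in> atom_cone t T. y (\<lambda>_. 0) \<le> s} = {y. y = (\<lambda>_. 0) \<and> 0 \<le> s}"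
    unfolding True atom_cone_empty by auto
  ultimately show ?thesis by (metis finite_imp_compact)
next
  case False
  \<comment> \<open>Representations with fewer than \<open>M\<close> atoms are padded by
    \<open>u0\<close> with weight 0, which is why the empty set is treated apart.\<close>
  then obtain u0 where u0: "u0 \<in> T" by auto
  define A where "A = {\<alpha> :: 'n \<Rightarrow> nat. mdeg \<alpha> \<le> t}"
  define M where "M = card A"
  define Q where "Q = (PiE UNIV (\<lambda>_::nat. {0..s})) \<times> (PiE UNIV (\<lambda>_::nat. T))"
  define \<Phi> where "\<Phi> = (\<lambda>(l, u :: nat \<Rightarrow> real^'n) \<alpha>. \<Sum>i<M. l i * mvec t (u i) \<alpha>)"
  have "compact Q" unfolding Q_def by (intro compact_Times compact_product_UNIV) (use assms in auto)
  moreover have "continuous_on Q \<Phi>"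
  proof (rule continuous_on_coordinatewise_then_product)
    fix \<alpha> :: "'n \<Rightarrow> nat"
    have u: "continuous_on Q (\<lambda>x. snd x i)" for i
      by (rule continuous_on_product_then_coordinatewise[OF continuous_on_snd[OF continuous_on_id]])
    have l: "continuous_on Q (\<lambda>x. fst x i)" for i
      by (rule continuous_on_product_then_coordinatewise[OF continuous_on_fst[OF continuous_on_id]])
    have "continuous_on Q (\<lambda>x. mvec t (snd x i) \<alpha>)" for i
      using continuous_on_compose2[OF continuous_on_monom_eval[of UNIV \<alpha>] u]
      by (cases "mdeg \<alpha> \<le> t") (auto simp: mvec_def)
    then have "continuous_on Q (\<lambda>x. \<Sum>i<M. fst x i * mvec t (snd x i) \<alpha>)"
      by (intro continuous_intros l)
    then show "continuous_on Q (\<lambda>x. \<Phi> x \<alpha>)" by (simp add: \<Phi>_def case_prod_unfold)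
  qed
  ultimately have "compact (\<Phi> ` Q)" by (rule compact_continuous_image[rotated])
  moreover have "closed {y :: ('n \<Rightarrow> nat) \<Rightarrow> real. y (\<lambda>_. 0) \<le> s}"
    by (intro closed_Collect_le continuous_on_const continuous_on_coordinate)
  ultimately have "compact (\<Phi> ` Q \<inter> {y. y (\<lambda>_. 0) \<le> s})" by (rule compact_Int_closed)
  also have "\<Phi> ` Q \<inter> {y. y (\<lambda>_. 0) \<le> s} = {y \<in> atom_cone t T. y (\<lambda>_. 0) \<le> s}"
  proof (intro set_eqI iffI)
    fix y assume y: "y \<in> \<Phi> ` Q \<inter> {y. y (\<lambda>_. 0) \<le> s}"
    then obtain l u where lu: "(l, u) \<in> Q" "y = \<Phi> (l, u)" by auto
    have "(\<lambda>\<alpha>. \<Sum>i<k. l i * mvec t (u i) \<alpha>) \<in> atom_cone t T" for k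
    proof (induction k)
      case 0 then show ?case using zero_in_atom_cone by simp
    next
      case (Suc k)
      have "0 \<le> l k" "u k \<in> T" using lu by (auto simp: Q_def)
      from atom_cone_add_atom[OF Suc this] show ?case by simp
    qed
    then show "y \<in> {y \<in> atom_cone t T. y (\<lambda>_. 0) \<le> s}" using y lu by (simp add: \<Phi>_def)
  next
    fix y assume "y \<in> {y \<in> atom_cone t T. y (\<lambda>_. 0) \<le> s}"
    then have y: "y \<in> atom_cone t T" "y (\<lambda>_. 0) \<le> s" by auto
    obtain U lam where U: "finite U" "U \<subseteq> T" "\<And>u. u \<in> U \<Longrightarrow> 0 < lam u"
      "y = (\<lambda>\<alpha>. \<Sum>u\<in>U. lam u * mvec t u \<alpha>)"
      and indep: "\<And>c. (\<And>\<alpha>. (\<Sum>u\<in>U. c u * mvec t u \<alpha>) = 0) \<Longrightarrow> \<forall>u\<in>U. c u = 0"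
      using atom_cone_minimal_representation[OF y(1)] by blast
    have "card U \<le> M"
    proof (rule ccontr)
      assume "\<not> card U \<le> M"
      moreover have "finite A" unfolding A_def by (rule finite_mdeg_le)
      ultimately obtain c where c: "\<exists>u\<in>U. c u \<noteq> 0" "\<And>\<alpha>. \<alpha> \<in> A \<Longrightarrow> (\<Sum>u\<in>U. c u * mvec t u \<alpha>) = 0"
        using underdetermined_system[of A U "\<lambda>\<alpha> u. mvec t u \<alpha>"] U(1)
        unfolding M_def by (meson not_le)
      have "(\<Sum>u\<in>U. c u * mvec t u \<alpha>) = 0" for \<alpha>
        by (cases "\<alpha> \<in> A") (simp add: c, simp add: A_def mvec_def)
      with indep c(1) show False by blast
    qed
    obtain f where f: "bij_betw f {..<card U} U"
      using U(1) by (metis ex_bij_betw_nat_finite lessThan_atLeast0)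
    define l where "l = (\<lambda>i. if i < card U then lam (f i) else 0)"
    define u where "u = (\<lambda>i. if i < card U then f i else u0)"
    have fU: "f i \<in> U" if "i < card U" for i using f that by (auto simp: bij_betw_def)
    \<comment> \<open>The entry of every \<open>mvec t u\<close> at the zero exponent is 1, so that
      entry of \<open>y\<close> is the total weight and bounds each single weight.\<close>
    have mass: "sum lam U \<le> s" using y(2) unfolding U(4) by simp
    have "0 \<le> sum lam U" by (intro sum_nonneg less_imp_le U(3))
    then have "0 \<le> s" using mass by simp
    have "lam v \<le> s" if "v \<in> U" for v
      using member_le_sum[of v U lam] that U(1,3) mass by (force simp: less_imp_le)
    then have "(l, u) \<in> Q" using U(3) u0 fU subsetD[OF U(2) fU] \<open>0 \<le> s\<close>
      by (auto simp: Q_def l_def u_def less_imp_le)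
    moreover have "y = \<Phi> (l, u)"
    proof
      fix \<alpha>
      have "y \<alpha> = (\<Sum>i<card U. lam (f i) * mvec t (f i) \<alpha>)"
        unfolding U(4) by (rule sum.reindex_bij_betw[OF f, symmetric])
      also have "\<dots> = (\<Sum>i<M. l i * mvec t (u i) \<alpha>)"
        using \<open>card U \<le> M\<close> by (intro sum.mono_neutral_cong_left) (auto simp: l_def u_def)
      finally show "y \<alpha> = \<Phi> (l, u) \<alpha>" by (simp add: \<Phi>_def)
    qed
    ultimately show "y \<in> \<Phi> ` Q \<inter> {y. y (\<lambda>_. 0) \<le> s}" using y by blast
  qed
  finally show ?thesis .
qed

text \<open>First-order optimality condition: for small \<open>h\<close> the quadratic term cannot
  compensate a negative linear one.\<close>

lemma nonneg_coefficient_from_minimum: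
  fixes b q :: real
  assumes "\<And>h. 0 < h \<Longrightarrow> h < 1 \<Longrightarrow> 0 \<le> h * b + h\<^sup>2 * q"
  shows "0 \<le> b"
proof (rule ccontr)
  assume "\<not> 0 \<le> b"
  \<comment> \<open>The second bound gives \<open>h * (\<bar>q\<bar> + 1) \<le> - b / 2\<close>, so
    \<open>b + h * q\<close> would be at most \<open>b / 2\<close>; the bound 1/2 keeps
    \<open>h\<close> below 1.\<close>
  define h where "h = min (1/2) (- b / (2 * (\<bar>q\<bar> + 1)))"
  have h: "0 < h" "h < 1" using \<open>\<not> 0 \<le> b\<close> by (auto simp: h_def field_simps)
  have "0 \<le> h * (b + h * q)" using assms[OF h] by (simp add: power2_eq_square algebra_simps)
  then have "0 \<le> b + h * q" using h by (simp add: zero_le_mult_iff)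
  also have "h * q \<le> h * (\<bar>q\<bar> + 1)" using h by (intro mult_left_mono) auto
  also have "\<dots> \<le> - b / (2 * (\<bar>q\<bar> + 1)) * (\<bar>q\<bar> + 1)" by (intro mult_right_mono) (auto simp: h_def)
  also have "\<dots> = - b / 2" by (simp add: field_simps add_nonneg_eq_0_iff)
  finally show False using \<open>\<not> 0 \<le> b\<close> by simp
qed

text \<open>The separating polynomial is the difference between the nearest point of the cone and y.\<close>

lemma in_atom_cone_if_nonneg_on_nonneg_polys:
  fixes T :: "(real^'n::finite) set"
  assumes T: "compact T" and y: "supported_deg t y"
    and pos: "\<And>p. supported_deg t p \<Longrightarrow> (\<And>u. u \<in> T \<Longrightarrow> 0 \<le> peval p u) \<Longrightarrow> 0 \<le> pair p y"
  shows "y \<in> atom_cone t T"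
proof -
  define A where "A = {\<alpha> :: 'n \<Rightarrow> nat. mdeg \<alpha> \<le> t}"
  have A: "finite A" "(\<lambda>_. 0) \<in> A" by (auto simp: A_def finite_mdeg_le)
  define f where "f = (\<lambda>z. \<Sum>\<alpha>\<in>A. (z \<alpha> - y \<alpha>)\<^sup>2)"
  \<comment> \<open>Every vector at least as close to \<open>y\<close> as the origin has mass at
    most \<open>s\<close>. So the minimum of the distance over this compact slice is its minimum
    over the whole unbounded cone.\<close>
  define s where "s = y (\<lambda>_. 0) + sqrt (f (\<lambda>_. 0))"
  have f_nonneg: "0 \<le> f z" for z by (simp add: f_def sum_nonneg)
  let ?C = "{y \<in> atom_cone t T. y (\<lambda>_. 0) \<le> s}"
  have bound: "z (\<lambda>_. 0) \<le> s" if "f z \<le> f (\<lambda>_. 0)" for z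
  proof -
    have "(z (\<lambda>_. 0) - y (\<lambda>_. 0))\<^sup>2 \<le> f z"
      unfolding f_def using A by (intro member_le_sum) auto
    then have "\<bar>z (\<lambda>_. 0) - y (\<lambda>_. 0)\<bar> \<le> sqrt (f (\<lambda>_. 0))"
      using that by (intro real_le_rsqrt) simp
    then show ?thesis by (simp add: s_def)
  qed
  have "(\<lambda>_. 0) \<in> ?C" using zero_in_atom_cone bound[of "\<lambda>_. 0"] by auto
  moreover have "continuous_on ?C f" unfolding f_def by (intro continuous_intros continuous_on_coordinate)
  ultimately obtain z where z: "z \<in> ?C" "\<And>x. x \<in> ?C \<Longrightarrow> f z \<le> f x"
    using continuous_attains_inf[OF compact_atom_cone_bounded_mass[OF T, of t s]] by blast
  have "f z \<le> f (\<lambda>_. 0)" using z \<open>(\<lambda>_. 0) \<in> ?C\<close> by blast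
  have min: "f z \<le> f x" if "x \<in> atom_cone t T" for x
    using z(2)[of x] bound[of x] that \<open>f z \<le> f (\<lambda>_. 0)\<close> by fastforce
  define p where "p = (\<lambda>\<alpha>. z \<alpha> - y \<alpha>)"
  have p: "supported_deg t p"
    using y atom_cone_supported[of z] z(1) by (auto simp: p_def supported_deg_def)
  have pair_p: "pair p x = (\<Sum>\<alpha>\<in>A. p \<alpha> * x \<alpha>)" for x
    unfolding A_def by (rule pair_eq_sum[OF p])
  have expand: "f (\<lambda>\<alpha>. z \<alpha> + h * x \<alpha>) = f z + h * (2 * pair p x) + h\<^sup>2 * (\<Sum>\<alpha>\<in>A. (x \<alpha>)\<^sup>2)" for h x
    unfolding f_def pair_p sum_distrib_left sum.distrib[symmetric]
    by (intro sum.cong) (auto simp: p_def power2_eq_square algebra_simps)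
  have step: "0 \<le> pair p x" if "\<And>h. 0 < h \<Longrightarrow> h < 1 \<Longrightarrow> (\<lambda>\<alpha>. z \<alpha> + h * x \<alpha>) \<in> atom_cone t T" for x
  proof -
    have "0 \<le> 2 * pair p x"
    proof (rule nonneg_coefficient_from_minimum)
      fix h :: real assume "0 < h" "h < 1"
      from min[OF that[OF this]] show "0 \<le> h * (2 * pair p x) + h\<^sup>2 * (\<Sum>\<alpha>\<in>A. (x \<alpha>)\<^sup>2)"
        unfolding expand by simp
    qed
    then show ?thesis by simp
  qed
  \<comment> \<open>Moving from \<open>z\<close> towards an atom shows that \<open>p\<close> is
    nonnegative on \<open>T\<close>; moving towards the origin, below, shows that
    \<open>pair p z\<close> is at most 0.\<close>
  have "0 \<le> peval p u" if "u \<in> T" for u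
    unfolding pair_mvec[OF p, symmetric]
    by (rule step) (use z that in \<open>auto intro: atom_cone_add_atom\<close>)
  then have "0 \<le> pair p y" using pos p by blast
  moreover have "0 \<le> pair p (\<lambda>\<alpha>. - 1 * z \<alpha>)"
  proof (rule step)
    fix h :: real assume "0 < h" "h < 1"
    then have "(\<lambda>\<alpha>. (1 - h) * z \<alpha>) \<in> atom_cone t T" using z by (intro atom_cone_cmult) auto
    then show "(\<lambda>\<alpha>. z \<alpha> + h * (- 1 * z \<alpha>)) \<in> atom_cone t T" by (simp add: algebra_simps)
  qed
  \<comment> \<open>Since \<open>y - z = - p\<close> on the relevant exponents, the nonnegative
    number \<open>pair p (y - z)\<close> is minus the squared norm of \<open>p\<close>.\<close>
  ultimately have "0 \<le> pair p (\<lambda>\<alpha>. y \<alpha> + - 1 * z \<alpha>)" unfolding pair_add by linarith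
  also have "\<dots> = - (\<Sum>\<alpha>\<in>A. (p \<alpha>)\<^sup>2)"
    unfolding pair_p by (simp add: p_def power2_eq_square algebra_simps sum_subtractf sum.distrib)
  finally have "(\<Sum>\<alpha>\<in>A. (p \<alpha>)\<^sup>2) = 0" by (meson antisym neg_0_le_iff_le sum_nonneg zero_le_power2)
  then have "p \<alpha> = 0" if "\<alpha> \<in> A" for \<alpha> using A that by (simp add: sum_nonneg_eq_0_iff)
  then have "z = y"
    using p by (auto simp: p_def A_def supported_deg_def fun_eq_iff) (metis not_less)
  then show ?thesis using z by simp
qed

text \<open>Integrating a polynomial that is nonnegative on \<open>T\<close> gives a nonnegative
  number, so the separation criterion applies to moment vectors. Conversely, weighted point masses
  represent atomic vectors.\<close>

lemma atom_cone_eq_moment_cone: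
  fixes T :: "(real^'n::finite) set"
  assumes "compact T"
  shows "moment_cone t T = atom_cone t T"
proof (intro set_eqI iffI)
  fix y assume "y \<in> moment_cone t T"
  then obtain \<mu> :: "(real^'n) measure" where y: "supported_deg t y" and
    \<mu>: "AE x in \<mu>. x \<in> T"
      "\<And>\<alpha>. mdeg \<alpha> \<le> t \<Longrightarrow> integrable \<mu> (monom_eval \<alpha>)"
      "\<And>\<alpha>. mdeg \<alpha> \<le> t \<Longrightarrow> y \<alpha> = (\<integral>x. monom_eval \<alpha> x \<partial>\<mu>)"
    by (auto simp: moment_cone_def)
  show "y \<in> atom_cone t T"
  proof (rule in_atom_cone_if_nonneg_on_nonneg_polys[OF assms y])
    fix p :: "('n \<Rightarrow> nat) \<Rightarrow> real"
    assume p: "supported_deg t p" "\<And>u. u \<in> T \<Longrightarrow> 0 \<le> peval p u"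
    have "pair p y = (\<Sum>\<alpha>\<in>{\<alpha>. mdeg \<alpha> \<le> t}. \<integral>x. p \<alpha> * monom_eval \<alpha> x \<partial>\<mu>)"
      using p \<mu> by (simp add: pair_eq_sum)
    also have "\<dots> = (\<integral>x. (\<Sum>\<alpha>\<in>{\<alpha>. mdeg \<alpha> \<le> t}. p \<alpha> * monom_eval \<alpha> x) \<partial>\<mu>)"
      using \<mu> by (intro Bochner_Integration.integral_sum[symmetric]) auto
    also have "\<dots> = (\<integral>x. peval p x \<partial>\<mu>)"
      using p by (simp add: peval_eq_pair pair_eq_sum)
    also have "0 \<le> \<dots>"
      using \<mu>(1) p(2) by (intro integral_nonneg_AE) auto
    finally show "0 \<le> pair p y" .
  qed
next
  fix y assume y: "y \<in> atom_cone t T"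
  then obtain U lam where U: "finite U" "U \<subseteq> T" "\<And>u. u \<in> U \<Longrightarrow> 0 < lam u"
    "y = (\<lambda>\<alpha>. \<Sum>u\<in>U. lam u * mvec t u \<alpha>)" by (auto simp: atom_cone_def)
  \<comment> \<open>\<open>point_measure\<close> carries the power set of \<open>U\<close> as its
    sigma-algebra; the push-forward along the identity turns it into a Borel measure on the whole
    space.\<close>
  define P where "P = point_measure U (\<lambda>u. ennreal (lam u))"
  define \<mu> where "\<mu> = distr P borel (\<lambda>x. x)"
  have id: "(\<lambda>x. x) \<in> measurable P borel"
    by (auto simp: P_def measurable_point_measure_eq1)
  have meas: "monom_eval \<alpha> \<in> borel_measurable borel" for \<alpha>
    by (rule borel_measurable_continuous_onI[OF continuous_on_monom_eval])
  have "{x. x \<in> T} \<in> sets borel" using assms by (auto simp: compact_imp_closed)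
  moreover have "AE x in P. x \<in> T" using U(2) unfolding P_def AE_point_measure by auto
  ultimately have "AE x in \<mu>. x \<in> T"
    unfolding \<mu>_def by (subst AE_distr_iff[OF id]) auto
  moreover have "integrable \<mu> (monom_eval \<alpha>)" for \<alpha>
    unfolding \<mu>_def integrable_distr_eq[OF id meas]
    using U by (simp add: P_def integrable_point_measure_finite)
  moreover have "y \<alpha> = (\<integral>x. monom_eval \<alpha> x \<partial>\<mu>)" if "mdeg \<alpha> \<le> t" for \<alpha>
  proof -
    have "(\<integral>x. monom_eval \<alpha> x \<partial>\<mu>) = (\<Sum>u\<in>U. lam u * monom_eval \<alpha> u)"
      unfolding \<mu>_def integral_distr[OF id meas]
      using U by (simp add: P_def lebesgue_integral_point_measure_finite less_imp_le)
    then show ?thesis using U that by (simp add: mvec_def)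
  qed
  moreover have "sets \<mu> = sets borel" by (simp add: \<mu>_def)
  ultimately show "y \<in> moment_cone t T"
    using atom_cone_supported[OF y] by (auto simp: moment_cone_def intro!: exI[of _ \<mu>])
qed

section \<open>Generic uniqueness of minimizers of linear functions\<close>

text \<open>The concave support function of \<open>K\<close>, with linear forms restricted to the
  finitely many coordinates in \<open>A\<close>.\<close>

definition min_over :: "'i set \<Rightarrow> ('i \<Rightarrow> real) set \<Rightarrow> ('i \<Rightarrow> real) \<Rightarrow> real" where
  "min_over A K R = (INF z\<in>K. \<Sum>\<beta>\<in>A. R \<beta> * z \<beta>)"

lemma min_over_attained:
  assumes "compact K" "K \<noteq> {}"
  obtains z where "z \<in> K" "min_over A K R = (\<Sum>\<beta>\<in>A. R \<beta> * z \<beta>)"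
    "\<And>w. w \<in> K \<Longrightarrow> min_over A K R \<le> (\<Sum>\<beta>\<in>A. R \<beta> * w \<beta>)"
proof -
  have "continuous_on K (\<lambda>z. \<Sum>\<beta>\<in>A. R \<beta> * z \<beta>)"
    by (intro continuous_intros continuous_on_coordinate)
  then obtain z where z: "z \<in> K" "\<And>w. w \<in> K \<Longrightarrow> (\<Sum>\<beta>\<in>A. R \<beta> * z \<beta>) \<le> (\<Sum>\<beta>\<in>A. R \<beta> * w \<beta>)"
    using continuous_attains_inf[OF assms] by blast
  moreover have "min_over A K R = (\<Sum>\<beta>\<in>A. R \<beta> * z \<beta>)"
    unfolding min_over_def using z by (intro cInf_eq_minimum) auto
  ultimately show ?thesis using that by simp
qed

lemma min_over_le:
  assumes "compact K" "w \<in> K"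
  shows "min_over A K R \<le> (\<Sum>\<beta>\<in>A. R \<beta> * w \<beta>)"
proof -
  have "K \<noteq> {}" using assms by auto
  from min_over_attained[OF assms(1) this, of A R] show ?thesis using assms(2) by blast
qed

lemma min_over_eqI:
  assumes "z \<in> K" "\<And>w. w \<in> K \<Longrightarrow> (\<Sum>\<beta>\<in>A. R \<beta> * z \<beta>) \<le> (\<Sum>\<beta>\<in>A. R \<beta> * w \<beta>)"
  shows "min_over A K R = (\<Sum>\<beta>\<in>A. R \<beta> * z \<beta>)"
  unfolding min_over_def using assms by (intro cInf_eq_minimum) auto

lemma min_over_cong: "(\<And>\<beta>. \<beta> \<in> A \<Longrightarrow> R \<beta> = R' \<beta>) \<Longrightarrow> min_over A K R = min_over A K R'"
  unfolding min_over_def by (simp cong: sum.cong)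

text \<open>A strict sublevel set is a union of open half-spaces over \<open>z \<in> K\<close>,
  hence open even though this union is uncountable.\<close>

lemma min_over_measurable:
  fixes K :: "('i::countable \<Rightarrow> real) set"
  assumes K: "compact K" "K \<noteq> {}"
  shows "min_over A K \<in> borel_measurable (PiM A (\<lambda>_. lborel))"
proof -
  have "min_over A K \<in> borel_measurable borel"
  proof (rule borel_measurableI_less)
    fix b
    have "{R. min_over A K R < b} = (\<Union>z\<in>K. {R. (\<Sum>\<beta>\<in>A. R \<beta> * z \<beta>) < b})"
    proof safe
      fix R assume "min_over A K R < b"
      then show "R \<in> (\<Union>z\<in>K. {R. (\<Sum>\<beta>\<in>A. R \<beta> * z \<beta>) < b})"
        by (rule_tac min_over_attained[OF K, of A R]) auto
    next
      fix R z assume "z \<in> K" "(\<Sum>\<beta>\<in>A. R \<beta> * z \<beta>) < b"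
      then show "min_over A K R < b"
        using min_over_le[OF K(1), of z A R] by simp
    qed
    moreover have "open {R. (\<Sum>\<beta>\<in>A. R \<beta> * z \<beta>) < b}" for z
      by (intro open_Collect_less continuous_intros continuous_on_coordinate)
    ultimately show "{x \<in> space borel. min_over A K x < b} \<in> sets borel"
      by (simp add: open_UN)
  qed
  \<comment> \<open>Extension by zero transfers Borel measurability on all coefficient functions to
    the product sigma-algebra over \<open>A\<close>.\<close>
  moreover have "(\<lambda>x \<beta>. if \<beta> \<in> A then x \<beta> else 0) \<in> measurable (PiM A (\<lambda>_. lborel)) borel"
  proof (rule measurable_coordinatewise_then_product)
    fix \<beta> show "(\<lambda>x. if \<beta> \<in> A then x \<beta> else 0) \<in> borel_measurable (PiM A (\<lambda>_. lborel))"
      by (cases "\<beta> \<in> A") auto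
  qed
  ultimately have "(\<lambda>x. min_over A K (\<lambda>\<beta>. if \<beta> \<in> A then x \<beta> else 0)) \<in> borel_measurable (PiM A (\<lambda>_. lborel))"
    by (rule measurable_compose[rotated])
  moreover have "min_over A K (\<lambda>\<beta>. if \<beta> \<in> A then x \<beta> else 0) = min_over A K x" for x
    by (rule min_over_cong) simp
  ultimately show ?thesis by simp
qed

text \<open>Raising the coordinate \<open>\<alpha>\<close> of the objective by h raises the first minimum by at most
  \<open>p * h\<close> and the second one by at least \<open>q * h\<close>.  So the two minima agree in at most one point
  of each line parallel to that axis, and Fubini applies.\<close>

lemma null_set_min_over_eq:
  fixes K L :: "('i::countable \<Rightarrow> real) set"
  assumes A: "finite A" "\<alpha> \<in> A" and K: "compact K" "K \<noteq> {}" and L: "compact L" "L \<noteq> {}"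
    and pq: "p < q" "\<And>z. z \<in> K \<Longrightarrow> z \<alpha> \<le> p" "\<And>z. z \<in> L \<Longrightarrow> q \<le> z \<alpha>"
  shows "{x \<in> space (PiM A (\<lambda>_. lborel)). min_over A K x = min_over A L x}
    \<in> null_sets (PiM A (\<lambda>_. lborel))"
proof -
  define A' where "A' = A - {\<alpha>}"
  have A': "finite A'" "\<alpha> \<notin> A'" "insert \<alpha> A' = A" using A by (auto simp: A'_def)
  define N where "N = {x \<in> space (PiM A (\<lambda>_. lborel)). min_over A K x = min_over A L x}"
  have N: "N \<in> sets (PiM A (\<lambda>_. lborel))"
    unfolding N_def using min_over_measurable[OF K, of A] min_over_measurable[OF L, of A]
    by measurable
  interpret product_sigma_finite "\<lambda>_ :: 'i. lborel :: real measure"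
    by standard
  have shift: "(\<Sum>\<beta>\<in>A. (x(\<alpha> := y')) \<beta> * z \<beta>) = (\<Sum>\<beta>\<in>A. (x(\<alpha> := y)) \<beta> * z \<beta>) + (y' - y) * z \<alpha>"
    for x z :: "'i \<Rightarrow> real" and y y'
  proof -
    have "(\<Sum>\<beta>\<in>A. (x(\<alpha> := b)) \<beta> * z \<beta>) = b * z \<alpha> + (\<Sum>\<beta>\<in>A'. x \<beta> * z \<beta>)" for b
      unfolding A'(3)[symmetric] sum.insert[OF A'(1,2)] using A'(2) by (auto intro!: sum.cong)
    then show ?thesis by (simp add: algebra_simps)
  qed
  have unique: False if "y < y'" "x(\<alpha> := y) \<in> N" "x(\<alpha> := y') \<in> N" for x y y'
  proof -
    obtain z where z: "z \<in> K" "min_over A K (x(\<alpha> := y)) = (\<Sum>\<beta>\<in>A. (x(\<alpha> := y)) \<beta> * z \<beta>)"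
      using min_over_attained[OF K, of A "x(\<alpha> := y)"] by blast
    have "min_over A K (x(\<alpha> := y')) \<le> (\<Sum>\<beta>\<in>A. (x(\<alpha> := y')) \<beta> * z \<beta>)"
      by (rule min_over_le[OF K(1) z(1)])
    also have "\<dots> = min_over A K (x(\<alpha> := y)) + (y' - y) * z \<alpha>" unfolding shift[of x y' z y] z(2) ..
    also have "\<dots> \<le> min_over A K (x(\<alpha> := y)) + (y' - y) * p"
      using that pq(2)[OF z(1)] by (intro add_left_mono mult_left_mono) auto
    finally have 1: "min_over A K (x(\<alpha> := y')) \<le> min_over A K (x(\<alpha> := y)) + (y' - y) * p" .
    obtain w where w: "w \<in> L" "min_over A L (x(\<alpha> := y')) = (\<Sum>\<beta>\<in>A. (x(\<alpha> := y')) \<beta> * w \<beta>)"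
      using min_over_attained[OF L, of A "x(\<alpha> := y')"] by blast
    have "min_over A L (x(\<alpha> := y)) + (y' - y) * q
        \<le> (\<Sum>\<beta>\<in>A. (x(\<alpha> := y)) \<beta> * w \<beta>) + (y' - y) * w \<alpha>"
      using that pq(3)[OF w(1)] by (intro add_mono mult_left_mono min_over_le[OF L(1) w(1)]) auto
    also have "\<dots> = min_over A L (x(\<alpha> := y'))" unfolding w(2) shift[of x y' w y] ..
    finally have 2: "min_over A L (x(\<alpha> := y)) + (y' - y) * q \<le> min_over A L (x(\<alpha> := y'))" .
    have "(y' - y) * p < (y' - y) * q" using that pq by (intro mult_strict_left_mono) auto
    moreover have "min_over A K (x(\<alpha> := y)) = min_over A L (x(\<alpha> := y))"
      "min_over A K (x(\<alpha> := y')) = min_over A L (x(\<alpha> := y'))" using that by (simp_all add: N_def)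
    ultimately show False using 1 2 by linarith
  qed
  have slice: "(\<integral>\<^sup>+ y. indicator N (x(\<alpha> := y)) \<partial>lborel) = 0" for x
  proof (cases "\<exists>y. x(\<alpha> := y) \<in> N")
    case True
    then obtain y0 where y0: "x(\<alpha> := y0) \<in> N" by blast
    have "y = y0" if "x(\<alpha> := y) \<in> N" for y
      using unique[of y y0 x] unique[of y0 y x] y0 that by (meson linorder_neqE)
    then have "indicator N (x(\<alpha> := y)) \<le> (indicator {y0} y :: ennreal)" for y
      by (auto simp: indicator_def)
    then have "(\<integral>\<^sup>+ y. indicator N (x(\<alpha> := y)) \<partial>lborel) \<le> (\<integral>\<^sup>+ y. indicator {y0} y \<partial>lborel)"
      by (intro nn_integral_mono) auto
    then show ?thesis by simp
  qed (simp add: indicator_def)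
  have "emeasure (PiM A (\<lambda>_. lborel)) N = (\<integral>\<^sup>+ x. indicator N x \<partial>PiM (insert \<alpha> A') (\<lambda>_. lborel))"
    using N A' by simp
  also have "\<dots> = (\<integral>\<^sup>+ x. (\<integral>\<^sup>+ y. indicator N (x(\<alpha> := y)) \<partial>lborel) \<partial>PiM A' (\<lambda>_. lborel))"
    using N A' by (intro product_nn_integral_insert) auto
  finally show ?thesis using N unfolding slice N_def[symmetric] by auto
qed

text \<open>If two minimizers differ at \<open>\<alpha>\<close>, rationals \<open>p < q\<close>
  separate their values there. Then the parts of \<open>K\<close> below \<open>p\<close> and above
  \<open>q\<close> both attain the minimum over \<open>K\<close>, which puts \<open>R\<close> in one
  of countably many null sets.\<close>

lemma generic_unique_minimizer:
  fixes K :: "('i::countable \<Rightarrow> real) set"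
  assumes A: "finite A" and K: "compact K"
  shows "\<exists>N\<in>null_sets (PiM A (\<lambda>_. lborel)). \<forall>R z z'. restrict R A \<notin> N \<longrightarrow> z \<in> K \<longrightarrow> z' \<in> K \<longrightarrow>
       (\<forall>w\<in>K. (\<Sum>\<beta>\<in>A. R \<beta> * z \<beta>) \<le> (\<Sum>\<beta>\<in>A. R \<beta> * w \<beta>)) \<longrightarrow>
       (\<forall>w\<in>K. (\<Sum>\<beta>\<in>A. R \<beta> * z' \<beta>) \<le> (\<Sum>\<beta>\<in>A. R \<beta> * w \<beta>)) \<longrightarrow> (\<forall>\<alpha>\<in>A. z \<alpha> = z' \<alpha>)"
proof -
  define lo where "lo = (\<lambda>\<alpha> (p::real). K \<inter> {z. z \<alpha> \<le> p})"
  define hi where "hi = (\<lambda>\<alpha> (q::real). K \<inter> {z. q \<le> z \<alpha>})"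
  have compact: "compact (lo \<alpha> p)" "compact (hi \<alpha> p)" for \<alpha> p
    unfolding lo_def hi_def using K
    by (intro compact_Int_closed closed_Collect_le continuous_on_const continuous_on_coordinate; simp)+
  \<comment> \<open>The guard excludes empty parts, on which the infimum is not attained and the
    null set lemma does not apply.\<close>
  define N where "N = (\<lambda>(\<alpha>, p, q). if p < q \<and> lo \<alpha> p \<noteq> {} \<and> hi \<alpha> q \<noteq> {}
    then {x \<in> space (PiM A (\<lambda>_. lborel)). min_over A (lo \<alpha> p) x = min_over A (hi \<alpha> q) x} else {})"
  have "N i \<in> null_sets (PiM A (\<lambda>_. lborel))" if mem: "i \<in> A \<times> \<rat> \<times> \<rat>" for i
  proof -
    obtain \<alpha> p q where i: "i = (\<alpha>, p, q)" "\<alpha> \<in> A" using mem by (cases i) auto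
    show ?thesis
    proof (cases "p < q \<and> lo \<alpha> p \<noteq> {} \<and> hi \<alpha> q \<noteq> {}")
      case True
      then have "{x \<in> space (PiM A (\<lambda>_. lborel)). min_over A (lo \<alpha> p) x = min_over A (hi \<alpha> q) x}
          \<in> null_sets (PiM A (\<lambda>_. lborel))"
        by (intro null_set_min_over_eq[OF A i(2) compact(1) _ compact(2), where p = p and q = q])
          (simp_all add: lo_def hi_def)
      then show ?thesis using True by (simp add: N_def i)
    qed (auto simp: N_def i)
  qed
  then have null: "(\<Union>i\<in>A \<times> \<rat> \<times> \<rat>. N i) \<in> null_sets (PiM A (\<lambda>_. lborel))"
    using A by (intro null_sets_UN' countable_SIGMA) (auto simp: countable_rat countable_finite)
  have le: "\<not> z \<alpha> < z' \<alpha>"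
    if R: "restrict R A \<notin> (\<Union>i\<in>A \<times> \<rat> \<times> \<rat>. N i)" and z: "z \<in> K" "z' \<in> K"
      and min: "\<And>w. w \<in> K \<Longrightarrow> (\<Sum>\<beta>\<in>A. R \<beta> * z \<beta>) \<le> (\<Sum>\<beta>\<in>A. R \<beta> * w \<beta>)"
        "\<And>w. w \<in> K \<Longrightarrow> (\<Sum>\<beta>\<in>A. R \<beta> * z' \<beta>) \<le> (\<Sum>\<beta>\<in>A. R \<beta> * w \<beta>)"
      and \<alpha>: "\<alpha> \<in> A" for R z z' \<alpha>
  proof
    assume "z \<alpha> < z' \<alpha>"
    then obtain p where p: "p \<in> \<rat>" "z \<alpha> < p" "p < z' \<alpha>" using Rats_dense_in_real by blast
    obtain q where q: "q \<in> \<rat>" "p < q" "q < z' \<alpha>" using Rats_dense_in_real[OF p(3)] by blast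
    have zs: "z \<in> lo \<alpha> p" "z' \<in> hi \<alpha> q" using z p q by (auto simp: lo_def hi_def)
    have "min_over A (lo \<alpha> p) R = (\<Sum>\<beta>\<in>A. R \<beta> * z \<beta>)"
      by (rule min_over_eqI[OF zs(1)]) (auto simp: lo_def intro: min)
    moreover have "min_over A (hi \<alpha> q) R = (\<Sum>\<beta>\<in>A. R \<beta> * z' \<beta>)"
      by (rule min_over_eqI[OF zs(2)]) (auto simp: hi_def intro: min)
    moreover have "(\<Sum>\<beta>\<in>A. R \<beta> * z \<beta>) = (\<Sum>\<beta>\<in>A. R \<beta> * z' \<beta>)"
      using min z by (intro antisym) auto
    moreover have "min_over A S (restrict R A) = min_over A S R" for S
      by (rule min_over_cong) simp
    ultimately have "restrict R A \<in> N (\<alpha>, p, q)"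
      using zs q by (auto simp: N_def space_PiM)
    then show False using R \<alpha> p q by blast
  qed
  show ?thesis
  proof (intro bexI[OF _ null] allI impI ballI)
    fix R z z' \<alpha>
    assume h: "restrict R A \<notin> (\<Union>i\<in>A \<times> \<rat> \<times> \<rat>. N i)" "z \<in> K" "z' \<in> K"
      "\<forall>w\<in>K. (\<Sum>\<beta>\<in>A. R \<beta> * z \<beta>) \<le> (\<Sum>\<beta>\<in>A. R \<beta> * w \<beta>)"
      "\<forall>w\<in>K. (\<Sum>\<beta>\<in>A. R \<beta> * z' \<beta>) \<le> (\<Sum>\<beta>\<in>A. R \<beta> * w \<beta>)" "\<alpha> \<in> A"
    show "z \<alpha> = z' \<alpha>"
      using le[OF h(1,2,3) bspec[OF h(4)] bspec[OF h(5)] h(6)]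
        le[OF h(1,3,2) bspec[OF h(5)] bspec[OF h(4)] h(6)] by simp
  qed
qed

section \<open>Riesz functionals on the polynomial ring\<close>

text \<open>In this form polynomials are a commutative ring, so identities can be proved by ring
  algebra; exponents are added pointwise.\<close>

type_synonym 'n mpoly = "('n \<Rightarrow> nat, real) poly_mapping"

definition riesz :: "(('n::finite \<Rightarrow> nat) \<Rightarrow> real) \<Rightarrow> 'n mpoly \<Rightarrow> real" where
  "riesz z f = pair (Poly_Mapping.lookup f) z"

definition evalp :: "real^'n \<Rightarrow> 'n::finite mpoly \<Rightarrow> real" where
  "evalp x f = riesz (\<lambda>\<alpha>. monom_eval \<alpha> x) f"

definition Var :: "'n::finite \<Rightarrow> 'n mpoly" where
  "Var i = Poly_Mapping.single (\<lambda>j. if j = i then 1 else 0) 1"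

abbreviation Const :: "real \<Rightarrow> 'n::finite mpoly" where
  "Const b \<equiv> Poly_Mapping.single 0 b"

lemma psupp_lookup: "psupp (Poly_Mapping.lookup f) = Poly_Mapping.keys f"
  by (simp add: psupp_def Poly_Mapping.keys.rep_eq)

lemma riesz_eq_sum:
  assumes "finite S" "Poly_Mapping.keys f \<subseteq> S"
  shows "riesz z f = (\<Sum>\<alpha>\<in>S. Poly_Mapping.lookup f \<alpha> * z \<alpha>)"
  unfolding riesz_def pair_def psupp_lookup
  using assms by (intro sum.mono_neutral_left) (auto simp: in_keys_iff)

lemma riesz_zero [simp]: "riesz z 0 = 0"
  by (simp add: riesz_eq_sum[of "{}"])

lemma riesz_add: "riesz z (f + g) = riesz z f + riesz z g"
proof -
  let ?S = "Poly_Mapping.keys f \<union> Poly_Mapping.keys g"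
  have "finite ?S" "Poly_Mapping.keys (f + g) \<subseteq> ?S" by (auto dest: subsetD[OF Poly_Mapping.keys_add])
  then show ?thesis
    by (simp add: riesz_eq_sum[of ?S] lookup_add algebra_simps sum.distrib)
qed

lemma riesz_uminus: "riesz z (- f) = - riesz z f"
  using riesz_add[of z f "- f"] by simp

lemma riesz_diff: "riesz z (f - g) = riesz z f - riesz z g"
  using riesz_add[of z f "- g"] by (simp add: riesz_uminus)

lemma riesz_sum: "riesz z (\<Sum>i\<in>S. f i) = (\<Sum>i\<in>S. riesz z (f i))"
  by (induction S rule: infinite_finite_induct) (auto simp: riesz_add)

lemma riesz_single: "riesz z (Poly_Mapping.single \<alpha> b) = b * z \<alpha>"
  by (subst riesz_eq_sum[of "{\<alpha>}"]) auto

lemma riesz_one: "riesz z 1 = z 0"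
  using riesz_single[of z 0 1] by simp

lemma sum_single: "f = (\<Sum>\<alpha>\<in>Poly_Mapping.keys f. Poly_Mapping.single \<alpha> (Poly_Mapping.lookup f \<alpha>))"
proof (rule poly_mapping_eqI)
  fix \<beta>
  have "Poly_Mapping.lookup (\<Sum>\<alpha>\<in>Poly_Mapping.keys f. Poly_Mapping.single \<alpha> (Poly_Mapping.lookup f \<alpha>)) \<beta>
    = (\<Sum>\<alpha>\<in>Poly_Mapping.keys f. if \<alpha> = \<beta> then Poly_Mapping.lookup f \<beta> else 0)"
    unfolding lookup_sum by (intro sum.cong) (auto simp: lookup_single when_def)
  then show "Poly_Mapping.lookup f \<beta> = Poly_Mapping.lookup
      (\<Sum>\<alpha>\<in>Poly_Mapping.keys f. Poly_Mapping.single \<alpha> (Poly_Mapping.lookup f \<alpha>)) \<beta>"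
    by (simp add: in_keys_iff)
qed

lemma riesz_mult:
  "riesz z (f * g) = (\<Sum>\<alpha>\<in>Poly_Mapping.keys f. \<Sum>\<beta>\<in>Poly_Mapping.keys g.
     Poly_Mapping.lookup f \<alpha> * Poly_Mapping.lookup g \<beta> * z (\<alpha> + \<beta>))"
proof -
  have "f * g = (\<Sum>\<alpha>\<in>Poly_Mapping.keys f. \<Sum>\<beta>\<in>Poly_Mapping.keys g.
     Poly_Mapping.single (\<alpha> + \<beta>) (Poly_Mapping.lookup f \<alpha> * Poly_Mapping.lookup g \<beta>))"
    by (subst (1) sum_single[of f], subst (1) sum_single[of g])
      (simp add: sum_product mult_single)
  then show ?thesis by (simp add: riesz_sum riesz_single)
qed

lemma riesz_Const_mult: "riesz z (Const b * f) = b * riesz z f"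
  by (simp add: riesz_mult riesz_eq_sum[OF finite_keys order_refl, of z f] sum_distrib_left mult.assoc)

lemma riesz_of_nat_mult: "riesz z (of_nat k * f) = real k * riesz z f"
  using riesz_Const_mult[of z "real k" f] by simp

lemma evalp_zero [simp]: "evalp x 0 = 0"
  by (simp add: evalp_def)

lemma evalp_one [simp]: "evalp x 1 = 1"
  by (simp add: evalp_def riesz_one zero_fun_def)

lemma evalp_Const [simp]: "evalp x (Const b) = b"
  by (simp add: evalp_def riesz_single zero_fun_def)

lemma evalp_of_nat [simp]: "evalp x (of_nat k) = real k"
  using evalp_Const[of x "real k"] by simp

lemma evalp_numeral [simp]: "evalp x (numeral k) = numeral k"
  using evalp_of_nat[of x "numeral k"] unfolding of_nat_numeral .

lemma evalp_add [simp]: "evalp x (f + g) = evalp x f + evalp x g"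
  by (simp add: evalp_def riesz_add)

lemma evalp_diff [simp]: "evalp x (f - g) = evalp x f - evalp x g"
  by (simp add: evalp_def riesz_diff)

lemma evalp_sum [simp]: "evalp x (\<Sum>i\<in>S. f i) = (\<Sum>i\<in>S. evalp x (f i))"
  by (simp add: evalp_def riesz_sum)

lemma evalp_mult [simp]: "evalp x (f * g) = evalp x f * evalp x g"
proof -
  have "evalp x (f * g) = (\<Sum>\<alpha>\<in>Poly_Mapping.keys f. \<Sum>\<beta>\<in>Poly_Mapping.keys g.
     (Poly_Mapping.lookup f \<alpha> * monom_eval \<alpha> x) * (Poly_Mapping.lookup g \<beta> * monom_eval \<beta> x))"
    unfolding evalp_def riesz_mult by (intro sum.cong) (auto simp: plus_fun_def monom_eval_add)
  also have "\<dots> = evalp x f * evalp x g"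
    by (simp add: evalp_def riesz_eq_sum[OF finite_keys order_refl] sum_product)
  finally show ?thesis .
qed

lemma evalp_power [simp]: "evalp x (f ^ k) = evalp x f ^ k"
  by (induction k) auto

lemma evalp_prod [simp]: "evalp x (\<Prod>i\<in>S. f i) = (\<Prod>i\<in>S. evalp x (f i))"
  by (induction S rule: infinite_finite_induct) auto

lemma evalp_Var [simp]: "evalp x (Var i) = x $ i"
proof -
  have "monom_eval (\<lambda>j. if j = i then 1 else 0) x = (\<Prod>j\<in>UNIV. if j = i then x $ j else 1)"
    unfolding monom_eval_def by (intro prod.cong) auto
  then show ?thesis by (simp add: evalp_def Var_def riesz_single)
qed

lemma evalp_eq_peval: "evalp x f = peval (Poly_Mapping.lookup f) x"
  by (simp add: evalp_def riesz_def peval_eq_pair)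

lemma continuous_on_evalp: "continuous_on S (\<lambda>x. evalp x f)"
  unfolding evalp_eq_peval by (rule continuous_on_peval)

section \<open>Bernstein approximation of Riesz functionals\<close>

text \<open>The grid weights below have factorial moments equal to moments of the functional, so this
  bound says that their ordinary moments are asymptotically the moments of the functional.\<close>

lemma binomial_ratio_approx:
  assumes "k \<le> N" "2 * a \<le> N" "0 < N"
  shows "\<bar>real (k choose a) / real (N choose a) - (real k / real N) ^ a\<bar> \<le> 2 * (real a)\<^sup>2 / real N"
proof -
  have quot: "real (k choose a) / real (N choose a)
      = (\<Prod>j\<in>{0..<a}. (real k - real j) / (real N - real j))"
    unfolding binomial_gbinomial gbinomial_prod_rev by (simp add: prod_dividef)
  \<comment> \<open>For factors of absolute value at most 1, a difference of products is bounded by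
    the sum of the factor differences. From \<open>2 * a \<le> N\<close> follows
    \<open>j \<le> N - j\<close>, which covers the negative factors with \<open>k < j\<close>
    too.\<close>
  have "norm ((\<Prod>j\<in>{0..<a}. (real k - real j) / (real N - real j)) - (\<Prod>j\<in>{0..<a}. real k / real N))
     \<le> (\<Sum>j\<in>{0..<a}. norm ((real k - real j) / (real N - real j) - real k / real N))"
  proof (rule norm_prod_diff)
    fix j assume "j \<in> {0..<a}"
    then have "real j \<le> real N - real j" "real k \<le> real N" "0 < real N - real j" "0 \<le> real k"
      using assms by auto
    then show "norm ((real k - real j) / (real N - real j)) \<le> 1"
      by (simp add: abs_le_iff)
    show "norm (real k / real N) \<le> 1" using assms by simp
  qed
  also have "\<dots> \<le> (\<Sum>j\<in>{0..<a}. 2 * real a / real N)"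
  proof (rule sum_mono)
    fix j assume "j \<in> {0..<a}"
    then have j: "real j \<le> real a" "real N \<le> 2 * (real N - real j)" "0 < real N - real j"
      "0 < real N" "real k \<le> real N"
      using assms by auto
    have "(real k - real j) / (real N - real j) - real k / real N
        = - (real j * (real N - real k) / (real N * (real N - real j)))"
      using j by (simp add: field_simps)
    then have "norm ((real k - real j) / (real N - real j) - real k / real N)
        = real j * (real N - real k) / (real N * (real N - real j))"
      using j by (simp add: abs_mult)
    also have "\<dots> \<le> real a * real N / (real N * (real N / 2))"
      using j by (intro frac_le mult_mono mult_pos_pos) auto
    also have "\<dots> = 2 * real a / real N" using j by simp
    finally show "norm ((real k - real j) / (real N - real j) - real k / real N) \<le> 2 * real a / real N" .
  qed
  also have "\<dots> = 2 * (real a)\<^sup>2 / real N" by (simp add: power2_eq_square)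
  finally show ?thesis unfolding quot by simp
qed

text \<open>The factorial moments of a binomial distribution. Absorbing \<open>k choose a\<close>
  into \<open>N choose a\<close> leaves the binomial expansion of \<open>(Y + W) ^ (N - a)\<close>.
  A general semiring is allowed because \<open>Y\<close> and \<open>W\<close> will be
  polynomials.\<close>

lemma factorial_moment_identity:
  fixes Y W :: "'a::comm_semiring_1"
  assumes "Y + W = 1" "a \<le> N"
  shows "(\<Sum>k\<le>N. of_nat ((N choose k) * (k choose a)) * (Y ^ k * W ^ (N - k))) = of_nat (N choose a) * Y ^ a"
proof -
  have "(\<Sum>k\<le>N. of_nat ((N choose k) * (k choose a)) * (Y ^ k * W ^ (N - k)))
      = (\<Sum>k\<in>{a..N}. of_nat ((N choose k) * (k choose a)) * (Y ^ k * W ^ (N - k)))"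
    by (rule sum.mono_neutral_right) (auto simp: binomial_eq_0)
  also have "\<dots> = (\<Sum>i\<le>N - a. of_nat (N choose a) * Y ^ a * (of_nat ((N - a) choose i) * Y ^ i * W ^ (N - a - i)))"
  proof (rule sum.reindex_bij_witness[of _ "\<lambda>i. i + a" "\<lambda>k. k - a"])
    fix k assume k: "k \<in> {a..N}"
    then have "Y ^ k = Y ^ a * Y ^ (k - a)" "N - k = N - a - (k - a)" by (auto simp flip: power_add)
    moreover have "(N choose k) * (k choose a) = (N choose a) * ((N - a) choose (k - a))"
      using k by (intro choose_mult) auto
    ultimately show "of_nat (N choose a) * Y ^ a * (of_nat ((N - a) choose (k - a)) * Y ^ (k - a) * W ^ (N - a - (k - a)))
        = of_nat ((N choose k) * (k choose a)) * (Y ^ k * W ^ (N - k))"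
      by (simp add: mult_ac)
  qed (use assms in auto)
  also have "\<dots> = of_nat (N choose a) * Y ^ a * (Y + W) ^ (N - a)"
    by (simp add: binomial_ring sum_distrib_left)
  finally show ?thesis using assms by simp
qed

section \<open>Sums of squares modulo the sphere ideal\<close>

inductive_set sums_of_squares :: "'a::comm_ring_1 set" where
  zero: "0 \<in> sums_of_squares"
| add_square: "s \<in> sums_of_squares \<Longrightarrow> s + q * q \<in> sums_of_squares"

lemma square_sums_of_squares: "q * q \<in> sums_of_squares"
  using sums_of_squares.add_square[OF sums_of_squares.zero, of q] by simp

lemma sums_of_squares_add:
  assumes "s \<in> sums_of_squares" "t \<in> sums_of_squares"
  shows "s + t \<in> sums_of_squares"
  using assms(2,1)
proof (induction t rule: sums_of_squares.induct)
  case (add_square t q)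
  then show ?case using sums_of_squares.add_square[of "s + t" q] by (simp add: add.assoc)
qed simp

lemma sums_of_squares_sum:
  "(\<And>i. i \<in> S \<Longrightarrow> f i \<in> sums_of_squares) \<Longrightarrow> (\<Sum>i\<in>S. f i) \<in> sums_of_squares"
  by (induction S rule: infinite_finite_induct) (auto intro: sums_of_squares.zero sums_of_squares_add)

lemma sums_of_squares_mult:
  assumes "s \<in> sums_of_squares" "t \<in> sums_of_squares"
  shows "s * t \<in> sums_of_squares"
  using assms(2,1)
proof (induction t rule: sums_of_squares.induct)
  case (add_square t q)
  have "s * (q * q) \<in> sums_of_squares" using add_square.prems
  proof (induction s rule: sums_of_squares.induct)
    case (add_square s r)
    then have "s * (q * q) + (r * q) * (r * q) \<in> sums_of_squares"
      by (intro sums_of_squares.add_square) simp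
    then show ?case by (simp add: algebra_simps)
  qed (simp add: sums_of_squares.zero)
  with add_square show ?case by (simp add: distrib_left sums_of_squares_add)
qed (simp add: sums_of_squares.zero)

definition upper :: "'n::finite \<Rightarrow> 'n mpoly" where "upper i = Const (1/2) * (1 + Var i)"
definition lower :: "'n::finite \<Rightarrow> 'n mpoly" where "lower i = Const (1/2) * (1 - Var i)"

lemma Const_half: "(Const (1/2) :: 'n::finite mpoly) + Const (1/2) = 1"
  by (simp flip: single_add)

lemma upper_plus_lower: "upper i + lower i = 1"
proof -
  have "upper i + lower i = Const (1/2) + Const (1/2)" by (simp add: upper_def lower_def algebra_simps)
  then show ?thesis by (simp only: Const_half)
qed

lemma Var_eq_upper: "Var i = upper i + upper i - 1"
proof -
  have "upper i + upper i = (Const (1/2) + Const (1/2)) * (1 + Var i)" by (simp add: upper_def algebra_simps)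
  then show ?thesis by (simp only: Const_half) simp
qed

lemma evalp_upper: "evalp x (upper i) = (1 + x $ i) / 2"
  by (simp add: upper_def)

text \<open>What a limit of relaxation solutions inherits whatever the constraints \<open>c\<close>
  are: positivity on squares of every degree, and vanishing on the sphere ideal.\<close>

locale sphere_functional =
  fixes z :: "('n::finite \<Rightarrow> nat) \<Rightarrow> real"
  assumes square_nonneg: "0 \<le> riesz z (f * f)"
    and sphere: "riesz z ((1 - (\<Sum>i\<in>UNIV. Var i * Var i)) * f) = 0"
begin

text \<open>The arbitrary factor \<open>q\<close> says that \<open>f - s\<close> lies in the largest
  ideal on which the functional vanishes. Mere equality of the values at \<open>f\<close> and
  \<open>s\<close> would not be preserved by products.\<close>

definition sos_mod :: "'n mpoly \<Rightarrow> bool" where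
  "sos_mod f \<longleftrightarrow> (\<exists>s\<in>sums_of_squares. \<forall>q. riesz z ((f - s) * q) = 0)"

lemma sums_of_squares_nonneg: "s \<in> sums_of_squares \<Longrightarrow> 0 \<le> riesz z s"
  by (induction s rule: sums_of_squares.induct) (auto simp: riesz_add square_nonneg add_nonneg_nonneg)

lemma sos_mod_nonneg: "sos_mod f \<Longrightarrow> 0 \<le> riesz z f"
proof -
  assume "sos_mod f"
  then obtain s where s: "s \<in> sums_of_squares" "\<And>q. riesz z ((f - s) * q) = 0"
    by (auto simp: sos_mod_def)
  from s(2)[of 1] have "riesz z f = riesz z s" by (simp add: riesz_diff)
  then show ?thesis using sums_of_squares_nonneg s by simp
qed

lemma sos_mod_square: "sos_mod (q * q)"
  unfolding sos_mod_def using square_sums_of_squares[of q] by (intro bexI[of _ "q * q"]) auto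

lemma sos_mod_mult:
  assumes "sos_mod f" "sos_mod g"
  shows "sos_mod (f * g)"
proof -
  obtain s t where st: "s \<in> sums_of_squares" "t \<in> sums_of_squares"
    "\<And>q. riesz z ((f - s) * q) = 0" "\<And>q. riesz z ((g - t) * q) = 0"
    using assms by (auto simp: sos_mod_def)
  have "riesz z ((f * g - s * t) * q) = 0" for q
  proof -
    have "(f * g - s * t) * q = (f - s) * (g * q) + (g - t) * (s * q)" by (simp add: algebra_simps)
    then show ?thesis by (simp add: riesz_add st)
  qed
  then show ?thesis using sums_of_squares_mult[OF st(1,2)] by (auto simp: sos_mod_def)
qed

lemma sos_mod_power: "sos_mod f \<Longrightarrow> sos_mod (f ^ k)"
  using sos_mod_square[of 1] by (induction k) (auto intro: sos_mod_mult)

lemma sos_mod_prod: "(\<And>i. i \<in> S \<Longrightarrow> sos_mod (f i)) \<Longrightarrow> sos_mod (\<Prod>i\<in>S. f i)"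
  using sos_mod_square[of 1] by (induction S rule: infinite_finite_induct) (auto intro: sos_mod_mult)

text \<open>On the sphere \<open>1 - x = ((1 - x)^2 + (1 - x^2)) / 2\<close>, and \<open>1 - x^2\<close> is the sum of the
  squares of the other variables.\<close>

lemma sos_mod_half:
  assumes "v * v = Var i * Var i"
  shows "sos_mod (Const (1/2) * (1 - v))"
proof -
  define h where "h = (Const (1/2) :: 'n mpoly)"
  define s where "s = (h * (1 - v)) * (h * (1 - v)) + (\<Sum>j\<in>UNIV - {i}. (h * Var j) * (h * Var j))"
  have "s \<in> sums_of_squares"
    unfolding s_def by (intro sums_of_squares_add sums_of_squares_sum square_sums_of_squares)
  moreover have "riesz z ((h * (1 - v) - s) * q) = 0" for q
  proof -
    have sq: "(\<Sum>j\<in>UNIV. Var j * Var j) = v * v + (\<Sum>j\<in>UNIV - {i}. Var j * Var j)"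
      using assms by (simp add: sum.remove[of UNIV i])
    have "(\<Sum>j\<in>UNIV - {i}. (h * Var j) * (h * Var j)) = h * h * (\<Sum>j\<in>UNIV - {i}. Var j * Var j)"
      by (simp add: sum_distrib_left mult_ac)
    \<comment> \<open>With \<open>h = 1/2\<close>, the terms \<open>v * v\<close> and the squares of
      the other variables cancel, leaving \<open>2 * h * h * (1 - v)\<close>. The hypothesis on
      \<open>v\<close> admits both signs of the variable.\<close>
    then have "s + h * h * (1 - (\<Sum>j\<in>UNIV. Var j * Var j)) = (h + h) * (h * (1 - v))"
      unfolding s_def sq by (simp add: algebra_simps)
    also have "\<dots> = h * (1 - v)" unfolding h_def Const_half by simp
    finally have "(h * (1 - v) - s) * q = (1 - (\<Sum>j\<in>UNIV. Var j * Var j)) * (h * h * q)"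
      by (metis (no_types, lifting) add_diff_cancel_left' mult.assoc mult.commute)
    then show ?thesis by (simp add: sphere)
  qed
  ultimately show ?thesis unfolding sos_mod_def h_def by blast
qed

lemma sos_mod_lower: "sos_mod (lower i)"
  unfolding lower_def by (rule sos_mod_half[of _ i]) simp

lemma sos_mod_upper: "sos_mod (upper i)"
  unfolding upper_def using sos_mod_half[of "- Var i" i] by simp

section \<open>Bernstein weights and their moments\<close>

definition grid :: "nat \<Rightarrow> ('n \<Rightarrow> nat) set" where
  "grid N = PiE UNIV (\<lambda>_. {..N})"

text \<open>The functional of the tensor-product Bernstein basis polynomial of degree
  \<open>N\<close> in each variable, at index \<open>\<kappa>\<close>.\<close>

definition weight :: "nat \<Rightarrow> ('n \<Rightarrow> nat) \<Rightarrow> real" where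
  "weight N \<kappa> = (\<Prod>i\<in>UNIV. real (N choose \<kappa> i)) * riesz z (\<Prod>i\<in>UNIV. upper i ^ \<kappa> i * lower i ^ (N - \<kappa> i))"

text \<open>The Bernstein node \<open>\<kappa> i / N\<close> in the unit interval, carried to
  \<open>[-1, 1]\<close> so that \<open>upper i\<close> takes the value
  \<open>\<kappa> i / N\<close> there.\<close>

definition node :: "nat \<Rightarrow> ('n \<Rightarrow> nat) \<Rightarrow> real^'n" where
  "node N \<kappa> = (\<chi> i. 2 * real (\<kappa> i) / real N - 1)"

lemma weight_nonneg: "0 \<le> weight N \<kappa>"
  unfolding weight_def
  by (intro mult_nonneg_nonneg prod_nonneg sos_mod_nonneg sos_mod_prod sos_mod_mult sos_mod_power
      sos_mod_upper sos_mod_lower) auto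

text \<open>Multiplying the one-variable identities over all coordinates and expanding gives an
  identity of polynomials, to which the functional is applied. It is exact for every such
  \<open>N\<close>; an error enters only with ordinary powers.\<close>

lemma factorial_moments:
  assumes "\<And>i. a i \<le> N"
  shows "(\<Sum>\<kappa>\<in>grid N. weight N \<kappa> * (\<Prod>i\<in>UNIV. real (\<kappa> i choose a i) / real (N choose a i)))
    = riesz z (\<Prod>i\<in>UNIV. upper i ^ a i)"
proof -
  define b where "b = (\<Prod>i\<in>UNIV. real (N choose a i))"
  have b: "b \<noteq> 0" unfolding b_def using assms by (simp add: binomial_eq_0_iff not_less)
  have "(\<Prod>i\<in>UNIV. of_nat (N choose a i) * upper i ^ a i)
      = (\<Prod>i\<in>UNIV. \<Sum>k\<in>{..N}. of_nat ((N choose k) * (k choose a i)) * (upper i ^ k * lower i ^ (N - k)))"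
    by (intro prod.cong refl factorial_moment_identity[OF upper_plus_lower assms, symmetric])
  also have "\<dots> = (\<Sum>\<kappa>\<in>grid N. \<Prod>i\<in>UNIV. of_nat ((N choose \<kappa> i) * (\<kappa> i choose a i)) * (upper i ^ \<kappa> i * lower i ^ (N - \<kappa> i)))"
    unfolding grid_def by (rule prod_sum_PiE) auto
  finally have "(\<Sum>\<kappa>\<in>grid N. of_nat (\<Prod>i\<in>UNIV. (N choose \<kappa> i) * (\<kappa> i choose a i)) * (\<Prod>i\<in>UNIV. upper i ^ \<kappa> i * lower i ^ (N - \<kappa> i)))
      = of_nat (\<Prod>i\<in>UNIV. N choose a i) * (\<Prod>i\<in>UNIV. upper i ^ a i)"
    by (simp add: prod.distrib)
  from arg_cong[OF this, of "riesz z"]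
  have "(\<Sum>\<kappa>\<in>grid N. weight N \<kappa> * (\<Prod>i\<in>UNIV. real (\<kappa> i choose a i))) = b * riesz z (\<Prod>i\<in>UNIV. upper i ^ a i)"
    unfolding riesz_sum riesz_of_nat_mult by (simp add: weight_def b_def prod.distrib mult_ac)
  then show ?thesis
    using b by (simp add: prod_dividef sum_divide_distrib[symmetric] flip: b_def)
qed

lemma sum_weight: "(\<Sum>\<kappa>\<in>grid N. weight N \<kappa>) = z 0"
  using factorial_moments[of "\<lambda>_. 0" N] by (simp add: riesz_one)

definition approx :: "'n mpoly \<Rightarrow> bool" where
  "approx f \<longleftrightarrow> (\<lambda>N. \<Sum>\<kappa>\<in>grid N. weight N \<kappa> * evalp (node N \<kappa>) f) \<longlonglongrightarrow> riesz z f"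

lemma approx_add: "approx f \<Longrightarrow> approx g \<Longrightarrow> approx (f + g)"
  unfolding approx_def by (drule (1) tendsto_add) (simp add: riesz_add algebra_simps sum.distrib)

lemma approx_diff: "approx f \<Longrightarrow> approx g \<Longrightarrow> approx (f - g)"
  unfolding approx_def by (drule (1) tendsto_diff) (simp add: riesz_diff algebra_simps sum_subtractf)

lemma approx_Const_mult: "approx f \<Longrightarrow> approx (Const b * f)"
  unfolding approx_def riesz_Const_mult by (drule tendsto_mult_left[of _ _ _ b])
    (simp add: sum_distrib_left mult_ac)

lemma approx_sum: "(\<And>i. i \<in> S \<Longrightarrow> approx (f i)) \<Longrightarrow> approx (\<Sum>i\<in>S. f i)"
proof -
  have "approx 0" by (simp add: approx_def)
  then show "(\<And>i. i \<in> S \<Longrightarrow> approx (f i)) \<Longrightarrow> approx (\<Sum>i\<in>S. f i)"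
    by (induction S rule: infinite_finite_induct) (auto intro: approx_add)
qed

text \<open>Replacing each exact binomial ratio by the power \<open>(\<kappa> i / N) ^ a i\<close>
  costs an error of order \<open>1 / N\<close>, and the nonnegative weights add up to
  \<open>z 0\<close>.\<close>

lemma approx_upper: "approx (\<Prod>i\<in>UNIV. upper i ^ a i)"
proof -
  define e where "e = (\<lambda>N. z 0 * (\<Sum>i\<in>UNIV. 2 * (real (a i))\<^sup>2 / real N))"
  \<comment> \<open>Large enough to give \<open>0 < N\<close> and \<open>2 * a i \<le> N\<close> for
    all \<open>i\<close>, as the ratio estimate demands.\<close>
  define M where "M = Suc (\<Sum>i\<in>UNIV. 2 * a i)"
  have bound: "\<bar>(\<Sum>\<kappa>\<in>grid N. weight N \<kappa> * evalp (node N \<kappa>) (\<Prod>i\<in>UNIV. upper i ^ a i)) - riesz z (\<Prod>i\<in>UNIV. upper i ^ a i)\<bar> \<le> e N"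
    if "M \<le> N" for N
  proof -
    have a: "2 * a i \<le> N" for i
      using member_le_sum[of i UNIV "\<lambda>i. 2 * a i"] that by (simp add: M_def)
    have N: "0 < N" using that by (simp add: M_def)
    have a': "a i \<le> N" for i using a[of i] by simp
    have ev: "evalp (node N \<kappa>) (\<Prod>i\<in>UNIV. upper i ^ a i) = (\<Prod>i\<in>UNIV. (real (\<kappa> i) / real N) ^ a i)" for \<kappa>
      by (simp add: evalp_upper node_def)
    have "\<bar>(\<Sum>\<kappa>\<in>grid N. weight N \<kappa> * evalp (node N \<kappa>) (\<Prod>i\<in>UNIV. upper i ^ a i)) - riesz z (\<Prod>i\<in>UNIV. upper i ^ a i)\<bar>
      = \<bar>\<Sum>\<kappa>\<in>grid N. weight N \<kappa> * ((\<Prod>i\<in>UNIV. (real (\<kappa> i) / real N) ^ a i)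
           - (\<Prod>i\<in>UNIV. real (\<kappa> i choose a i) / real (N choose a i)))\<bar>"
      unfolding ev factorial_moments[of a N, OF a', symmetric] right_diff_distrib sum_subtractf ..
    also have "\<dots> \<le> (\<Sum>\<kappa>\<in>grid N. weight N \<kappa> * (\<Sum>i\<in>UNIV. 2 * (real (a i))\<^sup>2 / real N))"
    proof (rule order_trans[OF sum_abs sum_mono])
      fix \<kappa> assume "\<kappa> \<in> grid N"
      then have \<kappa>: "\<kappa> i \<le> N" for i by (auto simp: grid_def)
      have "norm ((\<Prod>i\<in>UNIV. (real (\<kappa> i) / real N) ^ a i) - (\<Prod>i\<in>UNIV. real (\<kappa> i choose a i) / real (N choose a i)))
        \<le> (\<Sum>i\<in>UNIV. norm ((real (\<kappa> i) / real N) ^ a i - real (\<kappa> i choose a i) / real (N choose a i)))"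
      proof (rule norm_prod_diff)
        fix i
        show "norm ((real (\<kappa> i) / real N) ^ a i) \<le> 1"
          using \<kappa>[of i] N by (simp add: norm_power power_le_one)
        have "\<kappa> i choose a i \<le> N choose a i" using \<kappa>[of i] by (rule binomial_right_mono)
        then show "norm (real (\<kappa> i choose a i) / real (N choose a i)) \<le> 1"
          using a'[of i] by (simp add: divide_le_eq_1)
      qed
      also have "\<dots> \<le> (\<Sum>i\<in>UNIV. 2 * (real (a i))\<^sup>2 / real N)"
        using binomial_ratio_approx[OF \<kappa> a N]
        by (intro sum_mono) (simp add: abs_minus_commute)
      finally show "\<bar>weight N \<kappa> * ((\<Prod>i\<in>UNIV. (real (\<kappa> i) / real N) ^ a i)
           - (\<Prod>i\<in>UNIV. real (\<kappa> i choose a i) / real (N choose a i)))\<bar>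
         \<le> weight N \<kappa> * (\<Sum>i\<in>UNIV. 2 * (real (a i))\<^sup>2 / real N)"
        unfolding abs_mult using weight_nonneg[of N \<kappa>] by (simp add: mult_left_mono)
    qed
    also have "\<dots> = e N" by (simp add: e_def sum_weight flip: sum_distrib_right)
    finally show ?thesis .
  qed
  have "e \<longlonglongrightarrow> z 0 * (\<Sum>i\<in>(UNIV :: 'n set). 0)"
    unfolding e_def by (intro tendsto_mult tendsto_const tendsto_sum lim_const_over_n)
  then have e: "e \<longlonglongrightarrow> 0" by simp
  have "(\<lambda>N. (\<Sum>\<kappa>\<in>grid N. weight N \<kappa> * evalp (node N \<kappa>) (\<Prod>i\<in>UNIV. upper i ^ a i)) - riesz z (\<Prod>i\<in>UNIV. upper i ^ a i)) \<longlonglongrightarrow> 0"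
    by (rule Lim_null_comparison[OF _ e], rule eventually_sequentiallyI[of M])
      (simp only: real_norm_def bound)
  then show ?thesis unfolding approx_def by (rule LIM_zero_cancel)
qed

text \<open>Convergence is linear in the polynomial but not evidently stable under products. The
  induction therefore carries an arbitrary product of \<open>upper\<close> powers: each variable is
  \<open>2 * upper i - 1\<close>, and its factor is absorbed by raising \<open>a i\<close>.\<close>

lemma approx_monomial: "approx (Poly_Mapping.single \<alpha> 1 * (\<Prod>i\<in>UNIV. upper i ^ a i))"
proof (induction "mdeg \<alpha>" arbitrary: \<alpha> a)
  case 0
  then have "\<alpha> = 0" by (auto simp: mdeg_def)
  then show ?case using approx_upper[of a] by (simp only: single_one mult_1_left)
next
  case (Suc k)
  then obtain i where i: "\<alpha> i \<noteq> 0" by (metis (no_types, lifting) mdeg_def nat.distinct(1) sum.neutral)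
  define e where "e = (\<lambda>j. if j = i then 1 else 0 :: nat)"
  define \<beta> where "\<beta> = (\<lambda>j. \<alpha> j - e j)"
  have \<alpha>: "\<alpha> = \<beta> + e" using i by (auto simp: \<beta>_def e_def)
  have "mdeg e = 1" by (simp add: mdeg_def e_def)
  then have k: "k = mdeg \<beta>" using Suc(2) mdeg_add[of \<beta> e] by (simp add: \<alpha> plus_fun_def)
  define f where "f = (Poly_Mapping.single \<beta> 1 :: 'n mpoly)"
  have single: "Poly_Mapping.single \<alpha> 1 = f * Var i"
    by (simp add: f_def Var_def mult_single \<alpha> e_def)
  have raise: "(\<Prod>j\<in>UNIV. upper j ^ (a(i := Suc (a i))) j) = upper i * (\<Prod>j\<in>UNIV. upper j ^ a j)"
  proof -
    have "(\<Prod>j\<in>UNIV. upper j ^ (a(i := Suc (a i))) j) = upper i ^ Suc (a i) * (\<Prod>j\<in>UNIV - {i}. upper j ^ a j)"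
      by (subst prod.remove[of _ i]) (auto intro!: prod.cong)
    also have "\<dots> = upper i * (\<Prod>j\<in>UNIV. upper j ^ a j)"
      by (subst (2) prod.remove[of _ i]) (auto simp: mult.assoc)
    finally show ?thesis .
  qed
  have "Poly_Mapping.single \<alpha> 1 * (\<Prod>j\<in>UNIV. upper j ^ a j)
      = f * (\<Prod>j\<in>UNIV. upper j ^ (a(i := Suc (a i))) j) + f * (\<Prod>j\<in>UNIV. upper j ^ (a(i := Suc (a i))) j)
        - f * (\<Prod>j\<in>UNIV. upper j ^ a j)"
    unfolding single raise by (simp add: Var_eq_upper algebra_simps)
  then show ?case unfolding f_def using Suc(1)[OF k] by (simp only: approx_add approx_diff)
qed

lemma approx_all: "approx f"
proof -
  have "approx (Poly_Mapping.single \<alpha> b)" for \<alpha> b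
    using approx_Const_mult[OF approx_monomial[of \<alpha> "\<lambda>_. 0"], of b] by (simp add: mult_single)
  then show ?thesis by (subst sum_single) (intro approx_sum)
qed

text \<open>The functional is a limit of nonnegative combinations of values at nodes, and for
  positive \<open>N\<close> the nodes lie in the cube.\<close>

lemma riesz_nonneg_on_cube:
  assumes "\<And>x. (\<And>i. \<bar>x $ i\<bar> \<le> 1) \<Longrightarrow> 0 \<le> evalp x f"
  shows "0 \<le> riesz z f"
proof (rule LIMSEQ_le_const[OF approx_all[of f, unfolded approx_def]])
  have "0 \<le> (\<Sum>\<kappa>\<in>grid N. weight N \<kappa> * evalp (node N \<kappa>) f)" if "1 \<le> N" for N
  proof (intro sum_nonneg mult_nonneg_nonneg weight_nonneg assms)
    fix \<kappa> i assume "\<kappa> \<in> grid N"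
    then have "real (\<kappa> i) \<le> real N" by (auto simp: grid_def)
    then show "\<bar>node N \<kappa> $ i\<bar> \<le> 1" using that by (auto simp: node_def abs_le_iff field_simps)
  qed
  then show "\<exists>M. \<forall>N\<ge>M. 0 \<le> (\<Sum>\<kappa>\<in>grid N. weight N \<kappa> * evalp (node N \<kappa>) f)" by blast
qed

end

section \<open>Penalty estimates and positivity on the constraint set\<close>

text \<open>Bernoulli's inequality bounds \<open>1 + n * h\<close> by \<open>(1 + h) ^ n\<close>,
  and \<open>(1 + h) * (1 - h) \<le> 1\<close>.\<close>

lemma mult_power_le_inverse:
  fixes h :: real
  assumes "0 \<le> h" "h \<le> 1" "0 < n"
  shows "h * (1 - h) ^ n \<le> 1 / real n"
proof -
  have "(1 + real n * h) * (1 - h) ^ n \<le> (1 + h) ^ n * (1 - h) ^ n"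
    using assms by (intro mult_right_mono Bernoulli_inequality) auto
  also have "\<dots> = (1 - h * h) ^ n" by (simp add: power_mult_distrib[symmetric] algebra_simps)
  also have "\<dots> \<le> 1" using assms by (intro power_le_one) (auto simp: mult_le_one)
  finally have "(1 + real n * h) * (1 - h) ^ n \<le> 1" .
  moreover have "real n * h * (1 - h) ^ n \<le> (1 + real n * h) * (1 - h) ^ n"
    using assms by (intro mult_right_mono) auto
  ultimately have "real n * h * (1 - h) ^ n \<le> 1" by (rule order_trans[rotated])
  then show ?thesis using assms by (simp add: field_simps)
qed

text \<open>For \<open>h \<ge> 0\<close> this is the preceding estimate. For \<open>h < 0\<close>,
  Bernoulli gives \<open>(1 - h) ^ (2 * k) \<ge> 1 + 2 * k * \<bar>h\<bar>\<close>, and the negative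
  factor \<open>h\<close> turns it into a quadratic upper bound. The even power is written as a
  product to exhibit it as a square.\<close>

lemma penalty_bound:
  fixes h :: real
  assumes "\<bar>h\<bar> \<le> 1" "0 < k"
  shows "h * ((1 - h) ^ k * (1 - h) ^ k) \<le> 1 / real (2 * k) - real (2 * k) * (max 0 (- h))\<^sup>2"
proof -
  have pw: "(1 - h) ^ k * (1 - h) ^ k = (1 - h) ^ (2 * k)" by (simp add: mult_2 power_add)
  show ?thesis
  proof (cases "0 \<le> h")
    case True
    then show ?thesis using mult_power_le_inverse[of h "2 * k"] assms by (simp add: pw max_def)
  next
    case False
    have "1 + real (2 * k) * (- h) \<le> (1 + - h) ^ (2 * k)"
      using False by (intro Bernoulli_inequality) auto
    then have "h * (1 - h) ^ (2 * k) \<le> h * (1 + real (2 * k) * (- h))"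
      using False by (intro mult_left_mono_neg) auto
    also have "\<dots> = h - real (2 * k) * h\<^sup>2" by (simp add: power2_eq_square algebra_simps)
    also have "\<dots> \<le> 1 / real (2 * k) - real (2 * k) * h\<^sup>2"
      using False order_trans[of h 0 "1 / real (2 * k)"] by simp
    finally show ?thesis using False by (simp add: pw max_def)
  qed
qed

lemma compact_cube: "compact {x :: real^'n::finite. \<forall>i. \<bar>x $ i\<bar> \<le> 1}"
proof -
  have "{x :: real^'n. \<forall>i. \<bar>x $ i\<bar> \<le> 1} = cbox (\<chi> i. - 1) (\<chi> i. 1)"
    by (auto simp: mem_box_cart abs_le_iff minus_le_iff)
  then show ?thesis by simp
qed

lemma evalp_bounded_on_cube:
  obtains M where "0 < M" "\<And>x. \<forall>i. \<bar>x $ i\<bar> \<le> 1 \<Longrightarrow> \<bar>evalp x f\<bar> \<le> M"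
proof -
  have "compact ((\<lambda>x. evalp x f) ` {x. \<forall>i. \<bar>x $ i\<bar> \<le> 1})"
    by (intro compact_continuous_image continuous_on_evalp compact_cube)
  then obtain M where "0 < M" "\<And>y. y \<in> (\<lambda>x. evalp x f) ` {x. \<forall>i. \<bar>x $ i\<bar> \<le> 1} \<Longrightarrow> norm y \<le> M"
    using bounded_pos compact_imp_bounded by metis
  then show ?thesis by (intro that[of M]) auto
qed

context sphere_functional
begin

text \<open>For large k the polynomial F in the proof is nonnegative on the whole cube: the penalties
  \<open>2 * k * C\<^sup>2\<close> and \<open>- H * (1 - H) ^ (2 * k)\<close> are large away from the set defined by the
  constraints and at worst of order \<open>- 1 / k\<close> on it.  The functional of every penalty is nonpositive.\<close>

lemma riesz_nonneg_normalized:
  fixes C H :: "'i \<Rightarrow> 'n mpoly"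
  assumes fin: "finite E" "finite I"
    and E: "\<And>i. i \<in> E \<Longrightarrow> riesz z (C i * C i) = 0"
    and I: "\<And>j q. j \<in> I \<Longrightarrow> 0 \<le> riesz z (H j * (q * q))"
    and bd: "\<And>j x. j \<in> I \<Longrightarrow> (\<And>i. \<bar>x $ i\<bar> \<le> 1) \<Longrightarrow> \<bar>evalp x (H j)\<bar> \<le> 1"
    and p: "\<And>x. (\<And>i. i \<in> E \<Longrightarrow> evalp x (C i) = 0) \<Longrightarrow> (\<And>j. j \<in> I \<Longrightarrow> 0 \<le> evalp x (H j)) \<Longrightarrow>
      x \<bullet> x = 1 \<Longrightarrow> 0 \<le> evalp x p"
  shows "0 \<le> riesz z p"
proof (rule field_le_epsilon)
  fix e :: real assume "0 < e"
  have z0: "0 \<le> z 0" using square_nonneg[of 1] by (simp add: riesz_one)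
  \<comment> \<open>The added 1 keeps the quotient meaningful when \<open>z 0 = 0\<close>.\<close>
  define \<epsilon> where "\<epsilon> = e / (z 0 + 1)"
  have \<epsilon>: "0 < \<epsilon>" "\<epsilon> * z 0 \<le> e" using \<open>0 < e\<close> z0 by (auto simp: \<epsilon>_def field_simps)
  define cube where "cube = {x :: real^'n. \<forall>i. \<bar>x $ i\<bar> \<le> 1}"
  define S where "S = (1 - (\<Sum>i\<in>UNIV. Var i * Var i) :: 'n mpoly)"
  have evS: "evalp x S = 1 - x \<bullet> x" for x by (simp add: S_def inner_vec_def)
  \<comment> \<open>\<open>G\<close> measures the total squared violation of the constraints and
    vanishes exactly where all of them hold.\<close>
  define G where "G = (\<lambda>x. (\<Sum>i\<in>E. (evalp x (C i))\<^sup>2) + (evalp x S)\<^sup>2 + (\<Sum>j\<in>I. (max 0 (- evalp x (H j)))\<^sup>2))"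
  have G_nonneg: "0 \<le> G x" for x by (simp add: G_def sum_nonneg add_nonneg_nonneg)
  \<comment> \<open>The bad part of the cube. It is compact and contains no feasible point, so
    \<open>G\<close> has a positive lower bound \<open>\<eta>\<close> on it.\<close>
  define D where "D = cube \<inter> {x. evalp x p \<le> - \<epsilon> / 2}"
  have "\<exists>\<eta>>0. \<forall>x\<in>D. \<eta> \<le> G x"
  proof (cases "D = {}")
    case True then show ?thesis by (intro exI[of _ 1]) auto
  next
    case False
    have "compact D" unfolding D_def cube_def
      by (intro compact_Int_closed compact_cube closed_Collect_le continuous_on_evalp continuous_on_const)
    moreover have "continuous_on D G"
      unfolding G_def by (intro continuous_intros continuous_on_evalp)
    ultimately obtain x where x: "x \<in> D" "\<And>y. y \<in> D \<Longrightarrow> G x \<le> G y"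
      using continuous_attains_inf[of D G] False by metis
    have "G x \<noteq> 0"
    proof
      assume "G x = 0"
      moreover have "0 \<le> (\<Sum>i\<in>E. (evalp x (C i))\<^sup>2)" "0 \<le> (\<Sum>j\<in>I. (max 0 (- evalp x (H j)))\<^sup>2)"
        "0 \<le> (evalp x S)\<^sup>2" by (auto intro: sum_nonneg)
      ultimately have "(\<Sum>i\<in>E. (evalp x (C i))\<^sup>2) = 0" "(evalp x S)\<^sup>2 = 0"
        "(\<Sum>j\<in>I. (max 0 (- evalp x (H j)))\<^sup>2) = 0" unfolding G_def by linarith+
      then have *: "\<And>i. i \<in> E \<Longrightarrow> evalp x (C i) = 0" "x \<bullet> x = 1"
        "\<And>j. j \<in> I \<Longrightarrow> max 0 (- evalp x (H j)) = 0"
        using fin by (auto simp: sum_nonneg_eq_0_iff evS)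
      have "0 \<le> evalp x (H j)" if "j \<in> I" for j
        using *(3)[OF that] by (metis max.cobounded2 neg_le_0_iff_le)
      then have "0 \<le> evalp x p" using * by (intro p)
      then show False using x(1) \<epsilon> by (simp add: D_def)
    qed
    then show ?thesis using x G_nonneg[of x] by (intro exI[of _ "G x"]) auto
  qed
  then obtain \<eta> where \<eta>: "0 < \<eta>" "\<And>x. x \<in> D \<Longrightarrow> \<eta> \<le> G x" by blast
  obtain P where "0 < P" "\<And>x. \<forall>i. \<bar>x $ i\<bar> \<le> 1 \<Longrightarrow> \<bar>evalp x p\<bar> \<le> P"
    by (rule evalp_bounded_on_cube[of p]) blast
  then have P: "\<And>x. x \<in> cube \<Longrightarrow> \<bar>evalp x p\<bar> \<le> P" by (simp add: cube_def)
  \<comment> \<open>The first bound makes \<open>2 * k * G\<close> outweigh \<open>- p\<close> on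
    \<open>D\<close>; the second keeps the inequality penalties, together at most
    \<open>card I / (2 * k)\<close>, below \<open>\<epsilon> / 2\<close>.\<close>
  obtain k :: nat where k: "P / \<eta> < real k" "real (card I) / \<epsilon> < real k" "0 < k"
  proof -
    obtain k1 where "P / \<eta> < real k1" using reals_Archimedean2 by blast
    moreover obtain k2 where "real (card I) / \<epsilon> < real k2" using reals_Archimedean2 by blast
    ultimately show ?thesis by (intro that[of "Suc (k1 + k2)"]) auto
  qed
  define F where "F = p + Const \<epsilon> + of_nat (2 * k) * ((\<Sum>i\<in>E. C i * C i) + S * S)
    - (\<Sum>j\<in>I. H j * ((1 - H j) ^ k * (1 - H j) ^ k))"
  have "0 \<le> riesz z F"
  proof (rule riesz_nonneg_on_cube)
    fix x :: "real^'n" assume "\<And>i. \<bar>x $ i\<bar> \<le> 1"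
    then have x: "x \<in> cube" by (simp add: cube_def)
    have "(\<Sum>j\<in>I. evalp x (H j) * ((1 - evalp x (H j)) ^ k * (1 - evalp x (H j)) ^ k))
      \<le> (\<Sum>j\<in>I. 1 / real (2 * k) - real (2 * k) * (max 0 (- evalp x (H j)))\<^sup>2)"
      using bd \<open>\<And>i. \<bar>x $ i\<bar> \<le> 1\<close> k by (intro sum_mono penalty_bound) auto
    also have "\<dots> = real (card I) / real (2 * k) - real (2 * k) * (\<Sum>j\<in>I. (max 0 (- evalp x (H j)))\<^sup>2)"
      by (simp add: sum_subtractf sum_distrib_left)
    finally have "evalp x p + \<epsilon> + real (2 * k) * G x - real (card I) / real (2 * k) \<le> evalp x F"
      by (simp add: F_def G_def algebra_simps power2_eq_square)
    moreover have "real (card I) / real (2 * k) \<le> \<epsilon> / 2"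
      using k \<epsilon> by (simp add: field_simps)
    moreover have "0 \<le> evalp x p + \<epsilon> / 2 + real (2 * k) * G x"
    proof (cases "x \<in> D")
      case True
      have "P \<le> real k * \<eta>" using k \<eta> by (simp add: field_simps)
      also have "\<dots> \<le> real (2 * k) * G x"
        using \<eta> \<eta>(2)[OF True] by (intro mult_mono) auto
      finally show ?thesis using P[OF x] \<epsilon> by linarith
    next
      case False
      then have "- \<epsilon> / 2 < evalp x p" using x by (simp add: D_def)
      moreover have "0 \<le> real (2 * k) * G x" using G_nonneg by simp
      ultimately show ?thesis by linarith
    qed
    ultimately show "0 \<le> evalp x F" by linarith
  qed
  moreover have "riesz z (S * S) = 0" unfolding S_def by (rule sphere)
  then have "riesz z F = riesz z p + \<epsilon> * z 0 - (\<Sum>j\<in>I. riesz z (H j * ((1 - H j) ^ k * (1 - H j) ^ k)))"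
    unfolding F_def riesz_add riesz_diff riesz_of_nat_mult riesz_sum riesz_single by (simp add: E)
  moreover have "0 \<le> (\<Sum>j\<in>I. riesz z (H j * ((1 - H j) ^ k * (1 - H j) ^ k)))"
    by (intro sum_nonneg I)
  ultimately show "0 \<le> riesz z p + e" using \<epsilon> by linarith
qed

text \<open>Dividing each inequality constraint by a positive bound for it on the cube achieves the
  normalization and preserves its sign.\<close>

lemma riesz_nonneg:
  fixes C :: "'i \<Rightarrow> 'n mpoly"
  assumes fin: "finite E" "finite I"
    and E: "\<And>i. i \<in> E \<Longrightarrow> riesz z (C i * C i) = 0"
    and I: "\<And>j q. j \<in> I \<Longrightarrow> 0 \<le> riesz z (C j * (q * q))"
    and p: "\<And>x. (\<And>i. i \<in> E \<Longrightarrow> evalp x (C i) = 0) \<Longrightarrow> (\<And>j. j \<in> I \<Longrightarrow> 0 \<le> evalp x (C j)) \<Longrightarrow>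
      x \<bullet> x = 1 \<Longrightarrow> 0 \<le> evalp x p"
  shows "0 \<le> riesz z p"
proof -
  have "\<exists>M. 0 < M \<and> (\<forall>x. (\<forall>i. \<bar>x $ i\<bar> \<le> 1) \<longrightarrow> \<bar>evalp x (C j)\<bar> \<le> M)" for j
    by (rule evalp_bounded_on_cube[of "C j"]) blast
  then obtain M where M: "\<And>j. 0 < M j" "\<And>j x. (\<And>i. \<bar>x $ i\<bar> \<le> 1) \<Longrightarrow> \<bar>evalp x (C j)\<bar> \<le> M j"
    by metis
  show ?thesis
  proof (rule riesz_nonneg_normalized[OF fin, of C "\<lambda>j. Const (1 / M j) * C j"])
    fix j q assume "j \<in> I"
    then show "0 \<le> riesz z (Const (1 / M j) * C j * (q * q))"
      unfolding mult.assoc[of "Const (1 / M j)"] riesz_Const_mult using I M(1)[of j] by (simp add: less_imp_le)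
  next
    fix j and x :: "real^'n" assume "\<And>i. \<bar>x $ i\<bar> \<le> 1"
    then show "\<bar>evalp x (Const (1 / M j) * C j)\<bar> \<le> 1"
      using M(2)[of x j] M(1)[of j] by (simp add: abs_mult)
  next
    fix x :: "real^'n"
    assume h: "\<And>i. i \<in> E \<Longrightarrow> evalp x (C i) = 0" "\<And>j. j \<in> I \<Longrightarrow> 0 \<le> evalp x (Const (1 / M j) * C j)" "x \<bullet> x = 1"
    have "0 \<le> evalp x (C j)" if "j \<in> I" for j
      using h(2)[OF that] M(1)[of j] by (simp add: zero_le_divide_iff)
    then show "0 \<le> evalp x p" using p h by blast
  qed (use E in auto)
qed

end

section \<open>Localizing matrices and Riesz functionals\<close>

abbreviation mpoly_of :: "(('n::finite \<Rightarrow> nat) \<Rightarrow> real) \<Rightarrow> 'n mpoly" where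
  "mpoly_of p \<equiv> Abs_poly_mapping p"

lemma lookup_mpoly_of: "is_poly p \<Longrightarrow> Poly_Mapping.lookup (mpoly_of p) = p"
  by (simp add: is_poly_def psupp_def)

lemma riesz_mpoly_of: "is_poly p \<Longrightarrow> riesz z (mpoly_of p) = pair p z"
  by (simp add: riesz_def lookup_mpoly_of)

lemma evalp_mpoly_of: "is_poly p \<Longrightarrow> evalp x (mpoly_of p) = peval p x"
  by (simp add: evalp_eq_peval lookup_mpoly_of)

lemma keys_mpoly_of: "is_poly p \<Longrightarrow> Poly_Mapping.keys (mpoly_of p) = psupp p"
  by (simp add: lookup_mpoly_of flip: psupp_lookup)

text \<open>A localizing matrix entry depends only on \<open>\<alpha> + \<beta>\<close>, so the
  column at index 0 is the moment sequence shifted by \<open>q\<close>, whose functional is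
  multiplication by \<open>q\<close>.\<close>

lemma riesz_mpoly_of_mult:
  assumes "is_poly q"
  shows "riesz z (mpoly_of q * f) = riesz (\<lambda>\<alpha>. loc_mat q z \<alpha> (\<lambda>_. 0)) f"
proof -
  have "riesz z (mpoly_of q * f) = (\<Sum>\<gamma>\<in>psupp q. \<Sum>\<alpha>\<in>Poly_Mapping.keys f. q \<gamma> * Poly_Mapping.lookup f \<alpha> * z (\<gamma> + \<alpha>))"
    using assms by (simp add: riesz_mult keys_mpoly_of lookup_mpoly_of)
  also have "\<dots> = (\<Sum>\<alpha>\<in>Poly_Mapping.keys f. \<Sum>\<gamma>\<in>psupp q. q \<gamma> * Poly_Mapping.lookup f \<alpha> * z (\<gamma> + \<alpha>))"
    by (rule sum.swap)
  also have "\<dots> = (\<Sum>\<alpha>\<in>Poly_Mapping.keys f. Poly_Mapping.lookup f \<alpha> * loc_mat q z \<alpha> (\<lambda>_. 0))"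
    unfolding loc_mat_def sum_distrib_left
    by (intro sum.cong) (simp_all add: plus_fun_def add.commute mult_ac)
  finally show ?thesis by (simp add: riesz_eq_sum[OF finite_keys order_refl])
qed

lemma loc_mat_add: "loc_mat q z (\<alpha> + \<beta>) (\<lambda>_. 0) = loc_mat q z \<alpha> \<beta>"
  by (simp add: loc_mat_def plus_fun_def)

lemma riesz_localizing_form:
  assumes "is_poly q" "finite B" "Poly_Mapping.keys f \<subseteq> B"
  shows "riesz z (mpoly_of q * (f * f)) =
    (\<Sum>\<alpha>\<in>B. \<Sum>\<beta>\<in>B. Poly_Mapping.lookup f \<alpha> * loc_mat q z \<alpha> \<beta> * Poly_Mapping.lookup f \<beta>)"
proof -
  have "riesz z (mpoly_of q * (f * f)) = (\<Sum>\<alpha>\<in>Poly_Mapping.keys f. \<Sum>\<beta>\<in>Poly_Mapping.keys f.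
      Poly_Mapping.lookup f \<alpha> * loc_mat q z \<alpha> \<beta> * Poly_Mapping.lookup f \<beta>)"
    by (subst riesz_mpoly_of_mult[OF assms(1)], subst riesz_mult) (simp add: loc_mat_add mult_ac)
  also have "\<dots> = (\<Sum>\<alpha>\<in>Poly_Mapping.keys f. \<Sum>\<beta>\<in>B. Poly_Mapping.lookup f \<alpha> * loc_mat q z \<alpha> \<beta> * Poly_Mapping.lookup f \<beta>)"
    using assms by (intro sum.cong sum.mono_neutral_left) (auto simp: in_keys_iff)
  also have "\<dots> = (\<Sum>\<alpha>\<in>B. \<Sum>\<beta>\<in>B. Poly_Mapping.lookup f \<alpha> * loc_mat q z \<alpha> \<beta> * Poly_Mapping.lookup f \<beta>)"
    using assms by (intro sum.mono_neutral_left) (auto simp: in_keys_iff)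
  finally show ?thesis .
qed

lemma riesz_psd:
  assumes "is_poly q" "psd_on B (loc_mat q z)" "finite B" "Poly_Mapping.keys f \<subseteq> B"
  shows "0 \<le> riesz z (mpoly_of q * (f * f))"
  using assms(2) unfolding riesz_localizing_form[OF assms(1,3,4)] psd_on_def by blast

lemma riesz_zero_on:
  assumes "is_poly q" "zero_on (loc_idx k q) (loc_mat q z)" "Poly_Mapping.keys f \<subseteq> loc_idx k q"
  shows "riesz z (mpoly_of q * f) = 0"
proof -
  have "loc_mat q z \<alpha> (\<lambda>_. 0) = 0" if "\<alpha> \<in> Poly_Mapping.keys f" for \<alpha>
  proof -
    have "\<alpha> \<in> loc_idx k q" using that assms by blast
    moreover from this have "(\<lambda>_. 0) \<in> loc_idx k q" by (simp add: loc_idx_def)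
    ultimately show ?thesis using assms(2) by (simp add: zero_on_def)
  qed
  then show ?thesis
    by (subst riesz_mpoly_of_mult[OF assms(1)]) (simp add: riesz_eq_sum[OF finite_keys order_refl])
qed

lemma finite_loc_idx: "finite (loc_idx k q)"
  unfolding loc_idx_def by (rule finite_subset[OF _ finite_mdeg_le[of k]]) auto

text \<open>Each fixed test polynomial is covered by the index sets of all large orders, which is
  what lets the relaxation conditions pass to the limit. The sum of all degrees serves as a crude
  bound for the largest.\<close>

lemma keys_subset_loc_idx: "\<exists>k0. \<forall>k\<ge>k0. Poly_Mapping.keys f \<subseteq> loc_idx k q"
proof (intro exI allI impI subsetI)
  fix k \<alpha>
  assume "(\<Sum>\<alpha>\<in>Poly_Mapping.keys f. mdeg \<alpha>) + (pdeg q + 1) div 2 \<le> k" "\<alpha> \<in> Poly_Mapping.keys f"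
  then show "\<alpha> \<in> loc_idx k q"
    using member_le_sum[of \<alpha> "Poly_Mapping.keys f" mdeg] by (simp add: loc_idx_def)
qed

lemma is_poly_one: "is_poly (one_poly :: ('n::finite \<Rightarrow> nat) \<Rightarrow> real)"
  by (rule is_poly_supported_deg[of 0]) (auto simp: supported_deg_def one_poly_def)

lemma mpoly_of_one: "mpoly_of one_poly = 1"
  by (rule poly_mapping_eqI)
    (simp add: lookup_mpoly_of[OF is_poly_one] lookup_one one_poly_def zero_fun_def when_def)

lemma pdeg_one: "pdeg (one_poly :: ('n::finite \<Rightarrow> nat) \<Rightarrow> real) = 0"
proof -
  have "psupp (one_poly :: ('n \<Rightarrow> nat) \<Rightarrow> real) = {\<lambda>_. 0}" by (auto simp: psupp_def one_poly_def)
  then show ?thesis by (simp add: pdeg_def)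
qed

lemma loc_idx_one: "loc_idx k one_poly = {\<alpha>. mdeg \<alpha> \<le> k}"
  by (simp add: loc_idx_def pdeg_one)

lemma mdeg_unit: "mdeg (\<lambda>j. if j = i then b else 0) = b"
  by (simp add: mdeg_def)

lemma supported_deg_sphere: "supported_deg 2 sphere_poly"
  by (auto simp: supported_deg_def sphere_poly_def mdeg_unit)

lemma is_poly_sphere: "is_poly (sphere_poly :: ('n::finite \<Rightarrow> nat) \<Rightarrow> real)"
  by (rule is_poly_supported_deg[OF supported_deg_sphere])

lemma pdeg_sphere: "pdeg (sphere_poly :: ('n::finite \<Rightarrow> nat) \<Rightarrow> real) = 2"
proof (rule antisym)
  show "pdeg (sphere_poly :: ('n \<Rightarrow> nat) \<Rightarrow> real) \<le> 2"
    unfolding pdeg_def using is_poly_sphere psupp_supported_deg[OF supported_deg_sphere]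
    by (intro Max.boundedI) (auto simp: is_poly_def)
  fix i :: 'n
  define \<alpha> where "\<alpha> = (\<lambda>j. if j = i then 2 else 0 :: nat)"
  have "\<alpha> i \<noteq> 0" by (simp add: \<alpha>_def)
  then have "\<alpha> \<in> psupp sphere_poly" by (auto simp: psupp_def sphere_poly_def \<alpha>_def)
  then have "mdeg \<alpha> \<le> pdeg (sphere_poly :: ('n \<Rightarrow> nat) \<Rightarrow> real)"
    unfolding pdeg_def using is_poly_sphere by (intro Max_ge) (auto simp: is_poly_def)
  then show "2 \<le> pdeg (sphere_poly :: ('n \<Rightarrow> nat) \<Rightarrow> real)" by (simp add: \<alpha>_def mdeg_unit)
qed

lemma mpoly_of_sphere: "mpoly_of sphere_poly = (\<Sum>i\<in>UNIV. Var i * Var i) - 1"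
proof (rule poly_mapping_eqI)
  fix \<alpha> :: "'a \<Rightarrow> nat"
  define e where "e = (\<lambda>(i::'a) j. if j = i then 2 else 0 :: nat)"
  have inj: "e i = e j \<longleftrightarrow> i = j" for i j :: 'a
    by (auto simp: e_def fun_eq_iff split: if_splits)
  have "Var i * Var i = Poly_Mapping.single (e i) 1" for i
    by (simp add: Var_def mult_single e_def plus_fun_def if_distrib numeral_2_eq_2 cong: if_cong)
  then have "Poly_Mapping.lookup ((\<Sum>i\<in>UNIV. Var i * Var i) - 1) \<alpha>
    = (\<Sum>i\<in>UNIV. if e i = \<alpha> then 1 else 0) - (if \<alpha> = (\<lambda>_. 0) then 1 else 0)"
    by (simp add: lookup_minus lookup_sum lookup_single lookup_one when_def zero_fun_def)
  also have "\<dots> = (if \<alpha> = (\<lambda>_. 0) then - 1 else if \<exists>i. \<alpha> = e i then 1 else 0)"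
  proof (cases "\<exists>i. \<alpha> = e i")
    case True
    then obtain i where i: "\<alpha> = e i" by blast
    have "e i \<noteq> (\<lambda>_. 0)" by (metis e_def zero_neq_numeral)
    then show ?thesis by (auto simp: i inj)
  next
    case False
    then have "\<And>i. e i \<noteq> \<alpha>" by auto
    then show ?thesis using False by simp
  qed
  also have "\<dots> = sphere_poly \<alpha>" by (simp add: sphere_poly_def e_def)
  finally show "Poly_Mapping.lookup (mpoly_of sphere_poly) \<alpha> = Poly_Mapping.lookup ((\<Sum>i\<in>UNIV. Var i * Var i) - 1) \<alpha>"
    by (simp add: lookup_mpoly_of[OF is_poly_sphere])
qed

lemma mpoly_of_pmult:
  assumes "is_poly q" "is_poly r"
  shows "pmult q r = Poly_Mapping.lookup (mpoly_of q * mpoly_of r)"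
proof
  fix \<gamma> :: "'a \<Rightarrow> nat"
  \<comment> \<open>Taking the coefficient at \<open>\<gamma>\<close> is the Riesz functional of
    this indicator sequence, so the product formula for functionals applies.\<close>
  define \<delta> where "\<delta> = (\<lambda>\<alpha>. if \<alpha> = \<gamma> then 1 else 0 :: real)"
  have coeff: "Poly_Mapping.lookup f \<gamma> = riesz \<delta> f" for f
    unfolding riesz_eq_sum[OF finite_keys order_refl] \<delta>_def by (simp add: in_keys_iff if_distrib cong: if_cong)
  have fin: "finite {\<alpha>. \<alpha> \<le> \<gamma>}"
    by (rule finite_subset[OF _ finite_mdeg_le[of "mdeg \<gamma>"]]) (auto simp: mdeg_def le_fun_def intro!: sum_mono)
  have inner: "(\<Sum>\<beta>\<in>psupp r. q \<alpha> * r \<beta> * \<delta> (\<alpha> + \<beta>)) = (if \<alpha> \<le> \<gamma> then q \<alpha> * r (\<lambda>i. \<gamma> i - \<alpha> i) else 0)" for \<alpha>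
  proof (cases "\<alpha> \<le> \<gamma>")
    case True
    then have "\<alpha> + \<beta> = \<gamma> \<longleftrightarrow> \<beta> = (\<lambda>i. \<gamma> i - \<alpha> i)" for \<beta>
      by (auto simp: fun_eq_iff le_fun_def) (metis add_diff_cancel_left')
    then have "(\<Sum>\<beta>\<in>psupp r. q \<alpha> * r \<beta> * \<delta> (\<alpha> + \<beta>))
        = (\<Sum>\<beta>\<in>psupp r. if \<beta> = (\<lambda>i. \<gamma> i - \<alpha> i) then q \<alpha> * r \<beta> else 0)"
      by (intro sum.cong) (auto simp: \<delta>_def)
    then show ?thesis using True assms by (simp add: is_poly_def) (simp add: psupp_def)
  next
    case False
    then have "\<alpha> + \<beta> \<noteq> \<gamma>" for \<beta> by (auto simp: le_fun_def)
    then show ?thesis using False by (simp add: \<delta>_def)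
  qed
  have "Poly_Mapping.lookup (mpoly_of q * mpoly_of r) \<gamma>
      = (\<Sum>\<alpha>\<in>psupp q. if \<alpha> \<le> \<gamma> then q \<alpha> * r (\<lambda>i. \<gamma> i - \<alpha> i) else 0)"
    unfolding coeff riesz_mult keys_mpoly_of[OF assms(1)] keys_mpoly_of[OF assms(2)]
      lookup_mpoly_of[OF assms(1)] lookup_mpoly_of[OF assms(2)] inner ..
  also have "\<dots> = (\<Sum>\<alpha>\<in>psupp q \<inter> {\<alpha>. \<alpha> \<le> \<gamma>}. q \<alpha> * r (\<lambda>i. \<gamma> i - \<alpha> i))"
    using assms by (simp add: sum.inter_restrict is_poly_def)
  also have "\<dots> = pmult q r \<gamma>"
    unfolding pmult_def using fin by (intro sum.mono_neutral_left) (auto simp: psupp_def)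
  finally show "pmult q r \<gamma> = Poly_Mapping.lookup (mpoly_of q * mpoly_of r) \<gamma>" by simp
qed

section \<open>Sums of squares of bounded degree and control of the mass\<close>

lemma psd_on_subset:
  assumes "psd_on B M" "A \<subseteq> B" "finite B"
  shows "psd_on A M"
  unfolding psd_on_def
proof
  fix v :: "'a \<Rightarrow> real"
  define v' where "v' = (\<lambda>\<alpha>. if \<alpha> \<in> A then v \<alpha> else 0)"
  have "0 \<le> (\<Sum>\<alpha>\<in>B. \<Sum>\<beta>\<in>B. v' \<alpha> * M \<alpha> \<beta> * v' \<beta>)" using assms by (simp add: psd_on_def)
  also have "\<dots> = (\<Sum>\<alpha>\<in>A. \<Sum>\<beta>\<in>B. v' \<alpha> * M \<alpha> \<beta> * v' \<beta>)"
    using assms by (intro sum.mono_neutral_right) (auto simp: v'_def)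
  also have "\<dots> = (\<Sum>\<alpha>\<in>A. \<Sum>\<beta>\<in>A. v' \<alpha> * M \<alpha> \<beta> * v' \<beta>)"
    using assms by (intro sum.cong sum.mono_neutral_right) (auto simp: v'_def)
  also have "\<dots> = (\<Sum>\<alpha>\<in>A. \<Sum>\<beta>\<in>A. v \<alpha> * M \<alpha> \<beta> * v \<beta>)"
    by (intro sum.cong) (auto simp: v'_def)
  finally show "0 \<le> (\<Sum>\<alpha>\<in>A. \<Sum>\<beta>\<in>A. v \<alpha> * M \<alpha> \<beta> * v \<beta>)" .
qed

lemma pdeg_le_supported: "is_poly q \<Longrightarrow> pdeg q \<le> e \<Longrightarrow> supported_deg e q"
  using supported_deg_pdeg supported_deg_mono by blast

lemma supported_deg_pmult:
  assumes "is_poly q" "pdeg q \<le> e"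
  shows "supported_deg (2 * e) (pmult q q)"
  unfolding supported_deg_def
proof (intro allI impI, rule ccontr)
  fix \<gamma> assume \<gamma>: "2 * e < mdeg \<gamma>" "pmult q q \<gamma> \<noteq> 0"
  then have "\<gamma> \<in> Poly_Mapping.keys (mpoly_of q * mpoly_of q)"
    using mpoly_of_pmult[OF assms(1) assms(1)] by (simp add: in_keys_iff)
  then obtain \<alpha> \<beta> where ab: "\<alpha> \<in> psupp q" "\<beta> \<in> psupp q" "\<gamma> = \<alpha> + \<beta>"
    using keys_mult[of "mpoly_of q" "mpoly_of q"] by (auto simp: keys_mpoly_of[OF assms(1)])
  then have "mdeg \<alpha> \<le> e" "mdeg \<beta> \<le> e"
    using psupp_supported_deg[OF pdeg_le_supported[OF assms]] by auto
  then show False using \<gamma>(1) mdeg_add[of \<alpha> \<beta>] by (simp add: ab plus_fun_def)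
qed

lemma sos_cone_supported:
  assumes "p \<in> sos_cone e"
  shows "supported_deg (2 * e) p"
proof -
  obtain qs where qs: "\<forall>q\<in>set qs. is_poly q \<and> pdeg q \<le> e" "p = (\<lambda>\<gamma>. \<Sum>q\<leftarrow>qs. pmult q q \<gamma>)"
    using assms by (auto simp: sos_cone_def)
  have "(\<Sum>q\<leftarrow>qs. pmult q q \<gamma>) = 0" if "2 * e < mdeg \<gamma>" for \<gamma>
  proof -
    have "\<forall>q\<in>set qs. pmult q q \<gamma> = 0"
      using qs(1) that supported_deg_pmult unfolding supported_deg_def by blast
    then show ?thesis by (induction qs) auto
  qed
  then show ?thesis by (simp add: supported_deg_def qs(2))
qed

lemma sos_cone_pair_nonneg:
  fixes z :: "('n::finite \<Rightarrow> nat) \<Rightarrow> real"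
  assumes "p \<in> sos_cone e" and psd: "psd_on {\<alpha>. mdeg \<alpha> \<le> e} (loc_mat one_poly z)"
  shows "0 \<le> pair p z"
proof -
  obtain qs where qs: "\<forall>q\<in>set qs. is_poly q \<and> pdeg q \<le> e" "p = (\<lambda>\<gamma>. \<Sum>q\<leftarrow>qs. pmult q q \<gamma>)"
    using assms by (auto simp: sos_cone_def)
  have "p = Poly_Mapping.lookup (\<Sum>q\<leftarrow>qs. mpoly_of q * mpoly_of q)"
    unfolding qs(2) using qs(1)
    by (induction qs) (auto simp: fun_eq_iff lookup_add mpoly_of_pmult)
  then have "pair p z = riesz z (\<Sum>q\<leftarrow>qs. mpoly_of q * mpoly_of q)" by (simp add: riesz_def)
  also have "0 \<le> \<dots>"
    using qs(1)
  proof (induction qs)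
    case (Cons q qs)
    have "Poly_Mapping.keys (mpoly_of q) \<subseteq> {\<alpha>. mdeg \<alpha> \<le> e}"
      using Cons.prems psupp_supported_deg[OF pdeg_le_supported[of q e]] by (simp add: keys_mpoly_of)
    then have "0 \<le> riesz z (mpoly_of one_poly * (mpoly_of q * mpoly_of q))"
      by (rule riesz_psd[OF is_poly_one psd finite_mdeg_le])
    then show ?case using Cons by (simp add: mpoly_of_one riesz_add)
  qed simp
  finally show ?thesis .
qed

text \<open>An interior \<open>R\<close> remains a sum of squares after subtracting a small constant
  \<open>\<delta>\<close>, and sums of squares pair nonnegatively with a vector whose moment matrix
  is positive semidefinite.\<close>

lemma sos_interior_coercive:
  fixes R :: "('n::finite \<Rightarrow> nat) \<Rightarrow> real"
  assumes "R \<in> sos_interior e"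
  obtains \<delta> where "0 < \<delta>"
    "\<And>z. psd_on {\<alpha>. mdeg \<alpha> \<le> e} (loc_mat one_poly z) \<Longrightarrow> \<delta> * z (\<lambda>_. 0) \<le> pair R z"
proof -
  obtain \<epsilon> where \<epsilon>: "0 < \<epsilon>" "\<And>p. supported_deg (2 * e) p \<Longrightarrow>
      (\<Sum>\<alpha>\<in>{\<alpha>. mdeg \<alpha> \<le> 2 * e}. (p \<alpha> - R \<alpha>)\<^sup>2) < \<epsilon> \<Longrightarrow> p \<in> sos_cone e"
    and R: "R \<in> sos_cone e" using assms by (auto simp: sos_interior_def)
  \<comment> \<open>Only the constant coefficient changes, so the squared distance to
    \<open>R\<close> is \<open>\<delta>\<^sup>2 = \<epsilon> / 2\<close>, inside the ball.\<close>
  define \<delta> where "\<delta> = sqrt (\<epsilon> / 2)"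
  have \<delta>: "0 < \<delta>" "\<delta>\<^sup>2 < \<epsilon>" using \<epsilon>(1) by (auto simp: \<delta>_def)
  define p where "p = (\<lambda>\<alpha>. R \<alpha> - \<delta> * one_poly \<alpha>)"
  have sR: "supported_deg (2 * e) R" by (rule sos_cone_supported[OF R])
  then have sp: "supported_deg (2 * e) p"
    by (auto simp: p_def supported_deg_def one_poly_def)
  have "(\<Sum>\<alpha>\<in>{\<alpha>. mdeg \<alpha> \<le> 2 * e}. (p \<alpha> - R \<alpha>)\<^sup>2)
      = (\<Sum>\<alpha>\<in>{\<alpha> :: 'n \<Rightarrow> nat. mdeg \<alpha> \<le> 2 * e}. if \<alpha> = (\<lambda>_. 0) then \<delta>\<^sup>2 else 0)"
    by (intro sum.cong) (auto simp: p_def one_poly_def)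
  also have "\<dots> = \<delta>\<^sup>2" by (simp add: finite_mdeg_le)
  finally have p: "p \<in> sos_cone e" using \<epsilon>(2)[OF sp] \<delta> by simp
  show ?thesis
  proof (rule that[OF \<delta>(1)])
    fix z :: "('n \<Rightarrow> nat) \<Rightarrow> real" assume "psd_on {\<alpha>. mdeg \<alpha> \<le> e} (loc_mat one_poly z)"
    then have "0 \<le> pair p z" by (rule sos_cone_pair_nonneg[OF p])
    also have "pair p z = pair R z - (\<Sum>\<alpha>\<in>{\<alpha>. mdeg \<alpha> \<le> 2 * e}. if \<alpha> = (\<lambda>_. 0) then \<delta> * z \<alpha> else 0)"
      unfolding pair_eq_sum[OF sp] pair_eq_sum[OF sR] sum_subtractf[symmetric]
      by (intro sum.cong) (auto simp: p_def one_poly_def algebra_simps)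
    also have "\<dots> = pair R z - \<delta> * z (\<lambda>_. 0)" by (simp add: finite_mdeg_le)
    finally show "\<delta> * z (\<lambda>_. 0) \<le> pair R z" by simp
  qed
qed

section \<open>Localizing matrices of atomic vectors\<close>

lemma loc_mat_atoms:
  assumes "is_poly q" "\<alpha> \<in> loc_idx k q" "\<beta> \<in> loc_idx k q"
  shows "loc_mat q (\<lambda>\<gamma>. \<Sum>u\<in>U. lam u * mvec (2 * k) u \<gamma>) \<alpha> \<beta>
    = (\<Sum>u\<in>U. lam u * peval q u * (monom_eval \<alpha> u * monom_eval \<beta> u))"
proof -
  \<comment> \<open>Twice the rounded-up half of the degree of \<open>q\<close> is at least that
    degree, so no entry reaches the exponents truncated to zero in \<open>mvec\<close>.\<close>
  have deg: "mdeg (\<lambda>i. \<alpha> i + \<beta> i + \<gamma> i) \<le> 2 * k" if "\<gamma> \<in> psupp q" for \<gamma>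
  proof -
    have "mdeg \<gamma> \<le> pdeg q"
      using psupp_supported_deg[OF supported_deg_pdeg[OF assms(1)]] that by blast
    then show ?thesis using assms(2,3) by (simp add: loc_idx_def mdeg_add)
  qed
  have "loc_mat q (\<lambda>\<gamma>. \<Sum>u\<in>U. lam u * mvec (2 * k) u \<gamma>) \<alpha> \<beta>
    = (\<Sum>\<gamma>\<in>psupp q. \<Sum>u\<in>U. q \<gamma> * (lam u * (monom_eval \<alpha> u * monom_eval \<beta> u * monom_eval \<gamma> u)))"
    unfolding loc_mat_def sum_distrib_left
    by (intro sum.cong refl) (simp add: mvec_def deg monom_eval_add)
  also have "\<dots> = (\<Sum>u\<in>U. \<Sum>\<gamma>\<in>psupp q. q \<gamma> * (lam u * (monom_eval \<alpha> u * monom_eval \<beta> u * monom_eval \<gamma> u)))"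
    by (rule sum.swap)
  also have "\<dots> = (\<Sum>u\<in>U. lam u * peval q u * (monom_eval \<alpha> u * monom_eval \<beta> u))"
    unfolding peval_def sum_distrib_left sum_distrib_right by (intro sum.cong refl) (simp add: mult_ac)
  finally show ?thesis .
qed

text \<open>Each atom contributes a rank-one matrix with the nonnegative factor
  \<open>lam u * peval q u\<close>.\<close>

lemma psd_on_loc_mat_atoms:
  assumes "is_poly q" "\<And>u. u \<in> U \<Longrightarrow> 0 \<le> lam u" "\<And>u. u \<in> U \<Longrightarrow> 0 \<le> peval q u"
  shows "psd_on (loc_idx k q) (loc_mat q (\<lambda>\<gamma>. \<Sum>u\<in>U. lam u * mvec (2 * k) u \<gamma>))"
  unfolding psd_on_def
proof
  fix v
  let ?B = "loc_idx k q"
  have "(\<Sum>\<alpha>\<in>?B. \<Sum>\<beta>\<in>?B. v \<alpha> * loc_mat q (\<lambda>\<gamma>. \<Sum>u\<in>U. lam u * mvec (2 * k) u \<gamma>) \<alpha> \<beta> * v \<beta>)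
    = (\<Sum>\<alpha>\<in>?B. \<Sum>\<beta>\<in>?B. \<Sum>u\<in>U. lam u * peval q u * ((v \<alpha> * monom_eval \<alpha> u) * (v \<beta> * monom_eval \<beta> u)))"
    by (intro sum.cong refl, subst loc_mat_atoms[OF assms(1)])
      (simp_all add: sum_distrib_left sum_distrib_right mult_ac)
  also have "\<dots> = (\<Sum>\<alpha>\<in>?B. \<Sum>u\<in>U. \<Sum>\<beta>\<in>?B. lam u * peval q u * ((v \<alpha> * monom_eval \<alpha> u) * (v \<beta> * monom_eval \<beta> u)))"
    by (intro sum.cong refl sum.swap)
  also have "\<dots> = (\<Sum>u\<in>U. \<Sum>\<alpha>\<in>?B. \<Sum>\<beta>\<in>?B. lam u * peval q u * ((v \<alpha> * monom_eval \<alpha> u) * (v \<beta> * monom_eval \<beta> u)))"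
    by (rule sum.swap)
  also have "\<dots> = (\<Sum>u\<in>U. lam u * peval q u * (\<Sum>\<alpha>\<in>?B. v \<alpha> * monom_eval \<alpha> u)\<^sup>2)"
    by (intro sum.cong refl) (simp only: power2_eq_square sum_product, simp only: sum_distrib_left)
  also have "0 \<le> \<dots>" using assms by (intro sum_nonneg mult_nonneg_nonneg) auto
  finally show "0 \<le> (\<Sum>\<alpha>\<in>?B. \<Sum>\<beta>\<in>?B. v \<alpha> * loc_mat q (\<lambda>\<gamma>. \<Sum>u\<in>U. lam u * mvec (2 * k) u \<gamma>) \<alpha> \<beta> * v \<beta>)" .
qed

lemma zero_on_loc_mat_atoms:
  assumes "is_poly q" "\<And>u. u \<in> U \<Longrightarrow> peval q u = 0"
  shows "zero_on (loc_idx k q) (loc_mat q (\<lambda>\<gamma>. \<Sum>u\<in>U. lam u * mvec (2 * k) u \<gamma>))"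
  using assms by (auto simp: zero_on_def loc_mat_atoms)

lemma peval_one: "peval one_poly u = 1"
  using evalp_mpoly_of[OF is_poly_one, of u] by (simp add: mpoly_of_one)

lemma peval_sphere: "peval sphere_poly u = u \<bullet> u - 1"
  using evalp_mpoly_of[OF is_poly_sphere, of u] by (simp add: mpoly_of_sphere inner_vec_def)

section \<open>Bounds on pseudo-moments\<close>

lemma mdeg_fun_upd_Suc: "mdeg (\<beta>(i := Suc (\<beta> i))) = Suc (mdeg \<beta>)"
  unfolding mdeg_def by (simp add: sum.remove[of UNIV i])

lemma split_exponent:
  assumes "t \<le> mdeg \<alpha>"
  shows "\<exists>\<beta>\<le>\<alpha>. mdeg \<beta> = t"
  using assms
proof (induction t)
  case 0
  show ?case by (intro exI[of _ "\<lambda>_. 0"]) (auto simp: le_fun_def)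
next
  case (Suc t)
  then obtain \<beta> where \<beta>: "\<beta> \<le> \<alpha>" "mdeg \<beta> = t" by auto
  have "\<exists>i. \<beta> i < \<alpha> i"
  proof (rule ccontr)
    assume "\<not> (\<exists>i. \<beta> i < \<alpha> i)"
    then have "mdeg \<alpha> \<le> mdeg \<beta>" unfolding mdeg_def by (intro sum_mono) (simp add: not_less)
    then show False using Suc.prems \<beta> by simp
  qed
  then obtain i where "\<beta> i < \<alpha> i" by blast
  then have "\<beta>(i := Suc (\<beta> i)) \<le> \<alpha>" using \<beta> by (auto simp: le_fun_def)
  then show ?case using \<beta>(2) mdeg_fun_upd_Suc by metis
qed

text \<open>By the sphere condition, the even moments one step above
  \<open>\<gamma> + \<gamma>\<close> add up to the moment there. They are nonnegative, so none
  exceeds it and all are at most the mass. Positivity on squares of binomials then bounds the mixed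
  moments.\<close>

lemma pseudo_moment_bound:
  fixes z :: "('n::finite \<Rightarrow> nat) \<Rightarrow> real"
  assumes supp: "supported_deg (2 * k) z"
    and sph: "zero_on (loc_idx k sphere_poly) (loc_mat sphere_poly z)"
    and psd: "psd_on (loc_idx k one_poly) (loc_mat one_poly z)"
  shows "\<bar>z \<alpha>\<bar> \<le> z (\<lambda>_. 0)"
proof -
  have sq: "0 \<le> riesz z (f * f)" if "Poly_Mapping.keys f \<subseteq> {\<alpha>. mdeg \<alpha> \<le> k}" for f
    using riesz_psd[OF is_poly_one psd finite_loc_idx, of f] that by (simp add: loc_idx_one mpoly_of_one)
  have even: "0 \<le> z (\<beta> + \<beta>)" if "mdeg \<beta> \<le> k" for \<beta>
    using sq[of "Poly_Mapping.single \<beta> 1"] that by (simp add: mult_single riesz_single)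
  have diag: "z (\<beta> + \<beta>) \<le> z 0" if "mdeg \<beta> \<le> k" for \<beta>
    using that
  proof (induction "mdeg \<beta>" arbitrary: \<beta>)
    case 0
    then have "\<beta> = 0" by (auto simp: mdeg_def)
    then show ?case by (simp only: add_0_left)
  next
    case (Suc t)
    obtain \<gamma> where \<gamma>: "\<gamma> \<le> \<beta>" "mdeg \<gamma> = t" using split_exponent[of t \<beta>] Suc(2) by auto
    define e where "e = (\<lambda>i. \<beta> i - \<gamma> i)"
    have \<beta>: "\<beta> = \<gamma> + e" using \<gamma> by (auto simp: e_def le_fun_def)
    have "mdeg e = 1" using \<gamma> Suc(2) mdeg_add[of \<gamma> e] by (simp add: \<beta> plus_fun_def)
    then obtain i where i: "e i \<noteq> 0" by (metis (no_types, lifting) mdeg_def one_neq_zero sum.neutral)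
    have unit: "e = (\<lambda>j. if j = i then 1 else 0)"
    proof -
      have "e i + (\<Sum>j\<in>UNIV - {i}. e j) = 1"
        using \<open>mdeg e = 1\<close> unfolding mdeg_def by (simp add: sum.remove[of UNIV i])
      then have "e i = 1" "(\<Sum>j\<in>UNIV - {i}. e j) = 0" using i by linarith+
      then show ?thesis by (auto simp: fun_eq_iff)
    qed
    have shift: "riesz z (Var j * Var j * Poly_Mapping.single (\<gamma> + \<gamma>) 1)
        = z ((\<gamma> + (\<lambda>l. if l = j then 1 else 0)) + (\<gamma> + (\<lambda>l. if l = j then 1 else 0)))" for j
      by (simp add: Var_def mult_single riesz_single add_ac)
    have nn: "0 \<le> riesz z (Var j * Var j * Poly_Mapping.single (\<gamma> + \<gamma>) 1)" for j
      unfolding shift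
    proof (rule even)
      show "mdeg (\<gamma> + (\<lambda>l. if l = j then 1 else 0)) \<le> k"
        using Suc(2,3) \<gamma> mdeg_add[of \<gamma> "\<lambda>l. if l = j then 1 else 0"] mdeg_unit[of j 1]
        by (simp add: plus_fun_def)
    qed
    have loc: "(\<Sum>j\<in>UNIV. riesz z (Var j * Var j * Poly_Mapping.single (\<gamma> + \<gamma>) 1)) = z (\<gamma> + \<gamma>)"
    proof -
      have "loc_mat sphere_poly z \<gamma> \<gamma> = 0"
        using sph \<gamma> Suc(2,3) by (simp add: zero_on_def loc_idx_def pdeg_sphere)
      moreover have "riesz z (mpoly_of sphere_poly * Poly_Mapping.single (\<gamma> + \<gamma>) 1) = loc_mat sphere_poly z \<gamma> \<gamma>"
        by (simp add: riesz_mpoly_of_mult[OF is_poly_sphere] riesz_single loc_mat_add)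
      ultimately show ?thesis
        by (simp add: mpoly_of_sphere left_diff_distrib riesz_diff sum_distrib_right riesz_sum riesz_single)
    qed
    have "z (\<beta> + \<beta>) = riesz z (Var i * Var i * Poly_Mapping.single (\<gamma> + \<gamma>) 1)"
      unfolding shift \<beta> unit ..
    also have "\<dots> \<le> z (\<gamma> + \<gamma>)"
      unfolding loc[symmetric] using nn by (intro member_le_sum) auto
    also have "\<dots> \<le> z 0" using Suc(1)[of \<gamma>] \<gamma> Suc(2,3) by simp
    finally show ?case .
  qed
  have off: "\<bar>z (\<beta> + \<gamma>)\<bar> \<le> z 0" if b: "mdeg \<beta> \<le> k" and c: "mdeg \<gamma> \<le> k" for \<beta> \<gamma>
  proof -
    have "0 \<le> z (\<beta> + \<beta>) + 2 * s * z (\<beta> + \<gamma>) + s\<^sup>2 * z (\<gamma> + \<gamma>)" for s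
    proof -
      let ?f = "Poly_Mapping.single \<beta> 1 + Poly_Mapping.single \<gamma> s"
      have "Poly_Mapping.keys ?f \<subseteq> {\<alpha>. mdeg \<alpha> \<le> k}"
        using b c by (intro order_trans[OF Poly_Mapping.keys_add]) auto
      moreover have "riesz z (?f * ?f) = z (\<beta> + \<beta>) + 2 * s * z (\<beta> + \<gamma>) + s\<^sup>2 * z (\<gamma> + \<gamma>)"
        by (simp only: distrib_left distrib_right riesz_add mult_single riesz_single)
          (simp add: power2_eq_square add.commute[of \<gamma> \<beta>])
      ultimately show ?thesis using sq[of ?f] by simp
    qed
    \<comment> \<open>The values 1 and -1 of \<open>s\<close> give twice
      \<open>\<bar>z (\<beta> + \<gamma>)\<bar>\<close> at most the sum of the two even
      moments.\<close>
    from this[of 1] this[of "-1"] diag[OF b] diag[OF c] show ?thesis by simp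
  qed
  have z0: "0 \<le> z 0" using off[of 0 0] by (simp add: zero_fun_def)
  have "\<bar>z \<alpha>\<bar> \<le> z 0"
  proof (cases "mdeg \<alpha> \<le> 2 * k")
    case True
    \<comment> \<open>Taking degree \<open>min k (mdeg \<alpha>)\<close> for the first part leaves
      at most \<open>k\<close> for the second.\<close>
    obtain \<beta> where \<beta>: "\<beta> \<le> \<alpha>" "mdeg \<beta> = min k (mdeg \<alpha>)" using split_exponent[of "min k (mdeg \<alpha>)" \<alpha>] by auto
    define \<gamma> where "\<gamma> = (\<lambda>i. \<alpha> i - \<beta> i)"
    have \<alpha>: "\<alpha> = \<beta> + \<gamma>" using \<beta> by (auto simp: \<gamma>_def le_fun_def)
    have "mdeg \<alpha> = mdeg \<beta> + mdeg \<gamma>" using mdeg_add[of \<beta> \<gamma>] by (simp add: \<alpha> plus_fun_def)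
    then have "mdeg \<gamma> \<le> k" "mdeg \<beta> \<le> k" using \<beta>(2) True by linarith+
    then show ?thesis using off[of \<beta> \<gamma>] by (simp add: \<alpha>)
  next
    case False
    then show ?thesis using supp z0 by (simp add: supported_deg_def)
  qed
  then show ?thesis by (simp add: zero_fun_def)
qed

section \<open>Minimizers over the moment cone\<close>

lemma compact_Kcirc: "compact (Kcirc E I c)"
proof -
  have "Kcirc E I c = sphere 0 1 \<inter> ((\<Inter>i\<in>E. {u. peval (phom (c i)) u = 0}) \<inter>
      (\<Inter>j\<in>I. {u. 0 \<le> peval (phom (c j)) u}))"
    by (auto simp: Kcirc_def norm_eq_1)
  then show ?thesis
    by (simp only:) (intro compact_Int_closed closed_Int closed_INT ballI closed_Collect_eq
        closed_Collect_le continuous_on_peval continuous_on_const compact_sphere)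
qed

lemma is_poly_phom: "is_poly p \<Longrightarrow> is_poly (phom p)"
  unfolding is_poly_def by (rule finite_subset[rotated]) (auto simp: psupp_def phom_def)

lemma small_perturbation_nonneg:
  fixes lam c :: "'u \<Rightarrow> real"
  assumes "finite U" "\<And>u. u \<in> U \<Longrightarrow> 0 < lam u"
  shows "\<exists>h>0. \<forall>u\<in>U. h * \<bar>c u\<bar> \<le> lam u"
  using assms
proof (induction U rule: finite_induct)
  case empty
  show ?case by (intro exI[of _ 1]) auto
next
  case (insert w U)
  then obtain h where h: "0 < h" "\<And>u. u \<in> U \<Longrightarrow> h * \<bar>c u\<bar> \<le> lam u" by auto
  \<comment> \<open>The added 1 avoids division by zero when \<open>c w = 0\<close>.\<close>
  define h' where "h' = min h (lam w / (\<bar>c w\<bar> + 1))"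
  have "0 < lam w" using insert by simp
  then have h': "0 < h'" using h by (simp add: h'_def)
  have "h' * \<bar>c u\<bar> \<le> lam u" if "u \<in> insert w U" for u
  proof (cases "u = w")
    case True
    have "h' * \<bar>c w\<bar> \<le> h' * (\<bar>c w\<bar> + 1)" using h' by (intro mult_left_mono) auto
    also have "\<dots> \<le> lam w / (\<bar>c w\<bar> + 1) * (\<bar>c w\<bar> + 1)" by (intro mult_right_mono) (auto simp: h'_def)
    also have "\<dots> = lam w" by (simp add: add_nonneg_eq_0_iff)
    finally show ?thesis using True by simp
  next
    case False
    have "h' * \<bar>c u\<bar> \<le> h * \<bar>c u\<bar>" by (intro mult_right_mono) (auto simp: h'_def)
    then show ?thesis using h(2)[of u] that False by auto
  qed
  with h' show ?case by blast
qed

text \<open>With more atoms than constraints there is a direction, supported on the atoms, along which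
  all constraints are constant.  Moving both ways keeps feasibility, so uniqueness makes this
  direction a linear relation between the atoms.\<close>

lemma unique_minimizer_few_atoms:
  fixes R :: "('n::finite \<Rightarrow> nat) \<Rightarrow> real"
  assumes F: "F = {z \<in> atom_cone t T. \<forall>i<m. a i - pair (g i) z \<ge> 0}"
    and zs: "is_minimizer R F zs" and unique: "\<And>w. is_minimizer R F w \<Longrightarrow> w = zs"
  shows "\<exists>U lam. finite U \<and> U \<subseteq> T \<and> card U \<le> m \<and> (\<forall>u\<in>U. lam u > 0) \<and>
    zs = (\<lambda>\<alpha>. \<Sum>u\<in>U. lam u * mvec t u \<alpha>)"
proof -
  have zsF: "zs \<in> F" and min: "\<And>w. w \<in> F \<Longrightarrow> pair R zs \<le> pair R w"
    using zs by (auto simp: is_minimizer_def)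
  have "zs \<in> atom_cone t T" using zsF F by simp
  then obtain U lam where U: "finite U" "U \<subseteq> T" "\<And>u. u \<in> U \<Longrightarrow> 0 < lam u"
    and zs_eq: "zs = (\<lambda>\<alpha>. \<Sum>u\<in>U. lam u * mvec t u \<alpha>)"
    and indep: "\<And>c. (\<And>\<alpha>. (\<Sum>u\<in>U. c u * mvec t u \<alpha>) = 0) \<Longrightarrow> \<forall>u\<in>U. c u = 0"
    by (rule atom_cone_minimal_representation) blast
  have "card U \<le> m"
  proof (rule ccontr)
    assume "\<not> card U \<le> m"
    then obtain c where c: "\<exists>u\<in>U. c u \<noteq> 0"
      "\<And>i. i < m \<Longrightarrow> (\<Sum>u\<in>U. c u * pair (g i) (mvec t u)) = 0"
      using underdetermined_system[of "{..<m}" U "\<lambda>i u. pair (g i) (mvec t u)"] U(1) by auto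
    define v where "v = (\<lambda>\<alpha>. \<Sum>u\<in>U. c u * mvec t u \<alpha>)"
    obtain h where h: "0 < h" "\<And>u. u \<in> U \<Longrightarrow> h * \<bar>c u\<bar> \<le> lam u"
      using small_perturbation_nonneg[of U lam c] U by auto
    have gv: "pair (g i) v = 0" if "i < m" for i
      using c(2)[OF that] by (simp add: v_def pair_sum pair_cmult)
    have feas: "(\<lambda>\<alpha>. zs \<alpha> + s * v \<alpha>) \<in> F" if "\<bar>s\<bar> \<le> h" for s
    proof -
      have "(\<lambda>\<alpha>. zs \<alpha> + s * v \<alpha>) = (\<lambda>\<alpha>. \<Sum>u\<in>U. (lam u + s * c u) * mvec t u \<alpha>)"
        by (simp add: zs_eq v_def sum.distrib sum_distrib_left algebra_simps)
      moreover have "0 \<le> lam u + s * c u" if "u \<in> U" for u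
      proof -
        have "\<bar>s * c u\<bar> \<le> h * \<bar>c u\<bar>" using \<open>\<bar>s\<bar> \<le> h\<close> by (simp add: abs_mult mult_right_mono)
        then show ?thesis using h(2)[OF that] by linarith
      qed
      ultimately have "(\<lambda>\<alpha>. zs \<alpha> + s * v \<alpha>) \<in> atom_cone t T"
        using atom_cone_nonneg_weights[OF U(1,2), of "\<lambda>u. lam u + s * c u" t] by simp
      then show ?thesis using zsF by (simp add: F pair_add pair_cmult gv)
    qed
    have "pair R zs \<le> pair R zs + s * pair R v" if "\<bar>s\<bar> \<le> h" for s
      using min[OF feas[OF that]] by (simp add: pair_add pair_cmult)
    \<comment> \<open>Both signs of the step are feasible, so the objective must be constant along
      \<open>v\<close>.\<close>
    from this[of h] this[of "- h"] have Rv: "pair R v = 0"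
      using h(1) by (simp add: zero_le_mult_iff mult_le_0_iff)
    have "is_minimizer R F (\<lambda>\<alpha>. zs \<alpha> + h * v \<alpha>)"
      using feas[of h] h(1) min by (simp add: is_minimizer_def pair_add pair_cmult Rv)
    from unique[OF this] have "h * v \<alpha> = 0" for \<alpha> by (metis add_cancel_left_right)
    then have "v \<alpha> = 0" for \<alpha> using h(1) by simp
    then have "\<forall>u\<in>U. c u = 0" by (intro indep) (simp add: v_def)
    then show False using c(1) by blast
  qed
  then show ?thesis using U zs_eq by blast
qed

section \<open>Limits of relaxation minimizers\<close>

text \<open>The orders \<open>\<sigma> j\<close> tend to infinity, so each polynomial test holds for
  almost all \<open>j\<close> and survives in the limit. The limit functional is then nonnegative on
  every polynomial nonnegative on \<open>K\<close>, and separation applies in degree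
  \<open>t\<close>.\<close>

lemma limit_in_atom_cone:
  fixes c :: "'i \<Rightarrow> ('n::finite \<Rightarrow> nat) \<Rightarrow> real"
  assumes fin: "finite E" "finite I" and c: "\<And>i. i \<in> E \<union> I \<Longrightarrow> is_poly (c i)"
    and y: "\<And>j. y j \<in> relax_feas m a g E I c (\<sigma> j)" and \<sigma>: "strict_mono \<sigma>"
    and lim: "\<And>\<alpha>. (\<lambda>j. y j \<alpha>) \<longlonglongrightarrow> z \<alpha>"
  shows "trunc t z \<in> atom_cone t (Kcirc E I c)"
proof -
  have riesz_lim: "(\<lambda>j. riesz (y j) f) \<longlonglongrightarrow> riesz z f" for f
    unfolding riesz_eq_sum[OF finite_keys order_refl] by (intro tendsto_intros lim)
  have ev: "\<exists>j0. \<forall>j\<ge>j0. Poly_Mapping.keys f \<subseteq> loc_idx (\<sigma> j) q" for f q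
  proof -
    obtain k0 where "\<forall>k\<ge>k0. Poly_Mapping.keys f \<subseteq> loc_idx k q" using keys_subset_loc_idx by blast
    moreover have "j \<le> \<sigma> j" for j using \<sigma> by (rule strict_mono_imp_increasing)
    ultimately show ?thesis by (meson order_trans)
  qed
  have psd_lim: "0 \<le> riesz z (mpoly_of q * (f * f))"
    if "is_poly q" "\<And>j. psd_on (loc_idx (\<sigma> j) q) (loc_mat q (y j))" for q f
  proof -
    obtain j0 where "\<forall>j\<ge>j0. Poly_Mapping.keys f \<subseteq> loc_idx (\<sigma> j) q" using ev by blast
    then have "\<forall>j\<ge>j0. 0 \<le> riesz (y j) (mpoly_of q * (f * f))"
      using riesz_psd[OF that(1,2) finite_loc_idx] by blast
    then show ?thesis using LIMSEQ_le_const[OF riesz_lim] by blast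
  qed
  have zero_lim: "riesz z (mpoly_of q * f) = 0"
    if "is_poly q" "\<And>j. zero_on (loc_idx (\<sigma> j) q) (loc_mat q (y j))" for q f
  proof -
    obtain j0 where "\<forall>j\<ge>j0. Poly_Mapping.keys f \<subseteq> loc_idx (\<sigma> j) q" using ev by blast
    then have "\<forall>j\<ge>j0. riesz (y j) (mpoly_of q * f) = 0"
      using riesz_zero_on[OF that] by blast
    then have "(\<lambda>j. riesz (y j) (mpoly_of q * f)) \<longlonglongrightarrow> 0"
      by (intro tendsto_eventually) (auto simp: eventually_sequentially)
    then show ?thesis using riesz_lim LIMSEQ_unique by blast
  qed
  note feas = y[unfolded relax_feas_def, simplified]
  interpret sphere_functional z
  proof
    fix f :: "'n mpoly"
    show "0 \<le> riesz z (f * f)"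
      using psd_lim[OF is_poly_one, of f] feas by (simp add: mpoly_of_one)
    have "riesz z (mpoly_of sphere_poly * f) = 0"
      using zero_lim[OF is_poly_sphere, of f] feas by simp
    moreover have "(1 - (\<Sum>i\<in>UNIV. Var i * Var i)) * f = - (mpoly_of sphere_poly * f)"
      by (simp add: mpoly_of_sphere algebra_simps)
    ultimately show "riesz z ((1 - (\<Sum>i\<in>UNIV. Var i * Var i)) * f) = 0"
      by (simp add: riesz_uminus)
  qed
  show ?thesis
  proof (rule in_atom_cone_if_nonneg_on_nonneg_polys[OF compact_Kcirc])
    show "supported_deg t (trunc t z)" by (simp add: supported_deg_def trunc_def)
    fix p :: "('n \<Rightarrow> nat) \<Rightarrow> real"
    assume p: "supported_deg t p" "\<And>u. u \<in> Kcirc E I c \<Longrightarrow> 0 \<le> peval p u"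
    have pp: "is_poly p" using p(1) by (rule is_poly_supported_deg)
    have hom: "is_poly (phom (c i))" if "i \<in> E \<union> I" for i using c that by (intro is_poly_phom)
    have "0 \<le> riesz z (mpoly_of p)"
    proof (rule riesz_nonneg[OF fin, of "\<lambda>i. mpoly_of (phom (c i))"])
      fix i assume i: "i \<in> E"
      show "riesz z (mpoly_of (phom (c i)) * mpoly_of (phom (c i))) = 0"
        using feas i hom by (intro zero_lim) auto
    next
      fix j f assume j: "j \<in> I"
      show "0 \<le> riesz z (mpoly_of (phom (c j)) * (f * f))"
        using feas j hom by (intro psd_lim) auto
    next
      fix x :: "real^'n"
      assume "\<And>i. i \<in> E \<Longrightarrow> evalp x (mpoly_of (phom (c i))) = 0"
        "\<And>j. j \<in> I \<Longrightarrow> 0 \<le> evalp x (mpoly_of (phom (c j)))" "x \<bullet> x = 1"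
      then have "x \<in> Kcirc E I c" using hom by (simp add: Kcirc_def evalp_mpoly_of)
      then show "0 \<le> evalp x (mpoly_of p)" using p(2) by (simp add: evalp_mpoly_of[OF pp])
    qed
    also have "riesz z (mpoly_of p) = pair p (trunc t z)"
      unfolding riesz_mpoly_of[OF pp] by (rule pair_cong_deg[OF p(1)]) (simp add: trunc_def)
    finally show "0 \<le> pair p (trunc t z)" .
  qed
qed

text \<open>The same atoms and weights with more moments recorded: genuine moments satisfy all
  localizing conditions, and each \<open>g i\<close> sees only degrees up to \<open>2 * e\<close>.
  This bounds the relaxation values from above.\<close>

lemma atoms_in_relax_feas:
  fixes c :: "'i \<Rightarrow> ('n::finite \<Rightarrow> nat) \<Rightarrow> real"
  assumes c: "\<And>i. i \<in> E \<union> I \<Longrightarrow> is_poly (c i)" and g: "\<And>i. i < m \<Longrightarrow> supported_deg (2 * e) (g i)"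
    and "e \<le> k" and U: "finite U" "U \<subseteq> Kcirc E I c" "\<And>u. u \<in> U \<Longrightarrow> 0 < lam u"
    and feas: "\<And>i. i < m \<Longrightarrow> pair (g i) (\<lambda>\<alpha>. \<Sum>u\<in>U. lam u * mvec (2 * e) u \<alpha>) \<le> a i"
  shows "(\<lambda>\<alpha>. \<Sum>u\<in>U. lam u * mvec (2 * k) u \<alpha>) \<in> relax_feas m a g E I c k"
proof -
  have hom: "is_poly (phom (c i))" if "i \<in> E \<union> I" for i using c that by (intro is_poly_phom)
  have pg: "pair (g i) (\<lambda>\<alpha>. \<Sum>u\<in>U. lam u * mvec (2 * k) u \<alpha>) \<le> a i" if "i < m" for i
  proof -
    have "pair (g i) (\<lambda>\<alpha>. \<Sum>u\<in>U. lam u * mvec (2 * k) u \<alpha>) = pair (g i) (\<lambda>\<alpha>. \<Sum>u\<in>U. lam u * mvec (2 * e) u \<alpha>)"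
      using \<open>e \<le> k\<close> by (intro pair_cong_deg[OF g[OF that]]) (auto simp: mvec_def)
    then show ?thesis using feas[OF that] by simp
  qed
  have lam: "0 \<le> lam u" if "u \<in> U" for u using U(3)[OF that] by simp
  have K: "u \<in> Kcirc E I c" if "u \<in> U" for u using U(2) that by blast
  show ?thesis
    unfolding relax_feas_def mem_Collect_eq
  proof (intro conjI allI impI ballI)
    show "supported_deg (2 * k) (\<lambda>\<alpha>. \<Sum>u\<in>U. lam u * mvec (2 * k) u \<alpha>)"
      by (simp add: supported_deg_def mvec_def)
    show "0 \<le> a i - pair (g i) (\<lambda>\<alpha>. \<Sum>u\<in>U. lam u * mvec (2 * k) u \<alpha>)" if "i < m" for i
      using pg[OF that] by simp
    show "zero_on (loc_idx k (phom (c i))) (loc_mat (phom (c i)) (\<lambda>\<alpha>. \<Sum>u\<in>U. lam u * mvec (2 * k) u \<alpha>))"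
      if "i \<in> E" for i
      by (rule zero_on_loc_mat_atoms[OF hom]) (use K that in \<open>auto simp: Kcirc_def\<close>)
    show "psd_on (loc_idx k (phom (c j))) (loc_mat (phom (c j)) (\<lambda>\<alpha>. \<Sum>u\<in>U. lam u * mvec (2 * k) u \<alpha>))"
      if "j \<in> I" for j
      by (rule psd_on_loc_mat_atoms[OF hom lam]) (use K that in \<open>auto simp: Kcirc_def\<close>)
    show "zero_on (loc_idx k sphere_poly) (loc_mat sphere_poly (\<lambda>\<alpha>. \<Sum>u\<in>U. lam u * mvec (2 * k) u \<alpha>))"
      by (rule zero_on_loc_mat_atoms[OF is_poly_sphere]) (use K in \<open>auto simp: Kcirc_def peval_sphere\<close>)
    show "psd_on (loc_idx k one_poly) (loc_mat one_poly (\<lambda>\<alpha>. \<Sum>u\<in>U. lam u * mvec (2 * k) u \<alpha>))"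
      by (rule psd_on_loc_mat_atoms[OF is_poly_one lam]) (auto simp: peval_one)
  qed
qed

lemma atom_cone_psd:
  assumes "y \<in> atom_cone (2 * e) T"
  shows "psd_on {\<alpha>. mdeg \<alpha> \<le> e} (loc_mat one_poly y)"
proof -
  obtain U lam where "\<And>u. u \<in> U \<Longrightarrow> 0 < lam u" "y = (\<lambda>\<alpha>. \<Sum>u\<in>U. lam u * mvec (2 * e) u \<alpha>)"
    using assms by (auto simp: atom_cone_def)
  then show ?thesis
    using psd_on_loc_mat_atoms[OF is_poly_one, of U lam e] by (simp add: peval_one loc_idx_one less_imp_le)
qed

lemma tendsto_coordinate:
  "(f \<longlongrightarrow> l) F \<Longrightarrow> ((\<lambda>j. f j \<alpha>) \<longlongrightarrow> l \<alpha>) F"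
  by (rule continuous_on_tendsto_compose[OF continuous_on_coordinate[of UNIV \<alpha>]]) auto

text \<open>A box is compact in the product topology, and the countable index type makes it
  sequentially compact.\<close>

lemma bounded_sequence_pointwise_subsequence:
  fixes y :: "nat \<Rightarrow> 'a::countable \<Rightarrow> real"
  assumes "\<And>j \<alpha>. \<bar>y j \<alpha>\<bar> \<le> B"
  shows "\<exists>\<rho> z. strict_mono \<rho> \<and> (\<forall>\<alpha>. (\<lambda>j. y (\<rho> j) \<alpha>) \<longlonglongrightarrow> z \<alpha>)"
proof -
  have "seq_compact (PiE UNIV (\<lambda>_::'a. {- B..B}))"
    by (intro compact_imp_seq_compact compact_product_UNIV) simp
  moreover have "\<forall>j. y j \<in> PiE UNIV (\<lambda>_. {- B..B})"
    using assms by (auto simp: abs_le_iff minus_le_iff)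
  ultimately obtain z \<rho> where \<rho>: "strict_mono \<rho>" "(y \<circ> \<rho>) \<longlonglongrightarrow> z"
    unfolding seq_compact_def by blast
  have "(\<lambda>j. y (\<rho> j) \<alpha>) \<longlonglongrightarrow> z \<alpha>" for \<alpha>
    using tendsto_coordinate[OF \<rho>(2)] by (simp add: o_def)
  with \<rho>(1) show ?thesis by blast
qed

text \<open>The given limit fixes only the moments up to degree \<open>2 * t\<close>. A further
  subsequence converges in all coordinates to some \<open>z\<close>, which agrees with
  \<open>w\<close> up to degree \<open>2 * e\<close>, so the conclusions for \<open>z\<close> carry
  over to \<open>w\<close>.\<close>

lemma relaxation_limit_point:
  fixes c :: "'i \<Rightarrow> ('n::finite \<Rightarrow> nat) \<Rightarrow> real"
  assumes fin: "finite E" "finite I" and c: "\<And>i. i \<in> E \<union> I \<Longrightarrow> is_poly (c i)"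
    and g: "\<And>i. i < m \<Longrightarrow> supported_deg (2 * e) (g i)" and R: "supported_deg (2 * e) R"
    and feas: "\<And>j. y j \<in> relax_feas m a g E I c (\<sigma> j)" and \<sigma>: "strict_mono \<sigma>"
    and val: "\<And>j. pair R (y j) \<le> b" and bd: "\<And>j \<alpha>. \<bar>y j \<alpha>\<bar> \<le> B"
    and "e \<le> t" and w: "(\<lambda>j. trunc (2 * t) (y j)) \<longlonglongrightarrow> w"
  shows "trunc (2 * e) w \<in> {z \<in> atom_cone (2 * e) (Kcirc E I c). \<forall>i<m. a i - pair (g i) z \<ge> 0}"
    and "pair R (trunc (2 * e) w) \<le> b"
proof -
  obtain \<rho> z where \<rho>: "strict_mono \<rho>" and z: "\<And>\<alpha>. (\<lambda>j. y (\<rho> j) \<alpha>) \<longlonglongrightarrow> z \<alpha>"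
    using bounded_sequence_pointwise_subsequence[of y B, OF bd] by blast
  have "trunc (2 * e) z \<in> atom_cone (2 * e) (Kcirc E I c)"
    using strict_mono_compose[OF \<sigma> \<rho>]
    by (intro limit_in_atom_cone[OF fin c, where y = "\<lambda>j. y (\<rho> j)"
        and \<sigma> = "\<lambda>j. \<sigma> (\<rho> j)" and m = m and a = a and g = g] feas z) auto
  moreover have pair_lim: "(\<lambda>j. pair p (y (\<rho> j))) \<longlonglongrightarrow> pair p (trunc (2 * e) z)"
    if "supported_deg (2 * e) p" for p
  proof -
    have "(\<lambda>j. pair p (y (\<rho> j))) \<longlonglongrightarrow> pair p z"
      unfolding pair_def by (intro tendsto_intros z)
    then show ?thesis
      using pair_cong_deg[OF that, of "trunc (2 * e) z" z] by (simp add: trunc_def)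
  qed
  have "pair (g i) (trunc (2 * e) z) \<le> a i" if "i < m" for i
    using feas that by (intro LIMSEQ_le_const2[OF pair_lim[OF g]]) (auto simp: relax_feas_def)
  moreover have "trunc (2 * e) z = trunc (2 * e) w"
  proof
    fix \<alpha>
    have "z \<alpha> = w \<alpha>" if "mdeg \<alpha> \<le> 2 * e"
    proof -
      have "(\<lambda>j. trunc (2 * t) (y j) \<alpha>) \<longlonglongrightarrow> w \<alpha>"
        by (rule tendsto_coordinate[OF w])
      moreover have "mdeg \<alpha> \<le> 2 * t" using that \<open>e \<le> t\<close> by simp
      ultimately have "(\<lambda>j. y j \<alpha>) \<longlonglongrightarrow> w \<alpha>" by (simp add: trunc_def)
      from LIMSEQ_subseq_LIMSEQ[OF this \<rho>] show ?thesis
        using z[of \<alpha>] LIMSEQ_unique by (auto simp: o_def)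
    qed
    then show "trunc (2 * e) z \<alpha> = trunc (2 * e) w \<alpha>" by (simp add: trunc_def)
  qed
  ultimately show "trunc (2 * e) w \<in> {z \<in> atom_cone (2 * e) (Kcirc E I c). \<forall>i<m. a i - pair (g i) z \<ge> 0}"
    by simp
  show "pair R (trunc (2 * e) w) \<le> b"
    unfolding \<open>trunc (2 * e) z = trunc (2 * e) w\<close>[symmetric]
    using val by (intro LIMSEQ_le_const2[OF pair_lim[OF R]]) auto
qed

section \<open>Existence, uniqueness and convergence for a generic objective\<close>

theorem theorem4p4:
  fixes c :: "'i \<Rightarrow> ('n::finite \<Rightarrow> nat) \<Rightarrow> real" and E I :: "'i set"
    and g :: "nat \<Rightarrow> ('n \<Rightarrow> nat) \<Rightarrow> real" and a :: "nat \<Rightarrow> real" and m d :: nat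
  assumes "finite E" and "finite I"
    and "\<forall>i\<in>E \<union> I. is_poly (c i)"
    and "\<forall>i<m. is_poly (g i) \<and> pdeg (g i) \<le> d"
    and "\<exists>z \<in> moment_cone d (Kcirc E I c). \<forall>i<m. a i \<ge> pair (g i) z"
  defines "d1 \<equiv> (d + 1) div 2"
  defines "d2 \<equiv> max d1 (dc E I c)"
  shows "\<exists>N \<in> null_sets (PiM {\<alpha>. mdeg \<alpha> \<le> 2 * d1} (\<lambda>_. lborel)).
     \<forall>R \<in> sos_interior d1. restrict R {\<alpha>. mdeg \<alpha> \<le> 2 * d1} \<notin> N \<longrightarrow>
       (\<exists>!z. is_minimizer R (outer_feas m a g E I c d1) z) \<and>
       (\<forall>zs. is_minimizer R (outer_feas m a g E I c d1) zs \<longrightarrow>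
          (\<exists>U lam. finite U \<and> U \<subseteq> Kcirc E I c \<and> card U \<le> m \<and> (\<forall>u\<in>U. lam u > (0::real)) \<and>
                   zs = (\<lambda>\<alpha>. \<Sum>u\<in>U. lam u * mvec (2 * d1) u \<alpha>)) \<and>
          (\<forall>zk. (\<forall>k\<ge>d2. is_minimizer R (relax_feas m a g E I c k) (zk k)) \<longrightarrow>
             (\<forall>t\<ge>d1.
                (\<exists>B. \<forall>k\<ge>d2. \<forall>\<alpha>. mdeg \<alpha> \<le> 2 * t \<longrightarrow> \<bar>zk k \<alpha>\<bar> \<le> B) \<and>
                (\<forall>w \<sigma>. strict_mono \<sigma> \<and> (\<forall>j. d2 \<le> \<sigma> j) \<and>
                        (\<lambda>j. trunc (2 * t) (zk (\<sigma> j))) \<longlonglongrightarrow> w \<longrightarrow>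
                        trunc (2 * d1) w = zs))))"
proof -
  define K where "K = Kcirc E I c"
  have K: "compact K" unfolding K_def by (rule compact_Kcirc)
  define A where "A = {\<alpha> :: 'n \<Rightarrow> nat. mdeg \<alpha> \<le> 2 * d1}"
  have A: "finite A" unfolding A_def by (rule finite_mdeg_le)
  have "d \<le> 2 * d1" by (simp add: d1_def)
  have gd: "supported_deg d (g i)" if "i < m" for i using assms(4) that by (intro pdeg_le_supported) auto
  have g: "supported_deg (2 * d1) (g i)" if "i < m" for i
    using gd[OF that] \<open>d \<le> 2 * d1\<close> by (rule supported_deg_mono)
  define F where "F = outer_feas m a g E I c d1"
  have F: "F = {z \<in> atom_cone (2 * d1) K. \<forall>i<m. a i - pair (g i) z \<ge> 0}"
    unfolding F_def outer_feas_def K_def atom_cone_eq_moment_cone[OF compact_Kcirc] ..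
  have "\<exists>z. z \<in> F"
  proof -
    obtain z where z: "z \<in> atom_cone d K" "\<And>i. i < m \<Longrightarrow> pair (g i) z \<le> a i"
      using assms(5) unfolding atom_cone_eq_moment_cone[OF compact_Kcirc] K_def by blast
    from z(1) obtain U lam where U: "finite U" "U \<subseteq> K" "\<And>u. u \<in> U \<Longrightarrow> 0 < lam u"
      "z = (\<lambda>\<alpha>. \<Sum>u\<in>U. lam u * mvec d u \<alpha>)" unfolding atom_cone_def by blast
    \<comment> \<open>Feasibility is given in degree \<open>d\<close>, but \<open>2 * d1\<close> is
      \<open>d + 1\<close> for odd \<open>d\<close>. Reusing the atoms supplies the missing moments,
      and the \<open>g i\<close> cannot see them.\<close>
    define z' where "z' = (\<lambda>\<alpha>. \<Sum>u\<in>U. lam u * mvec (2 * d1) u \<alpha>)"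
    have "pair (g i) z' = pair (g i) z" if "i < m" for i
      using \<open>d \<le> 2 * d1\<close> by (intro pair_cong_deg[OF gd[OF that]]) (simp add: z'_def U(4) mvec_def)
    moreover have "z' \<in> atom_cone (2 * d1) K"
      unfolding z'_def using U by (intro atom_cone_nonneg_weights) (auto simp: less_imp_le)
    ultimately show ?thesis using z by (auto simp: F)
  qed
  then obtain z0 where z0: "z0 \<in> F" by blast
  \<comment> \<open>These slices do not depend on \<open>R\<close>, so the union of their null sets
    can be fixed before the objective.\<close>
  define Fs where "Fs = (\<lambda>s::nat. F \<inter> {z. z (\<lambda>_. 0) \<le> real s})"
  have Fs: "compact (Fs s)" for s
  proof -
    have "Fs s = {y \<in> atom_cone (2 * d1) K. y (\<lambda>_. 0) \<le> real s} \<inter> (\<Inter>i\<in>{..<m}. {z. pair (g i) z \<le> a i})"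
      by (auto simp: Fs_def F)
    then show ?thesis
      by (simp only:) (intro compact_Int_closed compact_atom_cone_bounded_mass[OF K] closed_INT ballI closed_pair_le)
  qed
  define Q where "Q = (\<lambda>s N. \<forall>R z z'. restrict R A \<notin> N \<longrightarrow> z \<in> Fs s \<longrightarrow> z' \<in> Fs s \<longrightarrow>
       (\<forall>w\<in>Fs s. (\<Sum>\<beta>\<in>A. R \<beta> * z \<beta>) \<le> (\<Sum>\<beta>\<in>A. R \<beta> * w \<beta>)) \<longrightarrow>
       (\<forall>w\<in>Fs s. (\<Sum>\<beta>\<in>A. R \<beta> * z' \<beta>) \<le> (\<Sum>\<beta>\<in>A. R \<beta> * w \<beta>)) \<longrightarrow> (\<forall>\<alpha>\<in>A. z \<alpha> = z' \<alpha>))"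
  have "\<forall>s. \<exists>N. N \<in> null_sets (PiM A (\<lambda>_. lborel)) \<and> Q s N"
    unfolding Q_def using generic_unique_minimizer[OF A Fs] by (simp add: Bex_def)
  from choice[OF this] obtain N where N: "\<And>s. N s \<in> null_sets (PiM A (\<lambda>_. lborel))"
    and Q: "\<And>s. Q s (N s)"
    by blast
  have main: "(\<exists>!z. is_minimizer R F z) \<and>
       (\<forall>zs. is_minimizer R F zs \<longrightarrow>
          (\<exists>U lam. finite U \<and> U \<subseteq> K \<and> card U \<le> m \<and> (\<forall>u\<in>U. lam u > (0::real)) \<and>
                   zs = (\<lambda>\<alpha>. \<Sum>u\<in>U. lam u * mvec (2 * d1) u \<alpha>)) \<and>
          (\<forall>zk. (\<forall>k\<ge>d2. is_minimizer R (relax_feas m a g E I c k) (zk k)) \<longrightarrow>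
             (\<forall>t\<ge>d1.
                (\<exists>B. \<forall>k\<ge>d2. \<forall>\<alpha>. mdeg \<alpha> \<le> 2 * t \<longrightarrow> \<bar>zk k \<alpha>\<bar> \<le> B) \<and>
                (\<forall>w \<sigma>. strict_mono \<sigma> \<and> (\<forall>j. d2 \<le> \<sigma> j) \<and>
                        (\<lambda>j. trunc (2 * t) (zk (\<sigma> j))) \<longlonglongrightarrow> w \<longrightarrow>
                        trunc (2 * d1) w = zs))))"
    if Rint: "R \<in> sos_interior d1" and RN: "restrict R A \<notin> (\<Union>s. N s)" for R
  proof -
    have R: "supported_deg (2 * d1) R" using Rint by (intro sos_cone_supported) (simp add: sos_interior_def)
    have pair_R: "pair R z = (\<Sum>\<beta>\<in>A. R \<beta> * z \<beta>)" for z unfolding A_def by (rule pair_eq_sum[OF R])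
    obtain \<delta> where \<delta>: "0 < \<delta>" and coercive:
      "\<And>z. psd_on {\<alpha>. mdeg \<alpha> \<le> d1} (loc_mat one_poly z) \<Longrightarrow> \<delta> * z (\<lambda>_. 0) \<le> pair R z"
      using sos_interior_coercive[OF Rint] by blast
    have mass: "z (\<lambda>_. 0) \<le> pair R z / \<delta>" if "z \<in> F" for z
      using coercive[OF atom_cone_psd[of z d1 K]] that \<delta> by (simp add: F field_simps)
    have unique: "z = z'" if z: "is_minimizer R F z" "is_minimizer R F z'" for z z'
    proof -
      obtain s :: nat where s: "max (z (\<lambda>_. 0)) (z' (\<lambda>_. 0)) \<le> real s" using real_arch_simple by blast
      have "\<forall>\<alpha>\<in>A. z \<alpha> = z' \<alpha>"
      proof (rule Q[of s, unfolded Q_def, THEN spec, THEN spec, THEN spec, THEN mp, THEN mp, THEN mp, THEN mp, THEN mp])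
        show "restrict R A \<notin> N s" using RN by blast
        show "z \<in> Fs s" "z' \<in> Fs s" using z s by (auto simp: Fs_def is_minimizer_def)
        show "\<forall>w\<in>Fs s. (\<Sum>\<beta>\<in>A. R \<beta> * z \<beta>) \<le> (\<Sum>\<beta>\<in>A. R \<beta> * w \<beta>)"
          "\<forall>w\<in>Fs s. (\<Sum>\<beta>\<in>A. R \<beta> * z' \<beta>) \<le> (\<Sum>\<beta>\<in>A. R \<beta> * w \<beta>)"
          using z by (auto simp: Fs_def is_minimizer_def pair_R)
      qed
      moreover have "supported_deg (2 * d1) z" "supported_deg (2 * d1) z'"
        using z by (auto simp: is_minimizer_def F intro: atom_cone_supported)
      ultimately show ?thesis
        by (auto simp: fun_eq_iff supported_deg_def A_def) (metis not_less)
    qed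
    have "\<exists>z. is_minimizer R F z"
    proof -
      obtain s :: nat where s: "pair R z0 / \<delta> \<le> real s" using real_arch_simple by blast
      \<comment> \<open>Every competitor no worse than \<open>z0\<close> has bounded mass by
        coercivity, so minimizing over one slice minimizes over \<open>F\<close>.\<close>
      have small: "w \<in> Fs s" if "w \<in> F" "pair R w \<le> pair R z0" for w
      proof -
        have "w (\<lambda>_. 0) \<le> pair R w / \<delta>" by (rule mass[OF that(1)])
        also have "\<dots> \<le> pair R z0 / \<delta>" using that(2) \<delta> by (intro divide_right_mono) auto
        finally show ?thesis using s that by (simp add: Fs_def)
      qed
      have z0s: "z0 \<in> Fs s" using small z0 by blast
      then obtain z where z: "z \<in> Fs s" "\<And>w. w \<in> Fs s \<Longrightarrow> pair R z \<le> pair R w"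
        using continuous_attains_inf[OF Fs[of s] _ continuous_on_pair, of R] by blast
      have "pair R z \<le> pair R w" if "w \<in> F" for w
        using small[OF that] z(2)[of w] z(2)[OF z0s] by linarith
      then show ?thesis using z(1) by (auto simp: is_minimizer_def Fs_def)
    qed
    then have ex1: "\<exists>!z. is_minimizer R F z" using unique by blast
    have atoms: "\<exists>U lam. finite U \<and> U \<subseteq> K \<and> card U \<le> m \<and> (\<forall>u\<in>U. lam u > 0) \<and>
        zs = (\<lambda>\<alpha>. \<Sum>u\<in>U. lam u * mvec (2 * d1) u \<alpha>)" if zs: "is_minimizer R F zs" for zs
      using unique_minimizer_few_atoms[OF F zs] unique zs by blast
    have bound: "pair R (y) \<le> pair R zs \<and> (\<forall>\<alpha>. \<bar>y \<alpha>\<bar> \<le> pair R zs / \<delta>)"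
      if zs: "is_minimizer R F zs" and min: "is_minimizer R (relax_feas m a g E I c k) (y)"
        and k: "d2 \<le> k" for zs y k
    proof -
      have "d1 \<le> k" using k by (simp add: d2_def)
      obtain U lam where U: "finite U" "U \<subseteq> K" "\<And>u. u \<in> U \<Longrightarrow> 0 < lam u"
        "zs = (\<lambda>\<alpha>. \<Sum>u\<in>U. lam u * mvec (2 * d1) u \<alpha>)" using atoms[OF zs] by blast
      \<comment> \<open>The atoms of \<open>zs\<close> give a feasible point of the relaxation with
        the same objective value, since \<open>R\<close> has degree at most
        \<open>2 * d1\<close>.\<close>
      let ?x = "\<lambda>\<alpha>. \<Sum>u\<in>U. lam u * mvec (2 * k) u \<alpha>"
      have "?x \<in> relax_feas m a g E I c k"
      proof (rule atoms_in_relax_feas[where e = d1])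
        show "pair (g i) (\<lambda>\<alpha>. \<Sum>u\<in>U. lam u * mvec (2 * d1) u \<alpha>) \<le> a i" if "i < m" for i
          using zs that by (simp add: is_minimizer_def F U(4))
      qed (use assms(3) g \<open>d1 \<le> k\<close> U in \<open>auto simp: K_def\<close>)
      then have "pair R (y) \<le> pair R ?x" using min by (simp add: is_minimizer_def)
      also have "pair R ?x = pair R zs"
        using \<open>d1 \<le> k\<close> by (intro pair_cong_deg[OF R]) (auto simp: U(4) mvec_def)
      finally have le: "pair R (y) \<le> pair R zs" .
      have feas: "supported_deg (2 * k) (y)"
        "zero_on (loc_idx k sphere_poly) (loc_mat sphere_poly (y))"
        "psd_on (loc_idx k one_poly) (loc_mat one_poly (y))"
        using min by (auto simp: is_minimizer_def relax_feas_def)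
      have "psd_on {\<alpha>. mdeg \<alpha> \<le> d1} (loc_mat one_poly (y))"
        using \<open>d1 \<le> k\<close> by (intro psd_on_subset[OF feas(3) _ finite_loc_idx]) (auto simp: loc_idx_one)
      from coercive[OF this] le have "\<delta> * y (\<lambda>_. 0) \<le> pair R zs" by simp
      then have "y (\<lambda>_. 0) \<le> pair R zs / \<delta>" using \<delta> by (simp add: field_simps)
      then have "\<bar>y \<alpha>\<bar> \<le> pair R zs / \<delta>" for \<alpha>
        using pseudo_moment_bound[OF feas, of \<alpha>] by linarith
      then show ?thesis using le by blast
    qed
    have limit: "trunc (2 * d1) w = zs"
      if zs: "is_minimizer R F zs" and zk: "\<And>k. d2 \<le> k \<Longrightarrow> is_minimizer R (relax_feas m a g E I c k) (zk k)"
        and t: "d1 \<le> t" and \<sigma>: "strict_mono \<sigma>" "\<And>j. d2 \<le> \<sigma> j"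
        and w: "(\<lambda>j. trunc (2 * t) (zk (\<sigma> j))) \<longlonglongrightarrow> w" for zs zk t w \<sigma>
    proof -
      have feas: "\<And>j. zk (\<sigma> j) \<in> relax_feas m a g E I c (\<sigma> j)"
        using zk[OF \<sigma>(2)] by (simp add: is_minimizer_def)
      have bd: "\<And>j. pair R (zk (\<sigma> j)) \<le> pair R zs" "\<And>j \<alpha>. \<bar>zk (\<sigma> j) \<alpha>\<bar> \<le> pair R zs / \<delta>"
        using bound[OF zs zk[OF \<sigma>(2)] \<sigma>(2)] by blast+
      have c: "\<And>i. i \<in> E \<union> I \<Longrightarrow> is_poly (c i)" using assms(3) by blast
      \<comment> \<open>The truncated limit is feasible and its value is at most the minimum, so it
        is a minimizer and uniqueness identifies it with \<open>zs\<close>.\<close>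
      note lim = relaxation_limit_point[OF assms(1,2) c g R feas \<sigma>(1) bd t w]
      have "trunc (2 * d1) w \<in> F" using lim(1) unfolding F K_def .
      moreover have "pair R (trunc (2 * d1) w) \<le> pair R zs" by (rule lim(2))
      ultimately have "is_minimizer R F (trunc (2 * d1) w)"
        using zs unfolding is_minimizer_def by (meson order_trans)
      then show ?thesis using unique zs by blast
    qed
    show ?thesis
    proof (intro conjI allI impI ex1 atoms)
      fix zs zk t
      assume zs: "is_minimizer R F zs"
        and zk: "\<forall>k\<ge>d2. is_minimizer R (relax_feas m a g E I c k) (zk k)" and t: "d1 \<le> t"
      show "\<exists>B. \<forall>k\<ge>d2. \<forall>\<alpha>. mdeg \<alpha> \<le> 2 * t \<longrightarrow> \<bar>zk k \<alpha>\<bar> \<le> B"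
        using bound[OF zs] zk by blast
      fix w \<sigma>
      assume "strict_mono \<sigma> \<and> (\<forall>j. d2 \<le> \<sigma> j) \<and> (\<lambda>j. trunc (2 * t) (zk (\<sigma> j))) \<longlonglongrightarrow> w"
      then show "trunc (2 * d1) w = zs" using zk t by (intro limit[OF zs]) auto
    qed
  qed
  show ?thesis
  proof (rule bexI[of _ "\<Union>s. N s"])
    show "(\<Union>s. N s) \<in> null_sets (PiM {\<alpha>. mdeg \<alpha> \<le> 2 * d1} (\<lambda>_. lborel))"
      using N unfolding A_def by (intro null_sets_UN)
    show "\<forall>R\<in>sos_interior d1. restrict R {\<alpha>. mdeg \<alpha> \<le> 2 * d1} \<notin> (\<Union>s. N s) \<longrightarrow>
       (\<exists>!z. is_minimizer R (outer_feas m a g E I c d1) z) \<and>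
       (\<forall>zs. is_minimizer R (outer_feas m a g E I c d1) zs \<longrightarrow>
          (\<exists>U lam. finite U \<and> U \<subseteq> Kcirc E I c \<and> card U \<le> m \<and> (\<forall>u\<in>U. lam u > (0::real)) \<and>
                   zs = (\<lambda>\<alpha>. \<Sum>u\<in>U. lam u * mvec (2 * d1) u \<alpha>)) \<and>
          (\<forall>zk. (\<forall>k\<ge>d2. is_minimizer R (relax_feas m a g E I c k) (zk k)) \<longrightarrow>
             (\<forall>t\<ge>d1.
                (\<exists>B. \<forall>k\<ge>d2. \<forall>\<alpha>. mdeg \<alpha> \<le> 2 * t \<longrightarrow> \<bar>zk k \<alpha>\<bar> \<le> B) \<and>
                (\<forall>w \<sigma>. strict_mono \<sigma> \<and> (\<forall>j. d2 \<le> \<sigma> j) \<and>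
                        (\<lambda>j. trunc (2 * t) (zk (\<sigma> j))) \<longlonglongrightarrow> w \<longrightarrow>
                        trunc (2 * d1) w = zs))))"
      by (intro ballI impI main[unfolded A_def F_def K_def])
  qed
qed

end
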